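(* There is no compact steady Ricci breather other than the one which is Ricci-flat. That is: let $M$ be a closed connected manifold and $\mathbf{g}(t)$, $t\in[t_1,t_2]$ with $t_1<t_2$, a solution to the Ricci flow $\frac{\partial}{\partial t}\mathbf{g}_{ij}=-2R_{ij}$ on $M$ such that $\mathbf{g}(t_1)$ and $\mathbf{g}(t_2)$ differ only by a diffeomorphism of $M$. Then $\mathbf{g}(t)$ is Ricci-flat.
   Context: A metric $\mathbf{g}(t)$ evolving by the Ricci flow is called a breather if for some $t_1<t_2$ and $\alpha>0$ the metrics $\alpha\mathbf{g}(t_1)$ and $\mathbf{g}(t_2)$ differ only by a diffeomorphism, i.e. $\mathbf{g}(t_2)=\alpha\Phi^*\mathbf{g}(t_1)$ for a diffeomorphism $\Phi$ of $M$; the cases $\alpha=1$, $\alpha<1$, $\alpha>1$ correspond to steady, shrinking and expanding breathers, respectively. $R_{ij}$ denotes the Ricci tensor. *)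

theory Defs
  imports "HOL-Analysis.Analysis"
begin

section \<open>Smooth functions\<close>

text \<open>The derivatives are taken within \<open>S\<close>, and \<^const>\<open>frechet_derivative\<close> is only meaningful
  where they are unique. Below, \<open>S\<close> is either open, where this is ordinary smoothness, or of the form
  \<open>{t1..t2} \<times> V\<close> with \<open>t1 < t2\<close> and \<open>V\<close> open, where it is smoothness up to the two end times
  (with one-sided time derivatives there).\<close>

primrec C_k_on :: "nat \<Rightarrow> 'a::real_normed_vector set \<Rightarrow> ('a \<Rightarrow> 'b::real_normed_vector) \<Rightarrow> bool"
  where
    "C_k_on 0 S f \<longleftrightarrow> continuous_on S f"
  | "C_k_on (Suc k) S f \<longleftrightarrow> f differentiable_on S \<and>
       (\<forall>v. C_k_on k S (\<lambda>x. frechet_derivative f (at x within S) v))"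

definition smooth_on :: "'a::real_normed_vector set \<Rightarrow> ('a \<Rightarrow> 'b::real_normed_vector) \<Rightarrow> bool"
  where "smooth_on S f \<longleftrightarrow> (\<forall>k. C_k_on k S f)"


section \<open>Smooth manifolds\<close>

text \<open>A chart is a pair of its domain and its coordinate map; the values of the coordinate map
  outside the domain are irrelevant.\<close>

type_synonym ('a, 'n) chart = "'a set \<times> ('a \<Rightarrow> real ^ 'n)"

abbreviation dom_of :: "('a, 'n::finite) chart \<Rightarrow> 'a set"
  where "dom_of c \<equiv> fst c"

abbreviation coord :: "('a, 'n::finite) chart \<Rightarrow> 'a \<Rightarrow> real ^ 'n"
  where "coord c \<equiv> snd c"

abbreviation param :: "('a, 'n::finite) chart \<Rightarrow> real ^ 'n \<Rightarrow> 'a"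
  where "param c \<equiv> inv_into (dom_of c) (coord c)"

definition is_chart :: "'a topology \<Rightarrow> ('a, 'n::finite) chart \<Rightarrow> bool"
  where "is_chart X c \<longleftrightarrow> openin X (dom_of c) \<and> open (coord c ` dom_of c) \<and>
    homeomorphic_map (subtopology X (dom_of c)) (top_of_set (coord c ` dom_of c)) (coord c)"

text \<open>\<open>A\<close> need not be maximal: it only serves to determine the smooth structure.\<close>

definition smooth_atlas :: "'a topology \<Rightarrow> ('a, 'n::finite) chart set \<Rightarrow> bool"
  where "smooth_atlas X A \<longleftrightarrow>
    (\<forall>c\<in>A. is_chart X c) \<and> (\<Union>c\<in>A. dom_of c) = topspace X \<and>
    (\<forall>c\<in>A. \<forall>d\<in>A. smooth_on (coord c ` (dom_of c \<inter> dom_of d)) (coord d \<circ> param c))"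

definition smooth_manifold :: "'a topology \<Rightarrow> ('a, 'n::finite) chart set \<Rightarrow> bool"
  where "smooth_manifold X A \<longleftrightarrow>
    Hausdorff_space X \<and> second_countable X \<and> smooth_atlas X A"

text \<open>Charts map onto open subsets of the full Euclidean space, so there is no boundary.\<close>

definition closed_connected_manifold :: "'a topology \<Rightarrow> ('a, 'n::finite) chart set \<Rightarrow> bool"
  where "closed_connected_manifold X A \<longleftrightarrow>
    smooth_manifold X A \<and> compact_space X \<and> connected_space X"

definition smooth_map :: "'a topology \<Rightarrow> ('a, 'n::finite) chart set \<Rightarrow> ('a \<Rightarrow> 'a) \<Rightarrow> bool"
  where "smooth_map X A \<Phi> \<longleftrightarrow> continuous_map X X \<Phi> \<and>
    (\<forall>c\<in>A. \<forall>d\<in>A. smooth_on (coord c ` {p \<in> dom_of c. \<Phi> p \<in> dom_of d}) (coord d \<circ> \<Phi> \<circ> param c))"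

definition diffeomorphism :: "'a topology \<Rightarrow> ('a, 'n::finite) chart set \<Rightarrow> ('a \<Rightarrow> 'a) \<Rightarrow> bool"
  where "diffeomorphism X A \<Phi> \<longleftrightarrow> smooth_map X A \<Phi> \<and>
    (\<exists>\<Psi>. smooth_map X A \<Psi> \<and> (\<forall>p\<in>topspace X. \<Psi> (\<Phi> p) = p \<and> \<Phi> (\<Psi> p) = p))"


section \<open>Riemannian metrics\<close>

text \<open>A covariant 2-tensor field \<open>h\<close> is given by its components: \<open>h c p $ i $ j\<close> is the component
  \<open>h\<^sub>i\<^sub>j\<close> at the point \<open>p\<close> with respect to the coordinates of the chart \<open>c\<close>. Only the values for
  \<open>c \<in> A\<close> and \<open>p \<in> dom_of c\<close> matter.\<close>

type_synonym ('a, 'n) tensor2 = "('a, 'n) chart \<Rightarrow> 'a \<Rightarrow> real ^ 'n ^ 'n"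

text \<open>The matrix form of \<open>h\<^sub>i\<^sub>j = (\<partial>y\<^sup>k/\<partial>x\<^sup>i) (\<partial>y\<^sup>l/\<partial>x\<^sup>j) h\<^sub>k\<^sub>l\<close>, where \<open>J\<close> is the Jacobian matrix of
  the coordinates \<open>y\<close> as functions of the coordinates \<open>x\<close>.\<close>

definition congr_transform :: "real ^ 'n ^ 'n \<Rightarrow> real ^ 'n ^ 'n \<Rightarrow> real ^ 'n ^ 'n::finite"
  where "congr_transform J h = transpose J ** h ** J"

definition tensor_field :: "('a, 'n::finite) chart set \<Rightarrow> ('a, 'n) tensor2 \<Rightarrow> bool"
  where "tensor_field A h \<longleftrightarrow>
    (\<forall>c\<in>A. \<forall>d\<in>A. \<forall>p \<in> dom_of c \<inter> dom_of d.
      h c p = congr_transform (jacobian (coord d \<circ> param c) (at (coord c p))) (h d p))"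

definition riemannian_metric :: "('a, 'n::finite) chart set \<Rightarrow> ('a, 'n) tensor2 \<Rightarrow> bool"
  where "riemannian_metric A g \<longleftrightarrow> tensor_field A g \<and>
    (\<forall>c\<in>A. smooth_on (coord c ` dom_of c) (g c \<circ> param c)) \<and>
    (\<forall>c\<in>A. \<forall>p\<in>dom_of c. transpose (g c p) = g c p \<and> (\<forall>v. v \<noteq> 0 \<longrightarrow> v \<bullet> (g c p *v v) > 0))"

text \<open>The pullback \<open>\<Phi>\<^sup>*h\<close>. For a tensor field \<open>h\<close> the result does not depend on the chart \<open>d\<close>
  chosen around \<open>\<Phi> p\<close>.\<close>

definition pullback ::
  "('a, 'n::finite) chart set \<Rightarrow> ('a \<Rightarrow> 'a) \<Rightarrow> ('a, 'n) tensor2 \<Rightarrow> ('a, 'n) tensor2"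
  where "pullback A \<Phi> h c p =
    (let d = (SOME d. d \<in> A \<and> \<Phi> p \<in> dom_of d)
     in congr_transform (jacobian (coord d \<circ> \<Phi> \<circ> param c) (at (coord c p))) (h d (\<Phi> p)))"


section \<open>Ricci curvature\<close>

definition pderiv_coord :: "'n \<Rightarrow> (real ^ 'n \<Rightarrow> real) \<Rightarrow> real ^ 'n \<Rightarrow> real"
  where "pderiv_coord i f x = frechet_derivative f (at x) (axis i 1)" for i :: "'n::finite"

text \<open>\<open>christoffel G k i j\<close> is \<open>\<Gamma>\<^sup>k\<^sub>i\<^sub>j\<close>.\<close>

definition christoffel ::
  "(real ^ 'n \<Rightarrow> real ^ 'n ^ 'n) \<Rightarrow> 'n \<Rightarrow> 'n \<Rightarrow> 'n \<Rightarrow> real ^ 'n \<Rightarrow> real"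
  where "christoffel G k i j x = (\<Sum>l\<in>UNIV. matrix_inv (G x) $ k $ l *
      (pderiv_coord i (\<lambda>y. G y $ j $ l) x + pderiv_coord j (\<lambda>y. G y $ i $ l) x
       - pderiv_coord l (\<lambda>y. G y $ i $ j) x)) / 2" for i :: "'n::finite"

text \<open>\<open>riemann_curv G l k i j\<close> is the component \<open>R\<^sup>l\<^sub>k\<^sub>i\<^sub>j\<close> in
  \<open>R(\<partial>\<^sub>i, \<partial>\<^sub>j) \<partial>\<^sub>k = R\<^sup>l\<^sub>k\<^sub>i\<^sub>j \<partial>\<^sub>l\<close> with \<open>R(X, Y) = \<nabla>\<^sub>X \<nabla>\<^sub>Y - \<nabla>\<^sub>Y \<nabla>\<^sub>X - \<nabla>\<^bsub>[X, Y]\<^esub>\<close>. The Ricci tensor is the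
  contraction \<open>R\<^sub>j\<^sub>k = R\<^sup>i\<^sub>k\<^sub>i\<^sub>j\<close>; with these signs it is positive on round spheres.\<close>

definition riemann_curv ::
  "(real ^ 'n \<Rightarrow> real ^ 'n ^ 'n) \<Rightarrow> 'n \<Rightarrow> 'n \<Rightarrow> 'n \<Rightarrow> 'n \<Rightarrow> real ^ 'n \<Rightarrow> real"
  where "riemann_curv G l k i j x =
      pderiv_coord i (christoffel G l j k) x - pderiv_coord j (christoffel G l i k) x
      + (\<Sum>m\<in>UNIV. christoffel G l i m x * christoffel G m j k x
                   - christoffel G l j m x * christoffel G m i k x)" for i :: "'n::finite"

definition ricci_matrix :: "(real ^ 'n \<Rightarrow> real ^ 'n ^ 'n) \<Rightarrow> real ^ 'n \<Rightarrow> real ^ 'n ^ 'n::finite"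
  where "ricci_matrix G x = (\<chi> j k. \<Sum>i\<in>UNIV. riemann_curv G i k i j x)"

definition ricci :: "('a, 'n::finite) tensor2 \<Rightarrow> ('a, 'n) tensor2"
  where "ricci g c p = ricci_matrix (g c \<circ> param c) (coord c p)"

definition ricci_flat :: "('a, 'n::finite) chart set \<Rightarrow> ('a, 'n) tensor2 \<Rightarrow> bool"
  where "ricci_flat A g \<longleftrightarrow> (\<forall>c\<in>A. \<forall>p\<in>dom_of c. ricci g c p = 0)"


section \<open>Ricci flow and breathers\<close>

definition ricci_flow ::
  "('a, 'n::finite) chart set \<Rightarrow> real \<Rightarrow> real \<Rightarrow> (real \<Rightarrow> ('a, 'n) tensor2) \<Rightarrow> bool"
  where "ricci_flow A t1 t2 g \<longleftrightarrow>
    (\<forall>t\<in>{t1..t2}. riemannian_metric A (g t)) \<and>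
    (\<forall>c\<in>A. smooth_on ({t1..t2} \<times> coord c ` dom_of c) (\<lambda>(t, x). g t c (param c x))) \<and>
    (\<forall>t\<in>{t1..t2}. \<forall>c\<in>A. \<forall>p\<in>dom_of c.
      ((\<lambda>s. g s c p) has_vector_derivative (-2) *\<^sub>R ricci (g t) c p) (at t within {t1..t2}))"

definition ricci_breather ::
  "'a topology \<Rightarrow> ('a, 'n::finite) chart set \<Rightarrow> real \<Rightarrow> real \<Rightarrow> real
     \<Rightarrow> (real \<Rightarrow> ('a, 'n) tensor2) \<Rightarrow> bool"
  where "ricci_breather X A \<alpha> t1 t2 g \<longleftrightarrow> t1 < t2 \<and> \<alpha> > 0 \<and> ricci_flow A t1 t2 g \<and>
    (\<exists>\<Phi>. diffeomorphism X A \<Phi> \<and>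
      (\<forall>c\<in>A. \<forall>p\<in>dom_of c. g t2 c p = \<alpha> *\<^sub>R pullback A \<Phi> (g t1) c p))"

definition steady_breather ::
  "'a topology \<Rightarrow> ('a, 'n::finite) chart set \<Rightarrow> real \<Rightarrow> real
     \<Rightarrow> (real \<Rightarrow> ('a, 'n) tensor2) \<Rightarrow> bool"
  where "steady_breather X A t1 t2 g \<longleftrightarrow> ricci_breather X A 1 t1 t2 g"

end

theory Submission
  imports Defs
begin

text \<open>The proof watches the minimum of the scalar curvature \<open>R\<close>. Along the Ricci flow
  \<open>\<partial>\<^sub>t R = \<Delta> R + 2 |Ric|\<^sup>2\<close> and \<open>|Ric|\<^sup>2 \<ge> R\<^sup>2 / n\<close> in dimension \<open>n\<close>,
  so by the maximum principle the spatial minimum of \<open>R\<close> never decreases, and over a time interval of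
  positive length it increases strictly unless its initial value is \<open>0\<close>. For a steady breather the
  metrics at the two end times are isometric, hence have the same minimum of \<open>R\<close>; this minimum
  is therefore \<open>0\<close>, and \<open>R \<ge> 0\<close> throughout. If \<open>R\<close> were positive somewhere at an
  interior time, the strong maximum principle would make it positive everywhere at all later interior
  times; by compactness its minimum would then be positive, and would remain so up to the final time,
  where it is \<open>0\<close>. Hence \<open>R\<close> vanishes at all interior times, the evolution equation leaves
  \<open>|Ric|\<^sup>2 = 0\<close>, and continuity in time covers the two end times.

  This argument is elementary in that it stays with pointwise identities and maximum principles; the
  monotonicity of the lowest eigenvalue of \<open>-4\<Delta> + R\<close> is replaced by that of the minimum of \<open>R\<close>.
  Four results carry it. \<open>scal_evolution\<close> is the evolution equation, which rests on
  \<open>contracted_bianchi\<close>. \<open>scal_transform\<close> is the invariance of \<open>R\<close> under isometries; it makes \<open>R\<close> a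
  function on the manifold and compares the two end times. \<open>weak_max_principle\<close> and
  \<open>positivity_spreads\<close> are the two maximum principles.

  In a chart everything is written with matrices. The Christoffel symbols with first lower index \<open>i\<close>
  form the matrix \<open>\<Gamma>\<^sub>i\<close>, and with \<open>\<partial>\<^sub>i\<close> for entrywise derivatives the structure equations become
  \<open>\<partial>\<^sub>i G = G \<Gamma>\<^sub>i + \<Gamma>\<^sub>i\<^sup>T G\<close> and \<open>F\<^sub>i\<^sub>j = \<partial>\<^sub>i \<Gamma>\<^sub>j - \<partial>\<^sub>j \<Gamma>\<^sub>i + \<Gamma>\<^sub>i \<Gamma>\<^sub>j - \<Gamma>\<^sub>j \<Gamma>\<^sub>i\<close>. The Bianchi identities, the
  behaviour under coordinate changes and the variation of the curvature then are identities between
  products of matrices, followed by contractions of indices.\<close>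

section \<open>Functions with continuous derivatives\<close>

text \<open>The class of \<open>k\<close> times continuously differentiable functions, with the derivative under an existential
  quantifier instead of \<^const>\<open>frechet_derivative\<close>. On a set such as \<open>{t1..t2} \<times> V\<close> the sum and product
  rules then apply directly, without first showing that derivatives within the set are unique.\<close>

primrec ck :: "nat \<Rightarrow> 'a::real_normed_vector set \<Rightarrow> ('a \<Rightarrow> 'b::real_normed_vector) \<Rightarrow> bool"
  where
    "ck 0 S f \<longleftrightarrow> continuous_on S f"
  | "ck (Suc k) S f \<longleftrightarrow> (\<exists>f'. (\<forall>x\<in>S. (f has_derivative f' x) (at x within S)) \<and>
       (\<forall>v. ck k S (\<lambda>x. f' x v)))"

lemma ck_if_C_k_on: "C_k_on k S f \<Longrightarrow> ck k S f"
proof (induction k arbitrary: f)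
  case (Suc k)
  then show ?case
    by (auto simp: differentiable_on_def frechet_derivative_works
        intro!: exI[of _ "\<lambda>x. frechet_derivative f (at x within S)"])
qed simp

lemma ck_if_smooth_on: "smooth_on S f \<Longrightarrow> ck k S f"
  by (simp add: smooth_on_def ck_if_C_k_on)

lemma ck_cong:
  assumes "\<And>x. x \<in> S \<Longrightarrow> f x = g x" "ck k S f"
  shows "ck k S g"
proof (cases k)
  case 0
  then show ?thesis using assms continuous_on_cong by (metis ck.simps(1))
next
  case (Suc n)
  then obtain f' where f': "\<forall>x\<in>S. (f has_derivative f' x) (at x within S)"
    "\<forall>v. ck n S (\<lambda>x. f' x v)"
    using assms by auto
  have "(g has_derivative f' x) (at x within S)" if "x \<in> S" for x
    using f'(1) that assms(1) has_derivative_transform by (metis (mono_tags, lifting))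
  then show ?thesis using f' Suc by auto
qed

lemma ck_subset: "ck k S f \<Longrightarrow> U \<subseteq> S \<Longrightarrow> ck k U f"
proof (induction k arbitrary: f)
  case 0
  then show ?case by (auto intro: continuous_on_subset)
next
  case (Suc k)
  then obtain f' where f': "\<forall>x\<in>S. (f has_derivative f' x) (at x within S)"
    "\<forall>v. ck k S (\<lambda>x. f' x v)"
    by auto
  have "(f has_derivative f' x) (at x within U)" if "x \<in> U" for x
    using f'(1) that Suc.prems(2) has_derivative_subset by blast
  then show ?case
    using f'(2) Suc.IH Suc.prems(2) by auto
qed

lemma ck_Suc_D: "ck (Suc k) S f \<Longrightarrow> ck k S f"
proof (induction k arbitrary: f)
  case 0
  then show ?case
    by (auto simp: continuous_on_eq_continuous_within intro: has_derivative_continuous)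
next
  case (Suc k)
  then show ?case by (metis ck.simps(2))
qed

lemma ck_mono: "ck k S f \<Longrightarrow> j \<le> k \<Longrightarrow> ck j S f"
proof (induction k)
  case (Suc k)
  then show ?case using ck_Suc_D le_Suc_eq by metis
qed simp

lemma ck_continuous_on: "ck k S f \<Longrightarrow> continuous_on S f"
  using ck_mono[of k S f 0] by simp

lemma ck_const: "ck k S (\<lambda>x. c)"
proof (induction k arbitrary: c)
  case (Suc k)
  then show ?case by (auto intro!: exI[of _ "\<lambda>x v. 0"])
qed simp

lemma ck_add: "ck k S f \<Longrightarrow> ck k S g \<Longrightarrow> ck k S (\<lambda>x. f x + g x)"
proof (induction k arbitrary: f g)
  case 0
  then show ?case by (auto intro: continuous_on_add)
next
  case (Suc k)
  then obtain f' g' where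
    "\<forall>x\<in>S. (f has_derivative f' x) (at x within S)" "\<forall>v. ck k S (\<lambda>x. f' x v)"
    "\<forall>x\<in>S. (g has_derivative g' x) (at x within S)" "\<forall>v. ck k S (\<lambda>x. g' x v)"
    by auto
  then show ?case using Suc.IH
    by (auto intro!: exI[of _ "\<lambda>x v. f' x v + g' x v"] derivative_intros)
qed

lemma ck_bounded_linear:
  assumes "bounded_linear L"
  shows "ck k S f \<Longrightarrow> ck k S (\<lambda>x. L (f x))"
proof (induction k arbitrary: f)
  case 0
  then show ?case using assms by (auto intro: bounded_linear.continuous_on)
next
  case (Suc k)
  then obtain f' where
    "\<forall>x\<in>S. (f has_derivative f' x) (at x within S)" "\<forall>v. ck k S (\<lambda>x. f' x v)"
    by auto
  then show ?case using Suc.IH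
    by (auto intro!: exI[of _ "\<lambda>x v. L (f' x v)"] bounded_linear.has_derivative[OF assms])
qed

lemma ck_mult:
  fixes f g :: "'a::real_normed_vector \<Rightarrow> real"
  shows "ck k S f \<Longrightarrow> ck k S g \<Longrightarrow> ck k S (\<lambda>x. f x * g x)"
proof (induction k arbitrary: f g)
  case 0
  then show ?case by (auto intro: continuous_on_mult)
next
  case (Suc k)
  then obtain f' g' where d:
    "\<forall>x\<in>S. (f has_derivative f' x) (at x within S)" "\<forall>v. ck k S (\<lambda>x. f' x v)"
    "\<forall>x\<in>S. (g has_derivative g' x) (at x within S)" "\<forall>v. ck k S (\<lambda>x. g' x v)"
    by auto
  have "ck k S (\<lambda>x. f x * g' x v + f' x v * g x)" for v
    using d Suc ck_Suc_D by (intro ck_add) blast+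
  then show ?case using d
    by (auto intro!: exI[of _ "\<lambda>x v. f x * g' x v + f' x v * g x"] derivative_eq_intros)
qed

lemma ck_minus:
  fixes f :: "'a::real_normed_vector \<Rightarrow> 'b::real_normed_vector"
  shows "ck k S f \<Longrightarrow> ck k S (\<lambda>x. - f x)"
  by (rule ck_bounded_linear[OF bounded_linear_minus[OF bounded_linear_ident]])

lemma ck_diff: "ck k S f \<Longrightarrow> ck k S g \<Longrightarrow> ck k S (\<lambda>x. f x - g x)"
  using ck_add[of k S f "\<lambda>x. - g x"] ck_minus[of k S g] by simp

lemma ck_sum: "(\<And>i. i \<in> I \<Longrightarrow> ck k S (f i)) \<Longrightarrow> ck k S (\<lambda>x. \<Sum>i\<in>I. f i x)"
  by (induction I rule: infinite_finite_induct) (auto intro: ck_const ck_add)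

lemma ck_prod:
  fixes f :: "'i \<Rightarrow> 'a::real_normed_vector \<Rightarrow> real"
  shows "(\<And>i. i \<in> I \<Longrightarrow> ck k S (f i)) \<Longrightarrow> ck k S (\<lambda>x. \<Prod>i\<in>I. f i x)"
  by (induction I rule: infinite_finite_induct) (auto intro: ck_const ck_mult)

text \<open>The derivative \<open>- f' / f\<^sup>2\<close> is a product of \<open>f'\<close> and two copies of \<open>1 / f\<close>, so the induction on \<open>k\<close> closes
  on itself.\<close>

lemma ck_inverse:
  fixes f :: "'a::real_normed_vector \<Rightarrow> real"
  assumes nz: "\<And>x. x \<in> S \<Longrightarrow> f x \<noteq> 0"
  shows "ck k S f \<Longrightarrow> ck k S (\<lambda>x. inverse (f x))"
proof (induction k)
  case 0
  then show ?case using nz by (auto intro: continuous_on_inverse)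
next
  case (Suc k)
  then obtain f' where d:
    "\<forall>x\<in>S. (f has_derivative f' x) (at x within S)" "\<forall>v. ck k S (\<lambda>x. f' x v)"
    by auto
  have inv: "ck k S (\<lambda>x. inverse (f x))"
    using Suc ck_Suc_D by blast
  have "ck k S (\<lambda>x. - (inverse (f x) * f' x v * inverse (f x)))" for v
    using d inv by (intro ck_minus ck_mult) auto
  then show ?case using d nz
    by (auto intro!: exI[of _ "\<lambda>x v. - (inverse (f x) * f' x v * inverse (f x))"] has_derivative_inverse)
qed

lemma ck_divide:
  fixes f g :: "'a::real_normed_vector \<Rightarrow> real"
  assumes "\<And>x. x \<in> S \<Longrightarrow> g x \<noteq> 0" "ck k S f" "ck k S g"
  shows "ck k S (\<lambda>x. f x / g x)"
  unfolding divide_inverse using assms by (intro ck_mult ck_inverse) auto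

lemma ck_differentiable:
  assumes "ck (Suc k) S f" "open S" "x \<in> S"
  shows "f differentiable (at x)"
  using assms by (auto simp: differentiable_def at_within_open_NO_MATCH)

lemma matrix_inv_inverse:
  fixes M :: "real^'n^'n"
  assumes "det M \<noteq> 0"
  shows "M ** matrix_inv M = mat 1" "matrix_inv M ** M = mat 1"
proof -
  obtain N where "M ** N = mat 1 \<and> N ** M = mat 1"
    using assms invertible_det_nz invertible_def by metis
  then have "M ** matrix_inv M = mat 1 \<and> matrix_inv M ** M = mat 1"
    unfolding matrix_inv_def by (rule someI)
  then show "M ** matrix_inv M = mat 1" "matrix_inv M ** M = mat 1" by auto
qed

text \<open>Cramer's rule writes the entries of the inverse as quotients of polynomials, which gives their
  smoothness.\<close>

lemma matrix_inv_cramer: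
  fixes M :: "real^'n^'n"
  assumes "det M \<noteq> 0"
  shows "matrix_inv M $ k $ l = det (\<chi> i j. if j = k then (axis l 1 :: real^'n) $ i else M $ i $ j) / det M"
proof -
  have inv: "M ** matrix_inv M = mat 1"
    using assms by (rule matrix_inv_inverse)
  have "M *v (matrix_inv M *v axis l 1) = axis l 1"
    by (simp add: matrix_vector_mul_assoc inv)
  then have "matrix_inv M *v axis l 1 =
      (\<chi> k. det (\<chi> i j. if j = k then (axis l 1 :: real^'n) $ i else M $ i $ j) / det M)"
    using cramer[OF assms] by blast
  then have "(matrix_inv M *v axis l 1) $ k =
      det (\<chi> i j. if j = k then (axis l 1 :: real^'n) $ i else M $ i $ j) / det M"
    by simp
  moreover have "(matrix_inv M *v axis l 1) $ k = matrix_inv M $ k $ l"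
    by (simp add: matrix_vector_mult_def axis_def if_distrib cong: if_cong)
  ultimately show ?thesis by simp
qed

lemma ck_det:
  fixes M :: "'a::real_normed_vector \<Rightarrow> real^'n^'n"
  assumes "\<And>i j. ck k S (\<lambda>x. M x $ i $ j)"
  shows "ck k S (\<lambda>x. det (M x))"
  unfolding det_def by (intro ck_sum ck_mult ck_prod ck_const assms)

lemma ck_matrix_inv:
  fixes M :: "'a::real_normed_vector \<Rightarrow> real^'n^'n"
  assumes "\<And>i j. ck k S (\<lambda>x. M x $ i $ j)" "\<And>x. x \<in> S \<Longrightarrow> det (M x) \<noteq> 0"
  shows "ck k S (\<lambda>x. matrix_inv (M x) $ a $ b)"
proof -
  have *: "ck k S (\<lambda>x. (\<chi> i j. if j = a then (axis b 1 :: real^'n) $ i else M x $ i $ j) $ i $ j)" for i j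
    using assms(1) ck_const by (cases "j = a") auto
  have "ck k S (\<lambda>x. det (\<chi> i j. if j = a then (axis b 1 :: real^'n) $ i else M x $ i $ j) / det (M x))"
    by (intro ck_divide ck_det assms *)
  then show ?thesis
    by (rule ck_cong[rotated]) (simp add: matrix_inv_cramer assms(2))
qed

subsection \<open>Partial derivatives\<close>

lemma ck_pderiv:
  fixes f :: "real^'n \<Rightarrow> real"
  assumes "ck (Suc k) V f" "open V"
  shows "ck k V (pderiv_coord i f)"
proof -
  obtain f' where f': "\<forall>x\<in>V. (f has_derivative f' x) (at x within V)"
    "\<forall>v. ck k V (\<lambda>x. f' x v)"
    using assms(1) by auto
  have "pderiv_coord i f x = f' x (axis i 1)" if "x \<in> V" for x
  proof -
    have "(f has_derivative f' x) (at x)" using f' that assms(2) by (simp add: at_within_open_NO_MATCH)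
    then show ?thesis
      unfolding pderiv_coord_def using frechet_derivative_at by metis
  qed
  then show ?thesis
    using ck_cong[OF _ f'(2)[rule_format, of "axis i 1"], of "pderiv_coord i f"] by simp
qed

lemma has_derivative_slice:
  assumes "(f has_derivative f') (at (t, x) within T \<times> V)" "t \<in> T"
  shows "((\<lambda>y. f (t, y)) has_derivative (\<lambda>v. f' (0, v))) (at x within V)"
proof -
  have 1: "((\<lambda>y. (t, y)) has_derivative (\<lambda>v. (0, v))) (at x within V)"
    by (auto intro!: derivative_eq_intros)
  have 2: "(f has_derivative f') (at ((\<lambda>y. (t, y)) x) within (\<lambda>y. (t, y)) ` V)"
    using assms by (auto intro: has_derivative_subset)
  show ?thesis
    using has_derivative_in_compose[OF 1 2] by simp
qed

lemma ck_slice: "ck k (T \<times> V) f \<Longrightarrow> t \<in> T \<Longrightarrow> ck k V (\<lambda>x. f (t, x))"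
proof (induction k arbitrary: f)
  case 0
  then have "continuous_on ((\<lambda>x. (t, x)) ` V) f" by (auto intro: continuous_on_subset)
  then show ?case
    using continuous_on_compose2[of "(\<lambda>x. (t, x)) ` V" f V "\<lambda>x. (t, x)"]
      continuous_on_Pair[OF continuous_on_const continuous_on_id, of V t] by auto
next
  case (Suc k)
  then obtain f' where f': "\<forall>x\<in>T \<times> V. (f has_derivative f' x) (at x within T \<times> V)"
    "\<forall>v. ck k (T \<times> V) (\<lambda>x. f' x v)"
    by auto
  have "ck k V (\<lambda>x. f' (t, x) (0, v))" for v
    using Suc.IH[OF f'(2)[rule_format, of "(0, v)"] Suc.prems(2)] .
  then show ?case
    using f'(1) Suc.prems(2)
    by (auto intro!: exI[of _ "\<lambda>x v. f' (t, x) (0, v)"] has_derivative_slice[where T = T])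
qed

text \<open>A spatial derivative only looks along the slice \<open>{t} \<times> V\<close>, in which \<open>V\<close> is open. It is therefore
  determined for every set \<open>T\<close> of times and inherits the regularity of \<open>f\<close> up to the end times.\<close>

lemma ck_pderiv_spacetime:
  fixes f :: "real \<times> (real^'n) \<Rightarrow> real"
  assumes "ck (Suc k) (T \<times> V) f" "open V"
  shows "ck k (T \<times> V) (\<lambda>(t, x). pderiv_coord i (\<lambda>y. f (t, y)) x)"
proof -
  obtain f' where f': "\<forall>x\<in>T \<times> V. (f has_derivative f' x) (at x within T \<times> V)"
    "\<forall>v. ck k (T \<times> V) (\<lambda>x. f' x v)"
    using assms(1) by auto
  have "pderiv_coord i (\<lambda>y. f (t, y)) x = f' (t, x) (0, axis i 1)" if "t \<in> T" "x \<in> V" for t x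
  proof -
    have "((\<lambda>y. f (t, y)) has_derivative (\<lambda>v. f' (t, x) (0, v))) (at x)"
      using has_derivative_slice[of f "f' (t, x)" t x T V] f' that assms(2)
      by (simp add: at_within_open_NO_MATCH)
    then show ?thesis
      unfolding pderiv_coord_def using frechet_derivative_at by metis
  qed
  then show ?thesis
    by (intro ck_cong[OF _ f'(2)[rule_format, of "(0, axis i 1)"]]) auto
qed

lemma pderiv_spacetime_eq:
  fixes f :: "real \<times> (real^'n) \<Rightarrow> real"
  assumes "f differentiable (at (t, x))"
  shows "pderiv_coord i (\<lambda>y. f (t, y)) x = frechet_derivative f (at (t, x)) (0, axis i 1)"
proof -
  have "(f has_derivative frechet_derivative f (at (t, x))) (at (t, x) within UNIV \<times> UNIV)"
    using assms frechet_derivative_works by auto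
  from has_derivative_slice[OF this] show ?thesis
    unfolding pderiv_coord_def using frechet_derivative_at by (metis UNIV_I)
qed

lemma time_derivative_eq:
  fixes f :: "real \<times> (real^'n) \<Rightarrow> real"
  assumes "f differentiable (at (t, x))"
  shows "((\<lambda>s. f (s, x)) has_real_derivative frechet_derivative f (at (t, x)) (1, 0)) (at t)"
proof -
  let ?D = "frechet_derivative f (at (t, x))"
  have d: "(f has_derivative ?D) (at (t, x))"
    using assms frechet_derivative_works by auto
  have 1: "((\<lambda>s. (s, x)) has_derivative (\<lambda>v. (v, 0))) (at t)"
    by (auto intro!: derivative_eq_intros)
  have "((\<lambda>s. f (s, x)) has_derivative (\<lambda>v. ?D (v, 0))) (at t)"
    using diff_chain_at[OF 1 d] by (simp add: o_def)
  moreover have "(\<lambda>v. ?D (v, 0)) = (*) (?D (1, 0))"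
  proof
    show "?D (v, 0) = ?D (1, 0) * v" for v
      using linear_scale[OF has_derivative_linear[OF d], of v "(1,0)"] by (simp add: mult.commute[of v])
  qed
  ultimately show ?thesis unfolding has_field_derivative_def by simp
qed

text \<open>Equality of mixed derivatives: the second difference along \<open>v\<close> and \<open>w\<close> is, by the mean
  value theorem, a value of either mixed derivative.\<close>

lemma second_difference:
  fixes f :: "'a::real_normed_vector \<Rightarrow> real"
  assumes f: "\<And>y. y \<in> ball x r \<Longrightarrow> (f has_derivative f' y) (at y)"
    and g: "\<And>y. y \<in> ball x r \<Longrightarrow> ((\<lambda>z. f' z v) has_derivative g' y) (at y)"
    and h: "0 < h" "h * (norm v + norm w) < r"
  shows "\<exists>y. dist x y \<le> h * (norm v + norm w) \<and>
    f (x + h *\<^sub>R v + h *\<^sub>R w) - f (x + h *\<^sub>R v) - f (x + h *\<^sub>R w) + f x = h * h * g' y w"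
proof -
  have near: "dist x (x + s *\<^sub>R v + t *\<^sub>R w) \<le> h * (norm v + norm w)"
    if "0 \<le> s" "s \<le> h" "0 \<le> t" "t \<le> h" for s t
  proof -
    have "dist x (x + s *\<^sub>R v + t *\<^sub>R w) = norm (s *\<^sub>R v + t *\<^sub>R w)"
      by (metis add.assoc dist_add_cancel dist_0_norm add.right_neutral)
    also have "\<dots> \<le> s * norm v + t * norm w"
      using norm_triangle_ineq[of "s *\<^sub>R v" "t *\<^sub>R w"] that by simp
    also have "\<dots> \<le> h * norm v + h * norm w"
      using that by (intro add_mono mult_right_mono) auto
    finally show ?thesis by (simp add: algebra_simps)
  qed
  then have inb: "x + s *\<^sub>R v + t *\<^sub>R w \<in> ball x r"
    if "0 \<le> s" "s \<le> h" "0 \<le> t" "t \<le> h" for s t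
    using that h(2) by (smt (verit) mem_ball)
  define \<phi> where "\<phi> s = f (x + s *\<^sub>R v + h *\<^sub>R w) - f (x + s *\<^sub>R v)" for s
  have along: "((\<lambda>s. F (p + s *\<^sub>R u)) has_real_derivative F' u) (at s)"
    if "(F has_derivative F') (at (p + s *\<^sub>R u))" for F :: "'a \<Rightarrow> real" and F' p u s
  proof -
    have "((\<lambda>s. p + s *\<^sub>R u) has_derivative (\<lambda>a. a *\<^sub>R u)) (at s)"
      by (auto intro!: derivative_eq_intros)
    from diff_chain_at[OF this that] have "((\<lambda>s. F (p + s *\<^sub>R u)) has_derivative (\<lambda>a. F' (a *\<^sub>R u))) (at s)"
      by (simp add: o_def)
    moreover have "(\<lambda>a. F' (a *\<^sub>R u)) = (*) (F' u)"
      using linear_scale[OF has_derivative_linear[OF that]] by auto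
    ultimately show ?thesis unfolding has_field_derivative_def by simp
  qed
  have d\<phi>: "(\<phi> has_real_derivative f' (x + s *\<^sub>R v + h *\<^sub>R w) v - f' (x + s *\<^sub>R v) v) (at s)"
    if "0 \<le> s" "s \<le> h" for s
    unfolding \<phi>_def
  proof (rule DERIV_diff)
    show "((\<lambda>s. f (x + s *\<^sub>R v + h *\<^sub>R w)) has_real_derivative f' (x + s *\<^sub>R v + h *\<^sub>R w) v) (at s)"
      using along[of f "f' (x + s *\<^sub>R v + h *\<^sub>R w)" "x + h *\<^sub>R w" s v] f[OF inb[of s h]] that h(1)
      by (simp add: algebra_simps)
    show "((\<lambda>s. f (x + s *\<^sub>R v)) has_real_derivative f' (x + s *\<^sub>R v) v) (at s)"
      using along[of f "f' (x + s *\<^sub>R v)" "x" s v] f[OF inb[of s 0]] that h(1)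
      by (simp add: algebra_simps)
  qed
  obtain s where s: "0 < s" "s < h"
    "\<phi> h - \<phi> 0 = (h - 0) * (f' (x + s *\<^sub>R v + h *\<^sub>R w) v - f' (x + s *\<^sub>R v) v)"
    using MVT2[OF h(1) d\<phi>] by blast
  have "((\<lambda>t. f' (x + s *\<^sub>R v + t *\<^sub>R w) v) has_real_derivative g' (x + s *\<^sub>R v + t *\<^sub>R w) w) (at t)"
    if "0 \<le> t" "t \<le> h" for t
    using along[of "\<lambda>z. f' z v" "g' (x + s *\<^sub>R v + t *\<^sub>R w)" "x + s *\<^sub>R v" t w]
      g[OF inb[of s t]] that s by simp
  from MVT2[OF h(1) this] obtain t where t: "0 < t" "t < h"
    "f' (x + s *\<^sub>R v + h *\<^sub>R w) v - f' (x + s *\<^sub>R v + 0 *\<^sub>R w) v = (h - 0) * g' (x + s *\<^sub>R v + t *\<^sub>R w) w"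
    by blast
  have "f (x + h *\<^sub>R v + h *\<^sub>R w) - f (x + h *\<^sub>R v) - f (x + h *\<^sub>R w) + f x = \<phi> h - \<phi> 0"
    by (simp add: \<phi>_def)
  also have "\<dots> = h * h * g' (x + s *\<^sub>R v + t *\<^sub>R w) w"
    using s(3) t(3) by simp
  finally show ?thesis using near[of s t] s t by auto
qed

text \<open>Both mixed derivatives at \<open>x\<close> are limits of the same second difference quotient.\<close>

lemma mixed_derivatives_commute:
  fixes f :: "'a::real_normed_vector \<Rightarrow> real"
  assumes "ck 2 S f" "open S" "x \<in> S"
  shows "frechet_derivative (\<lambda>z. frechet_derivative f (at z) v) (at x) w =
    frechet_derivative (\<lambda>z. frechet_derivative f (at z) w) (at x) v"
proof -
  obtain f' where f': "\<forall>x\<in>S. (f has_derivative f' x) (at x within S)"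
    and "\<forall>v. ck (Suc 0) S (\<lambda>x. f' x v)"
    using assms(1) by (auto simp: numeral_2_eq_2)
  then have "\<forall>v. \<exists>g'. (\<forall>x\<in>S. ((\<lambda>z. f' z v) has_derivative g' x) (at x within S)) \<and>
       (\<forall>w. ck 0 S (\<lambda>x. g' x w))"
    by simp
  then obtain g where g: "\<And>x v. x\<in>S \<Longrightarrow> ((\<lambda>z. f' z v) has_derivative g v x) (at x within S)"
    "\<And>v w. continuous_on S (\<lambda>x. g v x w)"
    by simp metis
  have f'a: "(f has_derivative f' y) (at y)" if "y \<in> S" for y
    using f' that assms(2) by (simp add: at_within_open_NO_MATCH)
  have ga: "((\<lambda>z. f' z v) has_derivative g v y) (at y)" if "y \<in> S" for y v
    using g(1)[of y v] that assms(2) by (simp add: at_within_open_NO_MATCH)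
  have e1: "frechet_derivative f (at y) = f' y" if "y \<in> S" for y
    using f'a[OF that] frechet_derivative_at by metis
  have e2: "frechet_derivative (\<lambda>z. frechet_derivative f (at z) v) (at x) w = g v x w" for v w
  proof -
    have "((\<lambda>z. frechet_derivative f (at z) v) has_derivative g v x) (at x)"
      by (rule has_derivative_transform_within_open[OF ga assms(2)]) (auto simp: assms(3) e1)
    then show ?thesis using frechet_derivative_at by metis
  qed
  obtain r where r: "r > 0" "ball x r \<subseteq> S"
    using assms(2,3) openE by blast
  have "\<bar>g v x w - g w x v\<bar> < 2 * e" if e: "e > 0" for e
  proof -
    have c: "\<exists>d>0. \<forall>y. dist x y < d \<longrightarrow> \<bar>g v y w - g v x w\<bar> < e" for v w
    proof -
      have "isCont (\<lambda>y. g v y w) x"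
        using g(2) assms(2,3) continuous_on_eq_continuous_at by blast
      then obtain d where "d > 0" "\<And>y. dist y x < d \<Longrightarrow> dist (g v y w) (g v x w) < e"
        unfolding continuous_at_eps_delta using e by blast
      then show ?thesis by (metis dist_commute dist_real_def)
    qed
    obtain d1 where d1: "d1 > 0" "\<And>y. dist x y < d1 \<Longrightarrow> \<bar>g v y w - g v x w\<bar> < e"
      using c by blast
    obtain d2 where d2: "d2 > 0" "\<And>y. dist x y < d2 \<Longrightarrow> \<bar>g w y v - g w x v\<bar> < e"
      using c by blast
    define m where "m = min r (min d1 d2)"
    have m: "m > 0" using r d1 d2 by (simp add: m_def)
    define h where "h = m / (2 * (norm v + norm w + 1))"
    have pos: "norm v + norm w + 1 > 0" by (smt (verit) norm_ge_zero)
    have h: "h > 0" using m pos by (simp add: h_def)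
    have "h * (norm v + norm w) \<le> h * (norm v + norm w + 1)" using h by simp
    also have "\<dots> = m / 2" using pos by (simp add: h_def field_simps)
    finally have hm: "h * (norm v + norm w) < m" using m by simp
    obtain y1 where y1: "dist x y1 \<le> h * (norm v + norm w)"
      "f (x + h *\<^sub>R v + h *\<^sub>R w) - f (x + h *\<^sub>R v) - f (x + h *\<^sub>R w) + f x = h * h * g v y1 w"
      using second_difference[of x r f f' v "g v" h w] f'a ga r h hm by (force simp: m_def)
    obtain y2 where y2: "dist x y2 \<le> h * (norm w + norm v)"
      "f (x + h *\<^sub>R w + h *\<^sub>R v) - f (x + h *\<^sub>R w) - f (x + h *\<^sub>R v) + f x = h * h * g w y2 v"
      using second_difference[of x r f f' w "g w" h v] f'a ga r h hm by (force simp: m_def add.commute)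
    have "h * h * g v y1 w = h * h * g w y2 v"
      using y1(2) y2(2) by (simp add: algebra_simps)
    then have "g v y1 w = g w y2 v" using h by simp
    moreover have "\<bar>g v y1 w - g v x w\<bar> < e" using d1(2) y1(1) hm by (simp add: m_def)
    moreover have "\<bar>g w y2 v - g w x v\<bar> < e" using d2(2) y2(1) hm by (simp add: m_def add.commute)
    ultimately show ?thesis by linarith
  qed
  then have "\<bar>g v x w - g w x v\<bar> \<le> 0"
    by (metis field_sum_of_halves less_eq_real_def linorder_not_less mult_2 zero_less_divide_iff zero_less_numeral)
  then show ?thesis by (simp add: e2)
qed

lemma pderiv_commute:
  fixes f :: "real^'n \<Rightarrow> real"
  assumes "ck 2 V f" "open V" "x \<in> V"
  shows "pderiv_coord i (pderiv_coord j f) x = pderiv_coord j (pderiv_coord i f) x"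
  using mixed_derivatives_commute[OF assms, of "axis j 1" "axis i 1"]
  unfolding pderiv_coord_def[abs_def] by simp

lemma pderiv_cong_open:
  assumes "open V" "x \<in> V" "\<And>y. y \<in> V \<Longrightarrow> f y = g y"
  shows "pderiv_coord i f x = pderiv_coord i g x"
proof -
  have "(f has_derivative D) (at x) \<longleftrightarrow> (g has_derivative D) (at x)" for D
    using has_derivative_transform_within_open[OF _ assms(1,2)] assms(3) by metis
  then show ?thesis unfolding pderiv_coord_def frechet_derivative_def by simp
qed

lemma time_pderiv_commute:
  fixes f :: "real \<times> (real^'n) \<Rightarrow> real"
  assumes "ck 2 (T \<times> V) f" "open T" "open V" "t \<in> T" "x \<in> V"
    and d: "\<And>s y. s \<in> T \<Longrightarrow> y \<in> V \<Longrightarrow> ((\<lambda>s. f (s, y)) has_real_derivative f' s y) (at s)"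
  shows "((\<lambda>s. pderiv_coord i (\<lambda>y. f (s, y)) x) has_real_derivative pderiv_coord i (f' t) x) (at t)"
proof -
  let ?S = "T \<times> V"
  have o: "open ?S" using assms by (simp add: open_Times)
  have diff: "f differentiable (at z)" if "z \<in> ?S" for z
    using ck_differentiable[of 1 ?S f z] assms(1) o that by (simp add: numeral_2_eq_2)
  let ?t = "\<lambda>z. frechet_derivative f (at z) (1, 0)"
  let ?i = "\<lambda>z. frechet_derivative f (at z) (0, axis i 1)"
  have c1: "ck 1 ?S (\<lambda>z. frechet_derivative f (at z) v)" for v
  proof -
    obtain g where g: "\<forall>x\<in>?S. (f has_derivative g x) (at x within ?S)"
      "\<forall>v. ck (Suc 0) ?S (\<lambda>x. g x v)"
      using assms(1) by (auto simp: numeral_2_eq_2)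
    have "g z v = frechet_derivative f (at z) v" if "z \<in> ?S" for z
      using g(1) that o frechet_derivative_at at_within_open by metis
    then show ?thesis using ck_cong[OF _ g(2)[rule_format, of v]] by simp
  qed
  have dt: "?t differentiable (at (t, x))" and di: "?i differentiable (at (t, x))"
    using ck_differentiable[OF c1[unfolded One_nat_def] o] assms(4,5) by (auto simp only: mem_Times_iff fst_conv snd_conv)
  have ft: "f' s y = ?t (s, y)" if "s \<in> T" "y \<in> V" for s y
    using time_derivative_eq[OF diff, of s y] d[OF that] that DERIV_unique by auto
  have "((\<lambda>s. ?i (s, x)) has_real_derivative frechet_derivative ?i (at (t, x)) (1, 0)) (at t)"
    by (rule time_derivative_eq[OF di])
  then have "((\<lambda>s. pderiv_coord i (\<lambda>y. f (s, y)) x) has_real_derivative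
      frechet_derivative ?i (at (t, x)) (1, 0)) (at t)"
    using assms(2,4) diff assms(5)
    by (elim has_field_derivative_transform_within_open[where S = T]) (auto simp: pderiv_spacetime_eq)
  also have "frechet_derivative ?i (at (t, x)) (1, 0) = frechet_derivative ?t (at (t, x)) (0, axis i 1)"
    using mixed_derivatives_commute[OF assms(1) o] assms by simp
  also have "\<dots> = pderiv_coord i (\<lambda>y. ?t (t, y)) x"
    using pderiv_spacetime_eq[OF dt] by simp
  also have "\<dots> = pderiv_coord i (f' t) x"
    by (rule pderiv_cong_open[OF assms(3,5)]) (simp add: ft assms)
  finally show ?thesis .
qed

lemma pderiv_eqI: "(f has_derivative D) (at x) \<Longrightarrow> pderiv_coord i f x = D (axis i 1)"
  unfolding pderiv_coord_def using frechet_derivative_at[of f D x] by simp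

lemma differentiable_frechet:
  "f differentiable (at x) \<Longrightarrow> (f has_derivative frechet_derivative f (at x)) (at x)"
  using frechet_derivative_works by blast

lemma pderiv_add:
  assumes "f differentiable (at x)" "g differentiable (at x)"
  shows "pderiv_coord i (\<lambda>y. f y + g y) x = pderiv_coord i f x + pderiv_coord i g x"
  using pderiv_eqI[OF has_derivative_add[OF assms[THEN differentiable_frechet]]]
  by (simp add: pderiv_coord_def)

lemma pderiv_minus:
  assumes "f differentiable (at x)"
  shows "pderiv_coord i (\<lambda>y. - f y) x = - pderiv_coord i f x"
  using pderiv_eqI[OF has_derivative_minus[OF assms[THEN differentiable_frechet]]]
  by (simp add: pderiv_coord_def)

lemma pderiv_diff:
  assumes "f differentiable (at x)" "g differentiable (at x)"
  shows "pderiv_coord i (\<lambda>y. f y - g y) x = pderiv_coord i f x - pderiv_coord i g x"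
  using pderiv_eqI[OF has_derivative_diff[OF assms[THEN differentiable_frechet]]]
  by (simp add: pderiv_coord_def)

lemma pderiv_mult:
  assumes "f differentiable (at x)" "g differentiable (at x)"
  shows "pderiv_coord i (\<lambda>y. f y * g y) x = f x * pderiv_coord i g x + pderiv_coord i f x * g x"
  using pderiv_eqI[OF has_derivative_mult[OF assms[THEN differentiable_frechet]]]
  by (simp add: pderiv_coord_def)

lemma pderiv_const [simp]: "pderiv_coord i (\<lambda>y. c) x = 0"
  by (simp add: pderiv_coord_def)

lemma pderiv_sum:
  assumes "\<And>k. k \<in> I \<Longrightarrow> f k differentiable (at x)"
  shows "pderiv_coord i (\<lambda>y. \<Sum>k\<in>I. f k y) x = (\<Sum>k\<in>I. pderiv_coord i (f k) x)"
  using pderiv_eqI[OF has_derivative_sum[OF assms[THEN differentiable_frechet]]]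
  by (simp add: pderiv_coord_def)

lemma pderiv_cmult:
  assumes "f differentiable (at x)"
  shows "pderiv_coord i (\<lambda>y. c * f y) x = c * pderiv_coord i f x"
  using pderiv_mult[of "\<lambda>_. c" x f] assms by simp

section \<open>Positive matrices\<close>

lemma symmetric_form_commute:
  fixes H :: "real^'n^'n"
  assumes "transpose H = H"
  shows "v \<bullet> (H *v w) = w \<bullet> (H *v v)"
  by (metis assms dot_lmul_matrix inner_commute transpose_matrix_vector)

text \<open>Completing squares one coordinate at a time: if \<open>H\<^sub>s\<^sub>s > 0\<close>, the Schur complement
  \<open>H\<^sub>i\<^sub>j - H\<^sub>s\<^sub>i H\<^sub>s\<^sub>j / H\<^sub>s\<^sub>s\<close> is again positive semidefinite and lives on one coordinate less; if \<open>H\<^sub>s\<^sub>s = 0\<close>,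
  the whole row \<open>s\<close> vanishes.\<close>

lemma psd_sum_of_squares:
  fixes H :: "real^'n^'n" and S :: "'n set"
  assumes "finite S" "transpose H = H" "\<And>v. v \<bullet> (H *v v) \<ge> 0"
    and "\<And>i j. i \<notin> S \<Longrightarrow> H $ i $ j = 0"
  shows "\<exists>b :: 'n \<Rightarrow> real^'n. \<forall>i j. H $ i $ j = (\<Sum>k\<in>S. b k $ i * b k $ j)"
  using assms
proof (induction S arbitrary: H rule: finite_induct)
  case empty
  then show ?case by auto
next
  case (insert s S)
  have sym: "H $ i $ j = H $ j $ i" for i j
    using insert.prems(1) by (metis transpose_def vec_lambda_beta)
  have es: "axis s 1 \<bullet> (H *v v) = (\<Sum>i\<in>UNIV. H $ s $ i * v $ i)" for v
    by (simp add: inner_axis' matrix_vector_mult_def)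
  have ess: "axis s 1 \<bullet> (H *v axis s 1) = H $ s $ s"
    using es[of "axis s 1"] by (simp add: axis_def if_distrib cong: if_cong)
  have shift: "(v - r *\<^sub>R axis s 1) \<bullet> (H *v (v - r *\<^sub>R axis s 1)) =
      v \<bullet> (H *v v) - 2 * r * (axis s 1 \<bullet> (H *v v)) + r * r * H $ s $ s" for v r
    using symmetric_form_commute[OF insert.prems(1), of v "axis s 1"] ess
    by (simp add: matrix_vector_mult_diff_distrib inner_diff_left inner_diff_right
        matrix_vector_mult_scaleR algebra_simps)
  show ?case
  proof (cases "H $ s $ s = 0")
    case True
    have "H $ s $ j = 0" for j
    proof -
      define c where "c = axis s 1 \<bullet> (H *v axis j 1)"
      have c: "c = H $ s $ j" by (simp only: c_def es) (simp add: axis_def if_distrib cong: if_cong)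
      define q where "q = axis j 1 \<bullet> (H *v axis j 1)"
      have pos: "0 \<le> q - 2 * r * c" for r
        using insert.prems(2)[of "axis j 1 - r *\<^sub>R axis s 1"] shift[of "axis j 1" r] True
        by (simp add: c_def q_def)
      have "c = 0"
      proof (rule ccontr)
        assume "c \<noteq> 0"
        then show False using pos[of "(q + 1) / (2 * c)"] by (simp add: field_simps)
      qed
      then show ?thesis using c by simp
    qed
    then have "H $ i $ j = 0" if "i \<notin> S" for i j
      using that insert.prems(3)[of i j] by (cases "i = s") auto
    then obtain b where "\<forall>i j. H $ i $ j = (\<Sum>k\<in>S. b k $ i * b k $ j)"
      using insert.IH[OF insert.prems(1,2)] by blast
    then show ?thesis using insert.hyps
      by (intro exI[of _ "b(s := 0)"]) (auto intro!: sum.cong)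
  next
    case False
    then have a: "H $ s $ s > 0"
      using insert.prems(2)[of "axis s 1"] ess by simp
    define H' :: "real^'n^'n" where "H' = (\<chi> i j. H $ i $ j - H $ s $ i * H $ s $ j / H $ s $ s)"
    have sym': "transpose H' = H'"
      by (simp add: transpose_def H'_def vec_eq_iff sym mult.commute)
    have q': "v \<bullet> (H' *v v) = v \<bullet> (H *v v) - (axis s 1 \<bullet> (H *v v))^2 / H $ s $ s" for v
    proof -
      have "v \<bullet> (H' *v v) = (\<Sum>i\<in>UNIV. \<Sum>j\<in>UNIV. v $ i * (H $ i $ j * v $ j)
          - (H $ s $ i * v $ i) * (H $ s $ j * v $ j) / H $ s $ s)"
        by (simp add: inner_vec_def matrix_vector_mult_def H'_def sum_distrib_left algebra_simps)
      also have "\<dots> = v \<bullet> (H *v v) - (\<Sum>i\<in>UNIV. H $ s $ i * v $ i) * (\<Sum>j\<in>UNIV. H $ s $ j * v $ j) / H $ s $ s"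
        by (simp add: inner_vec_def matrix_vector_mult_def sum_distrib_left sum_distrib_right sum_subtractf
            sum_divide_distrib sum_product) (rule sum.swap)
      finally show ?thesis by (simp add: es power2_eq_square)
    qed
    have pos': "v \<bullet> (H' *v v) \<ge> 0" for v
    proof -
      define c where "c = axis s 1 \<bullet> (H *v v)"
      have "0 \<le> v \<bullet> (H *v v) - 2 * (c / H $ s $ s) * c + (c / H $ s $ s) * (c / H $ s $ s) * H $ s $ s"
        using shift[of v "c / H $ s $ s"]
          insert.prems(2)[of "v - (c / H $ s $ s) *\<^sub>R axis s 1"] by (simp add: c_def)
      also have "\<dots> = v \<bullet> (H' *v v)"
        using a by (simp add: q' c_def[symmetric] power2_eq_square field_simps)
      finally show ?thesis .
    qed
    have "H' $ i $ j = 0" if "i \<notin> S" for i j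
      using that insert.prems(3)[of i j] insert.prems(3)[of i s] a sym[of i s] by (cases "i = s") (auto simp: H'_def)
    then obtain b where b: "\<forall>i j. H' $ i $ j = (\<Sum>k\<in>S. b k $ i * b k $ j)"
      using insert.IH[OF sym' pos'] by blast
    define b' where "b' = b(s := (1 / sqrt (H $ s $ s)) *\<^sub>R (\<chi> i. H $ s $ i))"
    have "H $ i $ j = (\<Sum>k\<in>insert s S. b' k $ i * b' k $ j)" for i j
    proof -
      have "(\<Sum>k\<in>S. b' k $ i * b' k $ j) = H' $ i $ j"
        using b insert.hyps by (auto simp: b'_def intro!: sum.cong)
      moreover have "b' s $ i * b' s $ j = H $ s $ i * H $ s $ j / H $ s $ s"
        using a by (simp add: b'_def)
      ultimately show ?thesis using insert.hyps by (simp add: H'_def)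
    qed
    then show ?thesis by blast
  qed
qed

lemma psd_factor:
  fixes H :: "real^'n^'n"
  assumes "transpose H = H" "\<And>v. v \<bullet> (H *v v) \<ge> 0"
  shows "\<exists>B :: real^'n^'n. H = B ** transpose B"
proof -
  obtain b :: "'n \<Rightarrow> real^'n" where b: "\<forall>i j. H $ i $ j = (\<Sum>k\<in>UNIV. b k $ i * b k $ j)"
    using psd_sum_of_squares[OF finite_class.finite_UNIV assms] by auto
  have "H = (\<chi> i k. b k $ i) ** transpose (\<chi> i k. b k $ i)"
    using b by (simp add: vec_eq_iff matrix_matrix_mult_def transpose_def)
  then show ?thesis by blast
qed

definition posdef :: "real^'n^'n \<Rightarrow> bool"
  where "posdef G \<longleftrightarrow> transpose G = G \<and> (\<forall>v. v \<noteq> 0 \<longrightarrow> v \<bullet> (G *v v) > 0)"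

lemma posdef_det: "posdef G \<Longrightarrow> det G \<noteq> 0"
proof -
  assume G: "posdef G"
  have "v = 0" if "G *v v = 0" for v
  proof (rule ccontr)
    assume "v \<noteq> 0"
    then have "v \<bullet> (G *v v) > 0" using G by (simp add: posdef_def)
    then show False using that by simp
  qed
  then have "\<exists>B. B ** G = mat 1"
    using matrix_left_invertible_ker by blast
  then show ?thesis
    using invertible_det_nz invertible_left_inverse by blast
qed

lemma transpose_matrix_inv:
  fixes G :: "real^'n^'n"
  assumes "det G \<noteq> 0" "transpose G = G"
  shows "transpose (matrix_inv G) = matrix_inv G"
proof -
  have "transpose (matrix_inv G) ** G = mat 1"
    by (metis assms matrix_inv_inverse(1) matrix_transpose_mul transpose_mat)
  then have "transpose (matrix_inv G) ** (G ** matrix_inv G) = matrix_inv G"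
    by (simp add: matrix_mul_assoc)
  then show ?thesis by (simp add: matrix_inv_inverse assms)
qed

lemma posdef_matrix_inv: "posdef G \<Longrightarrow> posdef (matrix_inv G)"
proof -
  assume G: "posdef G"
  have "v \<bullet> (matrix_inv G *v v) > 0" if "v \<noteq> 0" for v
  proof -
    define w where "w = matrix_inv G *v v"
    have v: "v = G *v w"
      by (simp add: w_def matrix_vector_mul_assoc matrix_inv_inverse posdef_det G)
    then have "w \<noteq> 0" using that by auto
    then have "w \<bullet> (G *v w) > 0" using G by (simp add: posdef_def)
    moreover have "v \<bullet> (matrix_inv G *v v) = w \<bullet> (G *v w)"
      by (metis v w_def inner_commute)
    ultimately show ?thesis by simp
  qed
  then show ?thesis
    using G posdef_det[OF G] transpose_matrix_inv[of G] by (simp add: posdef_def)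
qed

lemma posdef_inv_factor:
  fixes G :: "real^'n^'n"
  assumes "posdef G"
  shows "\<exists>B :: real^'n^'n. matrix_inv G = B ** transpose B"
proof (rule psd_factor)
  show "v \<bullet> (matrix_inv G *v v) \<ge> 0" for v
    using posdef_matrix_inv[OF assms] by (cases "v = 0") (auto simp: posdef_def less_imp_le)
  show "transpose (matrix_inv G) = matrix_inv G"
    using posdef_matrix_inv[OF assms] by (simp add: posdef_def)
qed

text \<open>When \<open>B B\<^sup>T\<close> is the inverse of a metric, the columns of \<open>B\<close> form an orthonormal frame and \<open>M\<close>
  represents \<open>S\<close> in this frame, so its trace is \<open>g\<^sup>i\<^sup>j S\<^sub>i\<^sub>j\<close> and its squared Frobenius norm is \<open>|S|\<^sup>2\<close>.\<close>

lemma frame_norm: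
  fixes B S :: "real^'n^'n"
  assumes "transpose S = S" and M_def: "M = transpose B ** S ** B"
  shows "trace (B ** transpose B ** S) = (\<Sum>k\<in>UNIV. M $ k $ k)"
    "trace (B ** transpose B ** S ** (B ** transpose B) ** S) = (\<Sum>k\<in>UNIV. \<Sum>l\<in>UNIV. (M $ k $ l)\<^sup>2)"
proof -
  have "trace (B ** transpose B ** S) = trace (B ** (transpose B ** S))"
    by (simp add: matrix_mul_assoc)
  also have "\<dots> = trace M"
    by (subst trace_mul_sym) (simp add: M_def)
  finally show "trace (B ** transpose B ** S) = (\<Sum>k\<in>UNIV. M $ k $ k)"
    by (simp add: trace_def)
  have sym: "M $ k $ l = M $ l $ k" for k l
  proof -
    have "transpose M = M"
      by (simp add: M_def matrix_transpose_mul assms matrix_mul_assoc)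
    then show ?thesis by (metis transpose_def vec_lambda_beta)
  qed
  have "trace (B ** transpose B ** S ** (B ** transpose B) ** S) =
      trace (B ** (transpose B ** S ** B ** transpose B ** S))"
    by (simp add: matrix_mul_assoc)
  also have "\<dots> = trace (M ** M)"
    by (subst trace_mul_sym) (simp add: M_def matrix_mul_assoc)
  also have "\<dots> = (\<Sum>k\<in>UNIV. \<Sum>l\<in>UNIV. (M $ k $ l)\<^sup>2)"
    using sym by (simp add: trace_def matrix_matrix_mult_def power2_eq_square)
  finally show "trace (B ** transpose B ** S ** (B ** transpose B) ** S) = (\<Sum>k\<in>UNIV. \<Sum>l\<in>UNIV. (M $ k $ l)\<^sup>2)" .
qed

text \<open>With \<open>S\<close> the Ricci tensor this is \<open>R\<^sup>2 \<le> n |Ric|\<^sup>2\<close>: the Cauchy-Schwarz inequality for the diagonal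
  of \<open>S\<close> in an orthonormal frame.\<close>

lemma trace_square_le:
  fixes G S :: "real^'n^'n"
  assumes "posdef G" "transpose S = S"
  shows "(trace (matrix_inv G ** S))\<^sup>2 \<le> CARD('n) * trace (matrix_inv G ** S ** matrix_inv G ** S)"
proof -
  obtain B :: "real^'n^'n" where B: "matrix_inv G = B ** transpose B"
    using posdef_inv_factor assms(1) by blast
  define M where "M = transpose B ** S ** B"
  have "(trace (matrix_inv G ** S))\<^sup>2 = (\<Sum>k\<in>UNIV. M $ k $ k)\<^sup>2"
    by (simp add: B frame_norm[OF assms(2) M_def])
  also have "\<dots> \<le> CARD('n) * (\<Sum>k\<in>UNIV. (M $ k $ k)\<^sup>2)"
    using Cauchy_Schwarz_ineq_sum[of "\<lambda>_. 1" "\<lambda>k. M $ k $ k" UNIV] by simp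
  also have "(\<Sum>k\<in>UNIV. (M $ k $ k)\<^sup>2) \<le> (\<Sum>k\<in>UNIV. \<Sum>l\<in>UNIV. (M $ k $ l)\<^sup>2)"
    by (intro sum_mono member_le_sum[where f = "\<lambda>l. (M $ _ $ l)\<^sup>2"]) auto
  also have "\<dots> = trace (matrix_inv G ** S ** matrix_inv G ** S)"
    by (simp add: B frame_norm[OF assms(2) M_def])
  finally show ?thesis by simp
qed

lemma norm_zero_imp_zero:
  fixes G S :: "real^'n^'n"
  assumes "posdef G" "transpose S = S" "trace (matrix_inv G ** S ** matrix_inv G ** S) = 0"
  shows "S = 0"
proof -
  obtain B :: "real^'n^'n" where B: "matrix_inv G = B ** transpose B"
    using posdef_inv_factor assms(1) by blast
  define M where "M = transpose B ** S ** B"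
  have "(\<Sum>k\<in>UNIV. \<Sum>l\<in>UNIV. (M $ k $ l)\<^sup>2) = 0"
    using assms(3) by (simp add: B frame_norm[OF assms(2) M_def])
  then have "M = 0"
    by (simp add: sum_nonneg_eq_0_iff sum_nonneg vec_eq_iff)
  have "S = (G ** matrix_inv G) ** S ** (matrix_inv G ** G)"
    by (simp add: matrix_inv_inverse posdef_det assms(1))
  also have "\<dots> = G ** B ** M ** transpose B ** G"
    by (simp add: B M_def matrix_mul_assoc)
  also have "\<dots> = 0"
    by (simp add: \<open>M = 0\<close> matrix_matrix_mult_def vec_eq_iff)
  finally show ?thesis .
qed

section \<open>Matrix-valued functions\<close>

lemma matrix_add_rdist: "(A + B) ** (C :: real^'n^'n) = A ** C + B ** C"
  by (simp add: matrix_matrix_mult_def vec_eq_iff sum.distrib algebra_simps)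

lemma matrix_diff_ldist: "(C :: real^'n^'n) ** (A - B) = C ** A - C ** B"
  by (simp add: matrix_matrix_mult_def vec_eq_iff sum_subtractf algebra_simps)

lemma matrix_diff_rdist: "(A - B) ** (C :: real^'n^'n) = A ** C - B ** C"
  by (simp add: matrix_matrix_mult_def vec_eq_iff sum_subtractf algebra_simps)

lemma matrix_minus_left: "(- A) ** (C :: real^'n^'n) = - (A ** C)"
  by (simp add: matrix_matrix_mult_def vec_eq_iff sum_negf)

lemma matrix_minus_right: "(C :: real^'n^'n) ** (- A) = - (C ** A)"
  by (simp add: matrix_matrix_mult_def vec_eq_iff sum_negf)

lemma matrix_scaleR_left: "(c *\<^sub>R A) ** (C :: real^'n^'n) = c *\<^sub>R (A ** C)"
  by (simp add: matrix_matrix_mult_def vec_eq_iff sum_distrib_left algebra_simps)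

lemma matrix_scaleR_right: "(C :: real^'n^'n) ** (c *\<^sub>R A) = c *\<^sub>R (C ** A)"
  by (simp add: matrix_matrix_mult_def vec_eq_iff sum_distrib_left algebra_simps)

lemma transpose_add: "transpose (A + B :: real^'n^'n) = transpose A + transpose B"
  by (simp add: transpose_def vec_eq_iff)

lemma transpose_diff: "transpose (A - B :: real^'n^'n) = transpose A - transpose B"
  by (simp add: transpose_def vec_eq_iff)

lemma transpose_minus: "transpose (- A :: real^'n^'n) = - transpose A"
  by (simp add: transpose_def vec_eq_iff)

lemma transpose_sum: "transpose (\<Sum>a\<in>I. M a :: real^'n^'n) = (\<Sum>a\<in>I. transpose (M a))"
  by (simp add: transpose_def vec_eq_iff)

lemmas matrix_ring = matrix_add_rdist matrix_add_ldistrib matrix_diff_ldist matrix_diff_rdist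
  matrix_minus_left matrix_minus_right matrix_mul_assoc
  transpose_add transpose_diff transpose_minus matrix_transpose_mul

lemma transpose_nth: "transpose A $ i $ j = A $ j $ i"
  by (simp add: transpose_def)

lemma matrix_mult_nth: "(A ** B) $ i $ j = (\<Sum>k\<in>UNIV. A $ i $ k * B $ k $ j)"
  by (simp add: matrix_matrix_mult_def)

lemma matrix_sum_left: "(\<Sum>a\<in>I. M a) ** (C :: real^'n^'n) = (\<Sum>a\<in>I. M a ** C)"
  by (simp add: vec_eq_iff matrix_mult_nth sum_distrib_right) (intro allI, rule sum.swap)

lemma matrix_sum_right: "(C :: real^'n^'n) ** (\<Sum>a\<in>I. M a) = (\<Sum>a\<in>I. C ** M a)"
  by (simp add: vec_eq_iff matrix_mult_nth sum_distrib_left) (intro allI, rule sum.swap)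

lemma trace_minus: "trace (- A :: real^'n^'n) = - trace A"
  by (simp add: trace_def sum_negf)

text \<open>Partial derivatives are taken entry by entry, since \<^const>\<open>christoffel\<close> and \<^const>\<open>riemann_curv\<close> are
  expressions in the entries of the metric.\<close>

definition mderiv :: "'m \<Rightarrow> (real^'m \<Rightarrow> real^'n^'n) \<Rightarrow> real^'m \<Rightarrow> real^'n::finite^'n"
  where "mderiv i M x = (\<chi> a b. pderiv_coord i (\<lambda>y. M y $ a $ b) x)" for i :: "'m::finite"

definition msmooth :: "'a::real_normed_vector set \<Rightarrow> ('a \<Rightarrow> real^'n^'n) \<Rightarrow> bool"
  where "msmooth V M \<longleftrightarrow> (\<forall>k a b. ck k V (\<lambda>x. M x $ a $ b))"

lemma msmoothI: "(\<And>k a b. ck k V (\<lambda>x. M x $ a $ b)) \<Longrightarrow> msmooth V M"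
  by (simp add: msmooth_def)

lemma msmooth_ck: "msmooth V M \<Longrightarrow> ck k V (\<lambda>x. M x $ a $ b)"
  by (simp add: msmooth_def)

lemma msmooth_add: "msmooth V M \<Longrightarrow> msmooth V N \<Longrightarrow> msmooth V (\<lambda>x. M x + N x)"
  by (simp add: msmooth_def ck_add)

lemma msmooth_diff: "msmooth V M \<Longrightarrow> msmooth V N \<Longrightarrow> msmooth V (\<lambda>x. M x - N x)"
  by (simp add: msmooth_def ck_diff)

lemma msmooth_mult: "msmooth V M \<Longrightarrow> msmooth V N \<Longrightarrow> msmooth V (\<lambda>x. M x ** N x)"
  by (simp add: msmooth_def matrix_mult_nth ck_sum ck_mult)

lemma msmooth_transpose: "msmooth V M \<Longrightarrow> msmooth V (\<lambda>x. transpose (M x))"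
  by (simp add: msmooth_def transpose_nth)

lemma msmooth_deriv: "msmooth V M \<Longrightarrow> open V \<Longrightarrow> msmooth V (mderiv i M)"
  unfolding msmooth_def mderiv_def by (auto intro!: ck_pderiv)

lemma ck_trace: "msmooth V M \<Longrightarrow> ck k V (\<lambda>x. trace (M x))"
  unfolding trace_def by (intro ck_sum msmooth_ck)

lemma msmooth_differentiable:
  "msmooth V M \<Longrightarrow> open V \<Longrightarrow> x \<in> V \<Longrightarrow> (\<lambda>x. M x $ a $ b) differentiable (at x)"
  using ck_differentiable msmooth_ck by blast

abbreviation mdiff :: "(real^'m \<Rightarrow> real^'n^'n) \<Rightarrow> real^'m \<Rightarrow> bool"
  where "mdiff M x \<equiv> \<forall>a b. (\<lambda>x. M x $ a $ b) differentiable (at x)"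

lemma mdiffD: "mdiff M x \<Longrightarrow> (\<lambda>x. M x $ a $ b) differentiable (at x)"
  by blast

lemma msmooth_mdiff: "msmooth V M \<Longrightarrow> open V \<Longrightarrow> x \<in> V \<Longrightarrow> mdiff M x"
  using msmooth_differentiable by blast

lemma mderiv_nth: "mderiv i M x $ a $ b = pderiv_coord i (\<lambda>y. M y $ a $ b) x"
  by (simp add: mderiv_def)

lemma mderiv_add: "mdiff M x \<Longrightarrow> mdiff N x \<Longrightarrow> mderiv i (\<lambda>y. M y + N y) x = mderiv i M x + mderiv i N x"
  by (simp add: mderiv_def vec_eq_iff pderiv_add)

lemma mderiv_diff: "mdiff M x \<Longrightarrow> mdiff N x \<Longrightarrow> mderiv i (\<lambda>y. M y - N y) x = mderiv i M x - mderiv i N x"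
  by (simp add: mderiv_def vec_eq_iff pderiv_diff)

lemma mderiv_mult:
  "mdiff M x \<Longrightarrow> mdiff N x \<Longrightarrow> mderiv i (\<lambda>y. M y ** N y) x = mderiv i M x ** N x + M x ** mderiv i N x"
  by (simp add: vec_eq_iff mderiv_nth matrix_mult_nth pderiv_sum pderiv_mult sum.distrib)

lemma mderiv_transpose: "mderiv i (\<lambda>y. transpose (M y)) x = transpose (mderiv i M x)"
  by (simp add: mderiv_def vec_eq_iff transpose_def)

lemma mderiv_const [simp]: "mderiv i (\<lambda>y. C) x = 0"
  by (simp add: mderiv_def vec_eq_iff)

lemma mderiv_cong_open:
  assumes "open V" "x \<in> V" "\<And>y. y \<in> V \<Longrightarrow> M y = N y"
  shows "mderiv i M x = mderiv i N x"
proof -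
  have "pderiv_coord i (\<lambda>y. M y $ a $ b) x = pderiv_coord i (\<lambda>y. N y $ a $ b) x" for a b
    using assms by (intro pderiv_cong_open[OF assms(1,2)]) simp
  then show ?thesis by (simp add: vec_eq_iff mderiv_nth)
qed

lemma mderiv_commute:
  assumes "msmooth V M" "open V" "x \<in> V"
  shows "mderiv i (mderiv j M) x = mderiv j (mderiv i M) x"
proof -
  have "pderiv_coord i (pderiv_coord j (\<lambda>y. M y $ a $ b)) x =
      pderiv_coord j (pderiv_coord i (\<lambda>y. M y $ a $ b)) x" for a b
    using pderiv_commute[OF msmooth_ck[OF assms(1)] assms(2,3)] .
  then show ?thesis by (simp add: vec_eq_iff mderiv_nth)
qed

lemma pderiv_trace:
  assumes "mdiff M x"
  shows "pderiv_coord i (\<lambda>y. trace (M y)) x = trace (mderiv i M x)"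
  unfolding trace_def using assms by (simp add: pderiv_sum mderiv_nth)

section \<open>Levi-Civita connection and curvature in a chart\<close>

text \<open>The connection matrix \<open>\<Gamma>\<^sub>i\<close> in direction \<open>i\<close>: row \<open>k\<close>, column \<open>j\<close> contains \<open>\<Gamma>\<^sup>k\<^sub>i\<^sub>j\<close>.\<close>

definition Gam :: "(real^'n \<Rightarrow> real^'n^'n) \<Rightarrow> 'n \<Rightarrow> real^'n \<Rightarrow> real^'n::finite^'n"
  where "Gam G i x = (\<chi> k j. christoffel G k i j x)"

text \<open>The curvature as a 2-form with values in matrices: row \<open>l\<close>, column \<open>k\<close> contains \<open>R\<^sup>l\<^sub>k\<^sub>i\<^sub>j\<close>.\<close>

definition curv :: "(real^'n \<Rightarrow> real^'n^'n) \<Rightarrow> 'n \<Rightarrow> 'n \<Rightarrow> real^'n \<Rightarrow> real^'n::finite^'n"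
  where "curv G i j x = mderiv i (Gam G j) x - mderiv j (Gam G i) x
    + Gam G i x ** Gam G j x - Gam G j x ** Gam G i x"

lemma Gam_nth: "Gam G i x $ k $ j = christoffel G k i j x"
  by (simp add: Gam_def)

lemma riemann_curv_eq: "riemann_curv G l k i j x = curv G i j x $ l $ k"
  by (simp add: riemann_curv_def curv_def mderiv_nth Gam_nth matrix_mult_nth sum_subtractf)

lemma ricci_matrix_nth: "ricci_matrix G x $ j $ k = (\<Sum>i\<in>UNIV. curv G i j x $ i $ k)"
  by (simp add: ricci_matrix_def riemann_curv_eq)

lemma curv_swap: "curv G j i x = - curv G i j x"
  by (simp add: curv_def)

definition scal :: "(real^'n \<Rightarrow> real^'n^'n) \<Rightarrow> real^'n::finite \<Rightarrow> real"
  where "scal G x = trace (matrix_inv (G x) ** ricci_matrix G x)"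

text \<open>The covariant derivative \<open>\<nabla>\<^sub>m\<close> of the curvature. The commutator with \<open>\<Gamma>\<^sub>m\<close> accounts for the two matrix
  indices and the sums for the two form indices.\<close>

definition cov_curv :: "(real^'n \<Rightarrow> real^'n^'n) \<Rightarrow> 'n \<Rightarrow> 'n \<Rightarrow> 'n \<Rightarrow> real^'n \<Rightarrow> real^'n::finite^'n"
  where "cov_curv G m i j x = mderiv m (curv G i j) x + Gam G m x ** curv G i j x
    - curv G i j x ** Gam G m x
    - (\<Sum>a\<in>UNIV. Gam G m x $ a $ i *\<^sub>R curv G a j x) - (\<Sum>a\<in>UNIV. Gam G m x $ a $ j *\<^sub>R curv G i a x)"

definition cov_ricci :: "(real^'n \<Rightarrow> real^'n^'n) \<Rightarrow> 'n \<Rightarrow> real^'n \<Rightarrow> real^'n::finite^'n"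
  where "cov_ricci G m x = mderiv m (ricci_matrix G) x
    - ricci_matrix G x ** Gam G m x - transpose (Gam G m x) ** ricci_matrix G x"

locale metric_chart =
  fixes V :: "(real^'n) set" and G :: "real^'n \<Rightarrow> real^'n::finite^'n"
  assumes open_V: "open V" and smooth_G: "msmooth V G"
    and posdef_G: "\<And>x. x \<in> V \<Longrightarrow> posdef (G x)"
begin

abbreviation "H x \<equiv> matrix_inv (G x)"
abbreviation "\<Gamma> \<equiv> Gam G"
abbreviation "F \<equiv> curv G"
abbreviation "S \<equiv> ricci_matrix G"

lemma G_sym: "x \<in> V \<Longrightarrow> transpose (G x) = G x"
  using posdef_G posdef_def by blast

lemma G_sym_nth: "x \<in> V \<Longrightarrow> G x $ i $ j = G x $ j $ i"
  by (metis G_sym transpose_nth)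

lemma det_G: "x \<in> V \<Longrightarrow> det (G x) \<noteq> 0"
  using posdef_G posdef_det by blast

lemma GH: "x \<in> V \<Longrightarrow> G x ** H x = mat 1" and HG: "x \<in> V \<Longrightarrow> H x ** G x = mat 1"
  using matrix_inv_inverse det_G by blast+

lemma H_sym: "x \<in> V \<Longrightarrow> transpose (H x) = H x"
  using transpose_matrix_inv det_G G_sym by blast

lemma H_sym_nth: "x \<in> V \<Longrightarrow> H x $ i $ j = H x $ j $ i"
  by (metis H_sym transpose_nth)

lemma smooth_H: "msmooth V H"
  using ck_matrix_inv[of _ V G] smooth_G det_G by (auto simp: msmooth_def)

lemma smooth_Gam: "msmooth V (\<Gamma> i)"
proof (rule msmoothI)
  fix k a b
  have "ck k V (pderiv_coord i (\<lambda>y. G y $ p $ q))" for i p q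
    using ck_pderiv[OF msmooth_ck[OF smooth_G] open_V] .
  then have "ck k V (christoffel G a i b)"
    unfolding christoffel_def[abs_def]
    by (intro ck_divide ck_sum ck_mult ck_add ck_diff msmooth_ck[OF smooth_H] ck_const) auto
  then show "ck k V (\<lambda>x. \<Gamma> i x $ a $ b)" by (simp add: Gam_nth)
qed

lemma smooth_curv: "msmooth V (F i j)"
  unfolding curv_def[abs_def]
  by (intro msmooth_add msmooth_diff msmooth_mult msmooth_deriv smooth_Gam open_V)

lemma smooth_ricci: "msmooth V S"
  by (rule msmoothI) (simp add: ricci_matrix_nth ck_sum msmooth_ck smooth_curv)

lemma ck_scal: "ck k V (scal G)"
  unfolding scal_def[abs_def] by (intro ck_trace msmooth_mult smooth_H smooth_ricci)

lemma Gam_sym: "x \<in> V \<Longrightarrow> \<Gamma> i x $ k $ j = \<Gamma> j x $ k $ i"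
proof -
  assume x: "x \<in> V"
  have "pderiv_coord l (\<lambda>y. G y $ i $ j) x = pderiv_coord l (\<lambda>y. G y $ j $ i) x" for l
    by (rule pderiv_cong_open[OF open_V x]) (rule G_sym_nth)
  then show ?thesis by (simp add: Gam_nth christoffel_def algebra_simps)
qed

text \<open>The Koszul formula for the connection with its upper index lowered.\<close>

lemma koszul:
  assumes x: "x \<in> V"
  shows "(G x ** \<Gamma> i x) $ l $ j = (pderiv_coord i (\<lambda>y. G y $ j $ l) x
    + pderiv_coord j (\<lambda>y. G y $ i $ l) x - pderiv_coord l (\<lambda>y. G y $ i $ j) x) / 2"
proof -
  define c :: "real^'n" where "c = (\<chi> l. (pderiv_coord i (\<lambda>y. G y $ j $ l) x
    + pderiv_coord j (\<lambda>y. G y $ i $ l) x - pderiv_coord l (\<lambda>y. G y $ i $ j) x) / 2)"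
  have "\<Gamma> i x $ k $ j = (H x *v c) $ k" for k
    by (simp add: Gam_nth christoffel_def matrix_vector_mult_def c_def sum_divide_distrib)
  then have "(G x ** \<Gamma> i x) $ l $ j = (G x *v (H x *v c)) $ l"
    by (simp add: matrix_mult_nth matrix_vector_mult_def)
  also have "\<dots> = c $ l"
    by (simp add: matrix_vector_mul_assoc GH[OF x])
  finally show ?thesis by (simp add: c_def)
qed

lemma compat:
  assumes x: "x \<in> V"
  shows "mderiv i G x = G x ** \<Gamma> i x + transpose (\<Gamma> i x) ** G x"
proof -
  have sym: "pderiv_coord k (\<lambda>y. G y $ i $ j) x = pderiv_coord k (\<lambda>y. G y $ j $ i) x" for i j k
    by (rule pderiv_cong_open[OF open_V x]) (rule G_sym_nth)
  have "mderiv i G x $ l $ j = (G x ** \<Gamma> i x + transpose (\<Gamma> i x) ** G x) $ l $ j" for l j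
  proof -
    have "(transpose (\<Gamma> i x) ** G x) = transpose (G x ** \<Gamma> i x)"
      by (simp add: matrix_transpose_mul G_sym x)
    then have t: "(transpose (\<Gamma> i x) ** G x) $ l $ j = (G x ** \<Gamma> i x) $ j $ l"
      by (simp add: transpose_nth)
    show ?thesis
      unfolding mderiv_nth vector_add_component t koszul[OF x] sym[of j l i] by (simp add: field_simps) (rule sym)
  qed
  then show ?thesis by (simp add: vec_eq_iff)
qed

lemma inverse_compat:
  assumes x: "x \<in> V"
  shows "mderiv i H x = - (\<Gamma> i x ** H x) - H x ** transpose (\<Gamma> i x)"
proof -
  have "0 = mderiv i (\<lambda>y. mat 1) x" by simp
  also have "\<dots> = mderiv i (\<lambda>y. G y ** H y) x"
    by (rule mderiv_cong_open[OF open_V x]) (simp add: GH)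
  also have "\<dots> = mderiv i G x ** H x + G x ** mderiv i H x"
    using smooth_G smooth_H open_V x by (intro mderiv_mult msmooth_mdiff[where V = V])
  finally have "G x ** mderiv i H x = - (mderiv i G x ** H x)"
    by (simp add: eq_neg_iff_add_eq_0 add.commute)
  then have "H x ** (G x ** mderiv i H x) = H x ** - (mderiv i G x ** H x)" by simp
  then have "mderiv i H x = - (H x ** (mderiv i G x ** H x))"
    by (simp add: matrix_mul_assoc HG[OF x] matrix_minus_right)
  also have "\<dots> = - (H x ** G x ** \<Gamma> i x ** H x) - H x ** transpose (\<Gamma> i x) ** (G x ** H x)"
    by (simp add: compat[OF x] matrix_ring)
  finally show ?thesis by (simp add: HG GH x)
qed

text \<open>Metric compatibility expresses \<open>\<partial>\<^sub>i \<partial>\<^sub>j G - \<partial>\<^sub>j \<partial>\<^sub>i G\<close>, which is zero, as the symmetrization of \<open>G F\<^sub>i\<^sub>j\<close>.\<close>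

lemma lowered_curv_antisym:
  assumes x: "x \<in> V"
  shows "transpose (G x ** F i j x) = - (G x ** F i j x)"
proof -
  note d = msmooth_mdiff[OF _ open_V x]
  have dd: "mderiv i (mderiv j G) x =
      (G x ** \<Gamma> i x + transpose (\<Gamma> i x) ** G x) ** \<Gamma> j x + G x ** mderiv i (\<Gamma> j) x
      + (transpose (mderiv i (\<Gamma> j) x) ** G x + transpose (\<Gamma> j x) ** (G x ** \<Gamma> i x + transpose (\<Gamma> i x) ** G x))" for i j
  proof -
    have "mderiv i (mderiv j G) x = mderiv i (\<lambda>x. G x ** \<Gamma> j x + transpose (\<Gamma> j x) ** G x) x"
      by (rule mderiv_cong_open[OF open_V x]) (rule compat)
    also have "\<dots> = mderiv i (\<lambda>x. G x ** \<Gamma> j x) x + mderiv i (\<lambda>x. transpose (\<Gamma> j x) ** G x) x"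
      by (intro mderiv_add d msmooth_mult msmooth_transpose smooth_G smooth_Gam)
    also have "mderiv i (\<lambda>x. G x ** \<Gamma> j x) x = mderiv i G x ** \<Gamma> j x + G x ** mderiv i (\<Gamma> j) x"
      by (intro mderiv_mult d msmooth_mult msmooth_transpose smooth_G smooth_Gam)
    also have "mderiv i (\<lambda>x. transpose (\<Gamma> j x) ** G x) x =
        mderiv i (\<lambda>x. transpose (\<Gamma> j x)) x ** G x + transpose (\<Gamma> j x) ** mderiv i G x"
      by (intro mderiv_mult d msmooth_mult msmooth_transpose smooth_G smooth_Gam)
    finally show ?thesis by (simp add: compat[OF x] mderiv_transpose)
  qed
  have "G x ** F i j x + transpose (G x ** F i j x) = mderiv i (mderiv j G) x - mderiv j (mderiv i G) x"
    unfolding dd[of i j] dd[of j i] curv_def by (simp add: matrix_ring G_sym x)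
  also have "\<dots> = 0"
    using mderiv_commute[OF smooth_G open_V x] by simp
  finally show ?thesis by (simp add: eq_neg_iff_add_eq_0 add.commute)
qed

text \<open>The contributions of the form indices cancel in the cyclic sum because \<open>\<Gamma>\<close> is symmetric and \<open>F\<close>
  antisymmetric. What remains is the Jacobi identity together with the commutation of partial
  derivatives.\<close>

lemma second_bianchi:
  assumes x: "x \<in> V"
  shows "cov_curv G m i j x + cov_curv G i j m x + cov_curv G j m i x = 0"
proof -
  note d = msmooth_mdiff[OF _ open_V x]
  define s where "s m i j = (\<Sum>a\<in>UNIV. \<Gamma> m x $ a $ i *\<^sub>R F a j x)" for m i j
  have s_sym: "s m i j = s i m j" for m i j
    unfolding s_def using Gam_sym[OF x] by simp
  have s_alt: "(\<Sum>a\<in>UNIV. \<Gamma> m x $ a $ j *\<^sub>R F i a x) = - s m j i" for m i j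
    unfolding s_def by (subst curv_swap) (simp add: sum_negf)
  have D: "mderiv m (F i j) x = mderiv m (mderiv i (\<Gamma> j)) x - mderiv m (mderiv j (\<Gamma> i)) x
      + (mderiv m (\<Gamma> i) x ** \<Gamma> j x + \<Gamma> i x ** mderiv m (\<Gamma> j) x)
      - (mderiv m (\<Gamma> j) x ** \<Gamma> i x + \<Gamma> j x ** mderiv m (\<Gamma> i) x)" for m i j
    unfolding curv_def[abs_def]
    by (simp add: mderiv_add mderiv_diff mderiv_mult d smooth_Gam msmooth_add msmooth_diff
        msmooth_mult msmooth_deriv open_V)
  have c: "mderiv a (mderiv b (\<Gamma> k)) x = mderiv b (mderiv a (\<Gamma> k)) x" for a b k
    by (rule mderiv_commute[OF smooth_Gam open_V x])
  have "cov_curv G m i j x + cov_curv G i j m x + cov_curv G j m i x =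
     (mderiv m (F i j) x + \<Gamma> m x ** F i j x - F i j x ** \<Gamma> m x)
     + (mderiv i (F j m) x + \<Gamma> i x ** F j m x - F j m x ** \<Gamma> i x)
     + (mderiv j (F m i) x + \<Gamma> j x ** F m i x - F m i x ** \<Gamma> j x)"
    unfolding cov_curv_def s_alt s_def[symmetric]
    using s_sym[of m i j] s_sym[of i j m] s_sym[of j m i] by simp
  also have "\<dots> = 0"
    unfolding D unfolding curv_def using c[of m i j] c[of m j i] c[of i j m]
    by (simp add: matrix_ring)
  finally show ?thesis .
qed

text \<open>Differentiating the antisymmetry of \<open>G F\<^sub>i\<^sub>j\<close>; as \<open>\<nabla>G = 0\<close>, the metric passes through \<open>\<nabla>\<^sub>m\<close>.\<close>

lemma lowered_cov_curv_antisym: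
  assumes x: "x \<in> V"
  shows "transpose (G x ** cov_curv G m i j x) = - (G x ** cov_curv G m i j x)"
proof -
  note d = msmooth_mdiff[OF _ open_V x]
  let ?K = "\<lambda>i j. G x ** F i j x"
  have K: "transpose (?K i j) = - ?K i j" for i j
    by (rule lowered_curv_antisym[OF x])
  define DK where "DK = mderiv m (\<lambda>x. G x ** F i j x) x"
  have DK: "DK = (G x ** \<Gamma> m x + transpose (\<Gamma> m x) ** G x) ** F i j x + G x ** mderiv m (F i j) x"
    unfolding DK_def using mderiv_mult[OF d[OF smooth_G] d[OF smooth_curv]] compat[OF x] by simp
  have "transpose DK = mderiv m (\<lambda>x. transpose (G x ** F i j x)) x"
    unfolding DK_def mderiv_transpose ..
  also have "\<dots> = mderiv m (\<lambda>x. 0 - (G x ** F i j x)) x"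
    by (rule mderiv_cong_open[OF open_V x]) (simp add: lowered_curv_antisym)
  also have "\<dots> = - DK"
    unfolding DK_def using mderiv_diff[of "\<lambda>_. 0" x "\<lambda>x. G x ** F i j x"]
      d[OF msmooth_mult[OF smooth_G smooth_curv]] by simp
  finally have tDK: "transpose DK = - DK" .
  have eq: "G x ** cov_curv G m i j x = DK - transpose (\<Gamma> m x) ** ?K i j - ?K i j ** \<Gamma> m x
    - (\<Sum>a\<in>UNIV. \<Gamma> m x $ a $ i *\<^sub>R ?K a j) - (\<Sum>a\<in>UNIV. \<Gamma> m x $ a $ j *\<^sub>R ?K i a)"
    unfolding DK cov_curv_def
    by (simp add: matrix_ring matrix_sum_right matrix_scaleR_right)
  have "transpose (transpose (\<Gamma> m x) ** ?K i j + ?K i j ** \<Gamma> m x) =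
      transpose (?K i j) ** \<Gamma> m x + transpose (\<Gamma> m x) ** transpose (?K i j)"
    unfolding transpose_add matrix_transpose_mul[of "transpose (\<Gamma> m x)"] matrix_transpose_mul[of "?K i j"] by simp
  also have "\<dots> = - (transpose (\<Gamma> m x) ** ?K i j + ?K i j ** \<Gamma> m x)"
    unfolding K by (simp add: matrix_minus_left matrix_minus_right)
  finally have t1: "transpose (transpose (\<Gamma> m x) ** ?K i j + ?K i j ** \<Gamma> m x) =
    - (transpose (\<Gamma> m x) ** ?K i j + ?K i j ** \<Gamma> m x)" .
  have t2: "transpose (\<Sum>a\<in>UNIV. \<Gamma> m x $ a $ i *\<^sub>R ?K a j) = - (\<Sum>a\<in>UNIV. \<Gamma> m x $ a $ i *\<^sub>R ?K a j)"
    unfolding transpose_sum transpose_scalar K by (simp add: sum_negf)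
  have t3: "transpose (\<Sum>a\<in>UNIV. \<Gamma> m x $ a $ j *\<^sub>R ?K i a) = - (\<Sum>a\<in>UNIV. \<Gamma> m x $ a $ j *\<^sub>R ?K i a)"
    unfolding transpose_sum transpose_scalar K by (simp add: sum_negf)
  have eq': "G x ** cov_curv G m i j x = DK - (transpose (\<Gamma> m x) ** ?K i j + ?K i j ** \<Gamma> m x)
    - (\<Sum>a\<in>UNIV. \<Gamma> m x $ a $ i *\<^sub>R ?K a j) - (\<Sum>a\<in>UNIV. \<Gamma> m x $ a $ j *\<^sub>R ?K i a)"
    unfolding eq by simp
  show ?thesis
    unfolding eq' unfolding transpose_diff[of "_ - _"] transpose_diff[of "DK"] tDK t1 t2 t3 by simp
qed

lemma raised_cov_curv_antisym:
  assumes x: "x \<in> V"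
  shows "transpose (cov_curv G m i j x ** H x) = - (cov_curv G m i j x ** H x)"
proof -
  let ?C = "cov_curv G m i j x"
  have "?C ** H x = H x ** (G x ** ?C) ** H x"
    by (simp add: matrix_mul_assoc HG[OF x])
  then have "transpose (?C ** H x) = H x ** transpose (G x ** ?C) ** H x"
    by (simp add: matrix_transpose_mul H_sym[OF x] matrix_mul_assoc)
  also have "\<dots> = - (H x ** (G x ** ?C) ** H x)"
    unfolding lowered_cov_curv_antisym[OF x] by (simp add: matrix_ring)
  finally show ?thesis by (simp add: matrix_mul_assoc HG[OF x])
qed

lemma cov_curv_swap: "x \<in> V \<Longrightarrow> cov_curv G m j i x = - cov_curv G m i j x"
proof -
  assume x: "x \<in> V"
  have "mderiv m (F j i) x = mderiv m (\<lambda>x. 0 - F i j x) x"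
    by (rule mderiv_cong_open[OF open_V x]) (simp add: curv_swap[of G j i])
  also have "\<dots> = - mderiv m (F i j) x"
    using mderiv_diff[of "\<lambda>_. 0" x "F i j"] msmooth_mdiff[OF smooth_curv open_V x] by simp
  finally have 1: "mderiv m (F j i) x = - mderiv m (F i j) x" .
  have 2: "(\<Sum>a\<in>UNIV. \<Gamma> m x $ a $ p *\<^sub>R F a q x) = - (\<Sum>a\<in>UNIV. \<Gamma> m x $ a $ p *\<^sub>R F q a x)" for p q
    by (subst curv_swap) (simp add: sum_negf)
  show ?thesis
    unfolding cov_curv_def 1 2 curv_swap[of G j i] by (simp add: matrix_ring)
qed

text \<open>Contraction commutes with \<open>\<nabla>\<^sub>m\<close>: the term of the upper index cancels that of the contracted form index.\<close>

lemma trace_cov_curv: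
  assumes x: "x \<in> V"
  shows "(\<Sum>i\<in>UNIV. cov_curv G m i j x $ i $ k) = cov_ricci G m x $ j $ k"
proof -
  have 1: "(\<Sum>i\<in>UNIV. mderiv m (F i j) x $ i $ k) = mderiv m S x $ j $ k"
    unfolding mderiv_nth ricci_matrix_nth
    using msmooth_mdiff[OF smooth_curv open_V x] by (simp add: pderiv_sum)
  have 2: "(\<Sum>i\<in>UNIV. (\<Gamma> m x ** F i j x) $ i $ k) =
      (\<Sum>i\<in>UNIV. (\<Sum>a\<in>UNIV. \<Gamma> m x $ a $ i *\<^sub>R F a j x) $ i $ k)"
    unfolding matrix_mult_nth by (simp, rule sum.swap)
  have 3: "(\<Sum>i\<in>UNIV. (F i j x ** \<Gamma> m x) $ i $ k) = (S x ** \<Gamma> m x) $ j $ k"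
    unfolding matrix_mult_nth ricci_matrix_nth sum_distrib_right by (rule sum.swap)
  have 4: "(\<Sum>i\<in>UNIV. (\<Sum>a\<in>UNIV. \<Gamma> m x $ a $ j *\<^sub>R F i a x) $ i $ k) = (transpose (\<Gamma> m x) ** S x) $ j $ k"
    unfolding matrix_mult_nth ricci_matrix_nth sum_distrib_left by (simp add: transpose_nth, rule sum.swap)
  show ?thesis
    unfolding cov_curv_def cov_ricci_def
    using 1 2 3 4 by (simp add: sum.distrib sum_subtractf)
qed

lemma scal_deriv:
  assumes x: "x \<in> V"
  shows "pderiv_coord j (scal G) x = trace (H x ** cov_ricci G j x)"
proof -
  note d = msmooth_mdiff[OF _ open_V x]
  have "pderiv_coord j (scal G) x = trace (mderiv j (\<lambda>x. H x ** S x) x)"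
    unfolding scal_def[abs_def] by (rule pderiv_trace[OF d[OF msmooth_mult[OF smooth_H smooth_ricci]]])
  also have "mderiv j (\<lambda>x. H x ** S x) x = mderiv j H x ** S x + H x ** mderiv j S x"
    by (rule mderiv_mult[OF d[OF smooth_H] d[OF smooth_ricci]])
  also have "trace (\<dots>) = trace (H x ** mderiv j S x) - trace (\<Gamma> j x ** (H x ** S x)) - trace (H x ** transpose (\<Gamma> j x) ** S x)"
    unfolding inverse_compat[OF x] by (simp add: matrix_ring trace_add trace_sub trace_minus)
  also have "trace (\<Gamma> j x ** (H x ** S x)) = trace (H x ** S x ** \<Gamma> j x)"
    by (rule trace_mul_sym)
  finally show ?thesis
    unfolding cov_ricci_def by (simp add: matrix_ring trace_sub)
qed

text \<open>Contracting the cyclic identity of \<open>second_bianchi\<close> over the upper index and with the inverse metric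
  gives three terms: the divergence of the Ricci tensor, \<open>- \<partial>\<^sub>j R\<close>, and a third term which the
  antisymmetry of \<open>(\<nabla>\<^sub>i F\<^sub>j\<^sub>m) H\<close> turns into the divergence once more.\<close>

lemma contracted_bianchi:
  assumes x: "x \<in> V"
  shows "2 * (\<Sum>k\<in>UNIV. \<Sum>m\<in>UNIV. H x $ k $ m * cov_ricci G m x $ j $ k) = pderiv_coord j (scal G) x"
proof -
  let ?C = "\<lambda>m i j. cov_curv G m i j x"
  let ?N = "\<Sum>k\<in>UNIV. \<Sum>m\<in>UNIV. H x $ k $ m * cov_ricci G m x $ j $ k"
  have t2: "(\<Sum>i\<in>UNIV. ?C j m i $ i $ k) = - (cov_ricci G j x $ m $ k)" for m k
    using trace_cov_curv[OF x, of j m k] by (simp add: cov_curv_swap[OF x, of j m] sum_negf)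
  have "cov_ricci G m x $ j $ k + (\<Sum>i\<in>UNIV. ?C i j m $ i $ k) - cov_ricci G j x $ m $ k = 0" for m k
  proof -
    have "(\<Sum>i\<in>UNIV. (?C m i j + ?C i j m + ?C j m i) $ i $ k) = 0"
      by (simp only: second_bianchi[OF x]) simp
    then show ?thesis
      using trace_cov_curv[OF x, of m j k] t2[of m k] by (simp add: sum.distrib)
  qed
  then have "(\<Sum>k\<in>UNIV. \<Sum>m\<in>UNIV. H x $ k $ m * (cov_ricci G m x $ j $ k
      + (\<Sum>i\<in>UNIV. ?C i j m $ i $ k) - cov_ricci G j x $ m $ k)) = 0"
    by simp
  then have main: "?N + (\<Sum>k\<in>UNIV. \<Sum>m\<in>UNIV. H x $ k $ m * (\<Sum>i\<in>UNIV. ?C i j m $ i $ k))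
      - (\<Sum>k\<in>UNIV. \<Sum>m\<in>UNIV. H x $ k $ m * cov_ricci G j x $ m $ k) = 0"
    by (simp add: algebra_simps sum.distrib sum_subtractf)
  have tr: "(\<Sum>k\<in>UNIV. \<Sum>m\<in>UNIV. H x $ k $ m * cov_ricci G j x $ m $ k) = pderiv_coord j (scal G) x"
    unfolding scal_deriv[OF x] trace_def matrix_mult_nth ..
  have "(\<Sum>k\<in>UNIV. \<Sum>m\<in>UNIV. H x $ k $ m * (\<Sum>i\<in>UNIV. ?C i j m $ i $ k)) =
      (\<Sum>k\<in>UNIV. \<Sum>m\<in>UNIV. \<Sum>i\<in>UNIV. ?C i j m $ i $ k * H x $ k $ m)"
    by (simp add: sum_distrib_left mult.commute)
  also have "\<dots> = (\<Sum>m\<in>UNIV. \<Sum>k\<in>UNIV. \<Sum>i\<in>UNIV. ?C i j m $ i $ k * H x $ k $ m)"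
    by (rule sum.swap)
  also have "\<dots> = (\<Sum>m\<in>UNIV. \<Sum>i\<in>UNIV. (?C i j m ** H x) $ i $ m)"
    unfolding matrix_mult_nth by (rule sum.cong[OF refl]) (rule sum.swap)
  also have "\<dots> = (\<Sum>m\<in>UNIV. \<Sum>i\<in>UNIV. (?C i m j ** H x) $ m $ i)"
  proof (intro sum.cong refl)
    fix m i
    have "(?C i j m ** H x) $ i $ m = transpose (?C i j m ** H x) $ m $ i"
      by (simp add: transpose_nth)
    also have "\<dots> = (?C i m j ** H x) $ m $ i"
      unfolding raised_cov_curv_antisym[OF x] cov_curv_swap[OF x, of i m j] by (simp add: matrix_minus_left)
    finally show "(?C i j m ** H x) $ i $ m = (?C i m j ** H x) $ m $ i" .
  qed
  also have "\<dots> = (\<Sum>i\<in>UNIV. \<Sum>m\<in>UNIV. (?C i m j ** H x) $ m $ i)"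
    by (rule sum.swap)
  also have "\<dots> = (\<Sum>i\<in>UNIV. \<Sum>k\<in>UNIV. (\<Sum>m\<in>UNIV. ?C i m j $ m $ k) * H x $ k $ i)"
    unfolding matrix_mult_nth sum_distrib_right by (rule sum.cong[OF refl]) (rule sum.swap)
  also have "\<dots> = (\<Sum>i\<in>UNIV. \<Sum>k\<in>UNIV. H x $ k $ i * cov_ricci G i x $ j $ k)"
    unfolding trace_cov_curv[OF x] by (simp add: mult.commute)
  also have "\<dots> = ?N" by (rule sum.swap)
  finally show ?thesis using main tr by simp
qed

end

section \<open>Evolution of the scalar curvature\<close>

definition has_mderiv :: "(real \<Rightarrow> real^'n^'n) \<Rightarrow> real \<Rightarrow> real^'n::finite^'n \<Rightarrow> bool"
  where "has_mderiv M t D \<longleftrightarrow> (\<forall>a b. ((\<lambda>s. M s $ a $ b) has_real_derivative D $ a $ b) (at t))"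

lemma has_mderivD: "has_mderiv M t D \<Longrightarrow> ((\<lambda>s. M s $ a $ b) has_real_derivative D $ a $ b) (at t)"
  by (simp add: has_mderiv_def)

lemma has_mderiv_mult:
  assumes "has_mderiv M t D" "has_mderiv N t E"
  shows "has_mderiv (\<lambda>s. M s ** N s) t (D ** N t + M t ** E)"
  unfolding has_mderiv_def
proof (intro allI)
  fix a b
  have "((\<lambda>s. \<Sum>k\<in>UNIV. M s $ a $ k * N s $ k $ b) has_real_derivative
      (\<Sum>k\<in>UNIV. D $ a $ k * N t $ k $ b + E $ k $ b * M t $ a $ k)) (at t)"
    using assms by (intro DERIV_sum DERIV_mult) (auto simp: has_mderiv_def)
  then show "((\<lambda>s. (M s ** N s) $ a $ b) has_real_derivative (D ** N t + M t ** E) $ a $ b) (at t)"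
    by (simp add: matrix_mult_nth sum.distrib mult.commute)
qed

lemma has_mderiv_add: "has_mderiv M t D \<Longrightarrow> has_mderiv N t E \<Longrightarrow> has_mderiv (\<lambda>s. M s + N s) t (D + E)"
  unfolding has_mderiv_def by (auto intro!: DERIV_add)

lemma has_mderiv_diff: "has_mderiv M t D \<Longrightarrow> has_mderiv N t E \<Longrightarrow> has_mderiv (\<lambda>s. M s - N s) t (D - E)"
  unfolding has_mderiv_def by (auto intro!: DERIV_diff)

lemma has_mderiv_const: "has_mderiv (\<lambda>s. M) t 0"
  unfolding has_mderiv_def by auto

lemma has_mderiv_unique: "has_mderiv M t D \<Longrightarrow> has_mderiv M t E \<Longrightarrow> D = E"
  unfolding has_mderiv_def by (simp add: vec_eq_iff) (metis DERIV_unique)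

lemma has_mderiv_trace:
  assumes "has_mderiv M t D"
  shows "((\<lambda>s. trace (M s)) has_real_derivative trace D) (at t)"
  unfolding trace_def using assms by (intro DERIV_sum) (simp add: has_mderiv_def)

lemma has_mderiv_cong_open:
  assumes "has_mderiv M t D" "open T" "t \<in> T" "\<And>s. s \<in> T \<Longrightarrow> M s = N s"
  shows "has_mderiv N t D"
  unfolding has_mderiv_def
proof (intro allI)
  fix a b
  show "((\<lambda>s. N s $ a $ b) has_real_derivative D $ a $ b) (at t)"
    by (rule has_field_derivative_transform_within_open[OF has_mderivD[OF assms(1)] assms(2,3)]) (simp add: assms(4))
qed

lemma sum_rotate3: "(\<Sum>j\<in>UNIV. \<Sum>k\<in>UNIV. \<Sum>i\<in>UNIV. f i j k) = (\<Sum>i\<in>UNIV. \<Sum>j\<in>UNIV. \<Sum>k\<in>UNIV. f i j k)"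
  for f :: "'b::finite \<Rightarrow> 'c::finite \<Rightarrow> 'd::finite \<Rightarrow> real"
proof -
  have "(\<Sum>j\<in>UNIV. \<Sum>k\<in>UNIV. \<Sum>i\<in>UNIV. f i j k) = (\<Sum>j\<in>UNIV. \<Sum>i\<in>UNIV. \<Sum>k\<in>UNIV. f i j k)"
    by (rule sum.cong[OF refl]) (rule sum.swap)
  also have "\<dots> = (\<Sum>i\<in>UNIV. \<Sum>j\<in>UNIV. \<Sum>k\<in>UNIV. f i j k)" by (rule sum.swap)
  finally show ?thesis .
qed

lemma sum_pull_out3: "(\<Sum>j\<in>UNIV. \<Sum>k\<in>UNIV. h j k * (\<Sum>i\<in>UNIV. f i j k)) = (\<Sum>i\<in>UNIV. \<Sum>j\<in>UNIV. \<Sum>k\<in>UNIV. h j k * f i j k)"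
  for f :: "'b::finite \<Rightarrow> 'c::finite \<Rightarrow> 'd::finite \<Rightarrow> real"
  unfolding sum_distrib_left by (rule sum_rotate3)

definition laplacian :: "(real^'n \<Rightarrow> real^'n^'n) \<Rightarrow> (real^'n \<Rightarrow> real) \<Rightarrow> real^'n::finite \<Rightarrow> real"
  where "laplacian G f x = (\<Sum>j\<in>UNIV. \<Sum>k\<in>UNIV. matrix_inv (G x) $ j $ k *
    (pderiv_coord j (pderiv_coord k f) x - (\<Sum>m\<in>UNIV. Gam G j x $ m $ k * pderiv_coord m f x)))"

text \<open>A family of metrics on an open set \<open>V\<close>, smooth jointly in time and space. The set \<open>T\<close> of times may be a
  closed interval, where the results express regularity up to the end times.\<close>

locale metric_strip =
  fixes T :: "real set" and V :: "(real^'n) set" and g :: "real \<Rightarrow> real^'n \<Rightarrow> real^'n::finite^'n"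
  assumes open_V: "open V" and smooth_g: "msmooth (T \<times> V) (\<lambda>(t, x). g t x)"
    and posdef_g: "\<And>t x. t \<in> T \<Longrightarrow> x \<in> V \<Longrightarrow> posdef (g t x)"
begin

lemma at_time: "t \<in> T \<Longrightarrow> metric_chart V (g t)"
proof
  assume t: "t \<in> T"
  show "msmooth V (g t)"
    using ck_slice[OF msmooth_ck[OF smooth_g] t] by (simp add: msmooth_def)
qed (auto intro: open_V posdef_g)

lemma smooth_inv_strip: "ck k (T \<times> V) (\<lambda>(t, x). matrix_inv (g t x) $ a $ b)"
proof -
  have "ck k (T \<times> V) (\<lambda>z. matrix_inv ((\<lambda>(t, x). g t x) z) $ a $ b)"
    by (intro ck_matrix_inv msmooth_ck[OF smooth_g]) (auto dest: posdef_det[OF posdef_g])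
  then show ?thesis by (simp add: case_prod_beta')
qed

lemma ck_g: "ck k (T \<times> V) (\<lambda>(t, x). g t x $ a $ b)"
  using msmooth_ck[OF smooth_g, of k a b] by (simp add: case_prod_beta')

lemma smooth_Gam_strip: "ck k (T \<times> V) (\<lambda>(t, x). Gam (g t) i x $ a $ b)"
proof -
  have "ck k (T \<times> V) (\<lambda>z. pderiv_coord i (\<lambda>y. g (fst z) y $ p $ q) (snd z))" for i p q
    using ck_pderiv_spacetime[OF ck_g open_V, of k i p q] by (simp add: case_prod_beta')
  moreover have "ck k (T \<times> V) (\<lambda>z. matrix_inv (g (fst z) (snd z)) $ p $ q)" for p q
    using smooth_inv_strip[of k p q] by (simp add: case_prod_beta')
  ultimately show ?thesis
    unfolding Gam_nth case_prod_beta' christoffel_def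
    by (intro ck_divide ck_sum ck_mult ck_add ck_diff ck_const) auto
qed

lemma smooth_ricci_strip: "ck k (T \<times> V) (\<lambda>(t, x). ricci_matrix (g t) x $ a $ b)"
proof -
  have 1: "ck k (T \<times> V) (\<lambda>z. pderiv_coord i (\<lambda>y. Gam (g (fst z)) j y $ p $ q) (snd z))" for i j p q
    using ck_pderiv_spacetime[OF smooth_Gam_strip open_V, of k i j p q] by (simp add: case_prod_beta')
  moreover have "ck k (T \<times> V) (\<lambda>z. Gam (g (fst z)) j (snd z) $ p $ q)" for j p q
    using smooth_Gam_strip[of k j p q] by (simp add: case_prod_beta')
  ultimately show ?thesis
    unfolding ricci_matrix_nth case_prod_beta' curv_def vector_add_component vector_minus_component
      mderiv_nth matrix_mult_nth
    by (intro ck_sum ck_mult ck_add ck_diff) auto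
qed

lemma ck_scal_strip: "ck k (T \<times> V) (\<lambda>(t, x). scal (g t) x)"
proof -
  have "ck k (T \<times> V) (\<lambda>z. ricci_matrix (g (fst z)) (snd z) $ p $ q)" for p q
    using smooth_ricci_strip[of k p q] by (simp add: case_prod_beta')
  moreover have "ck k (T \<times> V) (\<lambda>z. matrix_inv (g (fst z) (snd z)) $ p $ q)" for p q
    using smooth_inv_strip[of k p q] by (simp add: case_prod_beta')
  ultimately show ?thesis
    unfolding scal_def case_prod_beta' trace_def matrix_mult_nth
    by (intro ck_sum ck_mult) auto
qed

end

text \<open>The Ricci flow in a chart, over an open set of times, where time derivatives are two-sided and
  commute with spatial ones.\<close>

locale flow_chart = metric_strip T V g
  for T :: "real set" and V :: "(real^'n) set" and g :: "real \<Rightarrow> real^'n \<Rightarrow> real^'n::finite^'n" +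
  assumes open_T: "open T"
    and flow: "\<And>t x. t \<in> T \<Longrightarrow> x \<in> V \<Longrightarrow> has_mderiv (\<lambda>s. g s x) t ((-2) *\<^sub>R ricci_matrix (g t) x)"
begin

text \<open>The Ricci tensor is \<open>-1/2\<close> times the time derivative of a symmetric matrix.\<close>

lemma ricci_sym:
  assumes t: "t \<in> T" and x: "x \<in> V"
  shows "transpose (ricci_matrix (g t) x) = ricci_matrix (g t) x"
proof -
  have "has_mderiv (\<lambda>s. transpose (g s x)) t (transpose ((-2) *\<^sub>R ricci_matrix (g t) x))"
    using flow[OF t x] by (simp add: has_mderiv_def transpose_nth)
  then have "has_mderiv (\<lambda>s. g s x) t (transpose ((-2) *\<^sub>R ricci_matrix (g t) x))"
    by (rule has_mderiv_cong_open[OF _ open_T t]) (use posdef_g x in \<open>auto simp: posdef_def\<close>)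
  from has_mderiv_unique[OF this flow[OF t x]] show ?thesis
    by (simp add: transpose_scalar transpose_minus)
qed

lemma differentiable_time:
  assumes "ck 1 (T \<times> V) (\<lambda>(t, x). f t x)" "t \<in> T" "x \<in> V"
  shows "\<exists>D. ((\<lambda>s. f s x) has_real_derivative D) (at t)"
proof -
  have "(\<lambda>(t, x). f t x) differentiable (at (t, x))"
    using assms ck_differentiable[of 0 "T \<times> V" "\<lambda>(t, x). f t x" "(t, x)"] open_T open_V
    by (simp add: open_Times)
  from time_derivative_eq[OF this] show ?thesis by auto
qed

lemma inverse_evolution:
  assumes t: "t \<in> T" and x: "x \<in> V"
  shows "has_mderiv (\<lambda>s. matrix_inv (g s x)) t
    (2 *\<^sub>R (matrix_inv (g t x) ** ricci_matrix (g t) x ** matrix_inv (g t x)))"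
proof -
  interpret m: metric_chart V "g t" using at_time t .
  have "\<exists>D. ((\<lambda>s. matrix_inv (g s x) $ a $ b) has_real_derivative D) (at t)" for a b
    by (rule differentiable_time[OF smooth_inv_strip t x])
  then obtain D where "\<And>a b. ((\<lambda>s. matrix_inv (g s x) $ a $ b) has_real_derivative D a b) (at t)"
    by metis
  then have D: "has_mderiv (\<lambda>s. matrix_inv (g s x)) t (\<chi> a b. D a b)" (is "has_mderiv _ t ?D")
    by (simp add: has_mderiv_def)
  have "has_mderiv (\<lambda>s. mat 1 :: real^'n^'n) t
      (((-2) *\<^sub>R ricci_matrix (g t) x) ** matrix_inv (g t x) + g t x ** ?D)"
    by (rule has_mderiv_cong_open[OF has_mderiv_mult[OF flow[OF t x] D] open_T t])
      (use posdef_g x in \<open>simp add: matrix_inv_inverse posdef_det\<close>)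
  from has_mderiv_unique[OF this has_mderiv_const]
  have "g t x ** ?D = 2 *\<^sub>R (ricci_matrix (g t) x ** matrix_inv (g t x))"
    by (simp add: matrix_scaleR_left matrix_minus_left)
  then have "matrix_inv (g t x) ** (g t x ** ?D) =
      matrix_inv (g t x) ** (2 *\<^sub>R (ricci_matrix (g t) x ** matrix_inv (g t x)))" by simp
  then have "?D = 2 *\<^sub>R (matrix_inv (g t x) ** ricci_matrix (g t) x ** matrix_inv (g t x))"
    by (simp add: matrix_mul_assoc m.HG[OF x] matrix_scaleR_right)
  then show ?thesis using D by simp
qed

text \<open>The variation of the Christoffel symbols,
  \<open>1/2 g\<^sup>k\<^sup>l (\<nabla>\<^sub>i h\<^sub>j\<^sub>l + \<nabla>\<^sub>j h\<^sub>i\<^sub>l - \<nabla>\<^sub>l h\<^sub>i\<^sub>j)\<close> in row \<open>k\<close> and column \<open>j\<close>, for \<open>h = - 2 Ric\<close>.\<close>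

definition Gam_dot :: "real \<Rightarrow> 'n \<Rightarrow> real^'n \<Rightarrow> real^'n^'n"
  where "Gam_dot t i x = matrix_inv (g t x) ** (\<chi> l j. cov_ricci (g t) l x $ i $ j
    - cov_ricci (g t) i x $ l $ j - cov_ricci (g t) j x $ i $ l)"

text \<open>Differentiate \<open>\<Gamma>\<^sub>i = H (G \<Gamma>\<^sub>i)\<close>, where \<open>G \<Gamma>\<^sub>i\<close> is given by the Koszul formula. The derivative of \<open>H\<close>
  supplies exactly the terms that turn the partial derivatives of \<open>Ric\<close> into covariant ones.\<close>

lemma Gam_evolution:
  assumes t: "t \<in> T" and x: "x \<in> V"
  shows "has_mderiv (\<lambda>s. Gam (g s) i x) t (Gam_dot t i x)"
proof -
  interpret m: metric_chart V "g t" using at_time t .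
  let ?H = "matrix_inv (g t x)" and ?S = "ricci_matrix (g t)" and ?\<Gamma> = "Gam (g t)"
  let ?d = "\<lambda>i j l. pderiv_coord i (\<lambda>y. ?S y $ j $ l) x"
  have dp: "((\<lambda>s. pderiv_coord i (\<lambda>y. g s y $ j $ l) x) has_real_derivative (- 2) * ?d i j l) (at t)" for i j l
  proof -
    have "((\<lambda>s. pderiv_coord i (\<lambda>y. (\<lambda>(t, x). g t x $ j $ l) (s, y)) x) has_real_derivative
        pderiv_coord i (\<lambda>y. ((-2) *\<^sub>R ?S y) $ j $ l) x) (at t)"
      by (rule time_pderiv_commute[OF ck_g open_T open_V t x, where f' = "\<lambda>s y. ((-2) *\<^sub>R ricci_matrix (g s) y) $ j $ l"])
        (use has_mderivD[OF flow] in auto)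
    also have "pderiv_coord i (\<lambda>y. ((-2) *\<^sub>R ?S y) $ j $ l) x = (- 2) * ?d i j l"
      using pderiv_cmult[OF mdiffD[OF msmooth_mdiff[OF m.smooth_ricci open_V x]], of i "-2" j l] by simp
    finally show ?thesis by simp
  qed
  define K where "K = (\<chi> l j. ?d l i j - ?d i j l - ?d j i l)"
  have "has_mderiv (\<lambda>s. \<chi> l j. (pderiv_coord i (\<lambda>y. g s y $ j $ l) x
      + pderiv_coord j (\<lambda>y. g s y $ i $ l) x - pderiv_coord l (\<lambda>y. g s y $ i $ j) x) / 2) t K"
    unfolding has_mderiv_def
  proof (intro allI)
    fix l j
    have "((\<lambda>s. (pderiv_coord i (\<lambda>y. g s y $ j $ l) x
      + pderiv_coord j (\<lambda>y. g s y $ i $ l) x - pderiv_coord l (\<lambda>y. g s y $ i $ j) x) / 2)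
      has_real_derivative ((- 2) * ?d i j l + (- 2) * ?d j i l - (- 2) * ?d l i j) / 2) (at t)"
      by (intro DERIV_cdivide DERIV_add DERIV_diff dp)
    moreover have "((- 2) * ?d i j l + (- 2) * ?d j i l - (- 2) * ?d l i j) / 2 = K $ l $ j"
      by (simp add: K_def field_simps)
    ultimately show "((\<lambda>s. (\<chi> l j. (pderiv_coord i (\<lambda>y. g s y $ j $ l) x
      + pderiv_coord j (\<lambda>y. g s y $ i $ l) x - pderiv_coord l (\<lambda>y. g s y $ i $ j) x) / 2) $ l $ j)
      has_real_derivative K $ l $ j) (at t)"
      by simp
  qed
  then have K: "has_mderiv (\<lambda>s. g s x ** Gam (g s) i x) t K"
  proof (rule has_mderiv_cong_open[OF _ open_T t])
    fix s assume "s \<in> T"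
    then interpret ms: metric_chart V "g s" using at_time by blast
    show "(\<chi> l j. (pderiv_coord i (\<lambda>y. g s y $ j $ l) x + pderiv_coord j (\<lambda>y. g s y $ i $ l) x
      - pderiv_coord l (\<lambda>y. g s y $ i $ j) x) / 2) = g s x ** Gam (g s) i x"
      by (simp add: vec_eq_iff ms.koszul[OF x])
  qed
  have "has_mderiv (\<lambda>s. Gam (g s) i x) t
      ((2 *\<^sub>R (?H ** ?S x ** ?H)) ** (g t x ** ?\<Gamma> i x) + ?H ** K)"
  proof (rule has_mderiv_cong_open[OF has_mderiv_mult[OF inverse_evolution[OF t x] K] open_T t])
    fix s assume "s \<in> T"
    then interpret ms: metric_chart V "g s" using at_time by blast
    show "matrix_inv (g s x) ** (g s x ** Gam (g s) i x) = Gam (g s) i x"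
      by (simp add: matrix_mul_assoc ms.HG[OF x])
  qed
  moreover have "(2 *\<^sub>R (?H ** ?S x ** ?H)) ** (g t x ** ?\<Gamma> i x) + ?H ** K = Gam_dot t i x"
  proof -
    have "(2 *\<^sub>R (?H ** ?S x ** ?H)) ** (g t x ** ?\<Gamma> i x) = 2 *\<^sub>R (?H ** ?S x ** (?H ** g t x) ** ?\<Gamma> i x)"
      by (simp add: matrix_mul_assoc matrix_scaleR_left)
    also have "\<dots> = ?H ** (2 *\<^sub>R (?S x ** ?\<Gamma> i x))"
      by (simp add: m.HG[OF x] matrix_mul_assoc matrix_scaleR_right)
    finally have "(2 *\<^sub>R (?H ** ?S x ** ?H)) ** (g t x ** ?\<Gamma> i x) + ?H ** K =
        ?H ** (2 *\<^sub>R (?S x ** ?\<Gamma> i x) + K)"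
      by (simp add: matrix_add_ldistrib)
    moreover have "(2 *\<^sub>R (?S x ** ?\<Gamma> i x) + K) $ l $ j = cov_ricci (g t) l x $ i $ j
        - cov_ricci (g t) i x $ l $ j - cov_ricci (g t) j x $ i $ l" for l j
    proof -
      let ?P = "\<lambda>i. ?S x ** ?\<Gamma> i x"
      have S: "?S y $ a $ b = ?S y $ b $ a" if "y \<in> V" for a b y
        using ricci_sym[OF t that] by (metis transpose_nth)
      have d: "?d a b c = ?d a c b" for a b c
        by (rule pderiv_cong_open[OF open_V x]) (rule S)
      have P: "?P a $ b $ c = ?P c $ b $ a" for a b c
        unfolding matrix_mult_nth using m.Gam_sym[OF x] by simp
      have "transpose (?\<Gamma> a x) ** ?S x = transpose (?P a)" for a
        by (simp add: matrix_transpose_mul ricci_sym t x)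
      then have cr: "cov_ricci (g t) a x $ b $ c = ?d a b c - ?P a $ b $ c - ?P a $ c $ b" for a b c
        unfolding cov_ricci_def by (simp add: mderiv_nth transpose_nth)
      show ?thesis
        unfolding cr K_def using P[of j l i] P[of j i l] P[of l j i] d[of i j l] by simp
    qed
    ultimately show ?thesis
      unfolding Gam_dot_def by (metis (mono_tags, lifting) vec_lambda_unique)
  qed
  ultimately show ?thesis by simp
qed

context
  fixes t assumes t: "t \<in> T"
begin

interpretation m: metric_chart V "g t" using at_time t .

abbreviation "HH x \<equiv> matrix_inv (g t x)"
abbreviation "R \<equiv> scal (g t)"
abbreviation "C \<equiv> Gam_dot t"
abbreviation "\<Gamma>\<Gamma> \<equiv> Gam (g t)"

lemma cov_ricci_sym: "x \<in> V \<Longrightarrow> cov_ricci (g t) i x $ j $ k = cov_ricci (g t) i x $ k $ j"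
proof -
  assume x: "x \<in> V"
  let ?S = "ricci_matrix (g t)"
  have "transpose (mderiv i ?S x) = mderiv i (\<lambda>y. transpose (?S y)) x"
    by (simp add: mderiv_transpose)
  also have "\<dots> = mderiv i ?S x"
    by (rule mderiv_cong_open[OF open_V x]) (rule ricci_sym[OF t])
  finally have "transpose (cov_ricci (g t) i x) = cov_ricci (g t) i x"
    unfolding cov_ricci_def by (simp add: transpose_diff matrix_transpose_mul ricci_sym t x)
  then show ?thesis by (metis transpose_nth)
qed

lemma Gam_dot_sym: "x \<in> V \<Longrightarrow> C i x $ k $ j = C j x $ k $ i"
  unfolding Gam_dot_def matrix_mult_nth
  by (intro sum.cong refl) (simp add: cov_ricci_sym[of x] algebra_simps)

lemma msmooth_cov_ricci: "msmooth V (cov_ricci (g t) i)"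
  unfolding cov_ricci_def[abs_def]
  by (intro msmooth_diff msmooth_mult msmooth_transpose msmooth_deriv m.smooth_Gam m.smooth_ricci open_V)

lemma msmooth_Gam_dot: "msmooth V (C i)"
  unfolding Gam_dot_def[abs_def]
proof (intro msmooth_mult m.smooth_H msmoothI)
  fix k l j
  show "ck k V (\<lambda>x. (\<chi> l j. cov_ricci (g t) l x $ i $ j
    - cov_ricci (g t) i x $ l $ j - cov_ricci (g t) j x $ i $ l) $ l $ j)"
    by (simp, intro ck_diff msmooth_ck[OF msmooth_cov_ricci])
qed

lemma Gam_dot_trace:
  assumes x: "x \<in> V"
  shows "(\<Sum>i\<in>UNIV. C i x $ i $ k) = - pderiv_coord k R x"
proof -
  let ?N = "cov_ricci (g t)"
  have "(\<Sum>i\<in>UNIV. C i x $ i $ k) = (\<Sum>i\<in>UNIV. C k x $ i $ i)"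
    using Gam_dot_sym[OF x] by simp
  also have "\<dots> = (\<Sum>i\<in>UNIV. \<Sum>l\<in>UNIV. HH x $ i $ l * ?N l x $ k $ i)
      - (\<Sum>i\<in>UNIV. \<Sum>l\<in>UNIV. HH x $ i $ l * ?N k x $ l $ i)
      - (\<Sum>i\<in>UNIV. \<Sum>l\<in>UNIV. HH x $ i $ l * ?N i x $ k $ l)"
    unfolding Gam_dot_def matrix_mult_nth by (simp add: algebra_simps sum_subtractf sum.distrib)
  also have "(\<Sum>i\<in>UNIV. \<Sum>l\<in>UNIV. HH x $ i $ l * ?N i x $ k $ l) =
      (\<Sum>i\<in>UNIV. \<Sum>l\<in>UNIV. HH x $ l $ i * ?N i x $ k $ l)"
    by (intro sum.cong refl) (simp add: m.H_sym_nth[OF x])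
  also have "\<dots> = (\<Sum>i\<in>UNIV. \<Sum>l\<in>UNIV. HH x $ i $ l * ?N l x $ k $ i)"
    by (rule sum.swap)
  also have "(\<Sum>i\<in>UNIV. \<Sum>l\<in>UNIV. HH x $ i $ l * ?N k x $ l $ i) = pderiv_coord k R x"
    unfolding m.scal_deriv[OF x] trace_def matrix_mult_nth ..
  finally show ?thesis by simp
qed

text \<open>This is where the contracted Bianchi identity enters. It makes the vector field
  \<open>g\<^sup>j\<^sup>k \<partial>\<^sub>t \<Gamma>\<^sup>i\<^sub>j\<^sub>k\<close> vanish, so that its divergence drops out of the evolution of the scalar curvature.\<close>

lemma Gam_dot_contract:
  assumes x: "x \<in> V"
  shows "(\<Sum>j\<in>UNIV. \<Sum>k\<in>UNIV. HH x $ j $ k * C j x $ i $ k) = 0"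
proof -
  let ?N = "cov_ricci (g t)"
  have W: "(\<Sum>j\<in>UNIV. \<Sum>k\<in>UNIV. HH x $ j $ k * (?N l x $ j $ k - ?N j x $ l $ k - ?N k x $ j $ l)) = 0" for l
  proof -
    have a: "(\<Sum>j\<in>UNIV. \<Sum>k\<in>UNIV. HH x $ j $ k * ?N l x $ j $ k) = pderiv_coord l R x"
      unfolding m.scal_deriv[OF x] trace_def matrix_mult_nth
      by (intro sum.cong refl) (simp add: cov_ricci_sym[OF x])
    have c: "2 * (\<Sum>j\<in>UNIV. \<Sum>k\<in>UNIV. HH x $ j $ k * ?N k x $ j $ l) = pderiv_coord l R x"
      unfolding m.contracted_bianchi[OF x, symmetric] using cov_ricci_sym[OF x] by simp
    have "(\<Sum>j\<in>UNIV. \<Sum>k\<in>UNIV. HH x $ j $ k * ?N j x $ l $ k) =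
        (\<Sum>k\<in>UNIV. \<Sum>j\<in>UNIV. HH x $ j $ k * ?N j x $ l $ k)" by (rule sum.swap)
    also have "\<dots> = (\<Sum>j\<in>UNIV. \<Sum>k\<in>UNIV. HH x $ j $ k * ?N k x $ j $ l)"
      using cov_ricci_sym[OF x] m.H_sym_nth[OF x] by (intro sum.cong refl) metis
    finally show ?thesis using a c by (simp add: algebra_simps sum_subtractf sum.distrib)
  qed
  have "(\<Sum>j\<in>UNIV. \<Sum>k\<in>UNIV. HH x $ j $ k * C j x $ i $ k) =
      (\<Sum>j\<in>UNIV. \<Sum>k\<in>UNIV. \<Sum>l\<in>UNIV. HH x $ i $ l * (HH x $ j $ k * (?N l x $ j $ k - ?N j x $ l $ k - ?N k x $ j $ l)))"
    unfolding Gam_dot_def matrix_mult_nth by (simp add: sum_distrib_left mult.left_commute)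
  also have "\<dots> = (\<Sum>j\<in>UNIV. \<Sum>l\<in>UNIV. \<Sum>k\<in>UNIV. HH x $ i $ l * (HH x $ j $ k * (?N l x $ j $ k - ?N j x $ l $ k - ?N k x $ j $ l)))"
    by (rule sum.cong[OF refl]) (rule sum.swap)
  also have "\<dots> = (\<Sum>l\<in>UNIV. \<Sum>j\<in>UNIV. \<Sum>k\<in>UNIV. HH x $ i $ l * (HH x $ j $ k * (?N l x $ j $ k - ?N j x $ l $ k - ?N k x $ j $ l)))"
    by (rule sum.swap)
  also have "\<dots> = (\<Sum>l\<in>UNIV. HH x $ i $ l * (\<Sum>j\<in>UNIV. \<Sum>k\<in>UNIV. HH x $ j $ k * (?N l x $ j $ k - ?N j x $ l $ k - ?N k x $ j $ l)))"
    by (simp add: sum_distrib_left)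
  finally show ?thesis unfolding W by simp
qed

definition ricci_dot :: "real^'n \<Rightarrow> real^'n^'n"
  where "ricci_dot x = (\<chi> j k. \<Sum>i\<in>UNIV. (mderiv i (C j) x - mderiv j (C i) x
    + (C i x ** \<Gamma>\<Gamma> j x + \<Gamma>\<Gamma> i x ** C j x) - (C j x ** \<Gamma>\<Gamma> i x + \<Gamma>\<Gamma> j x ** C i x)) $ i $ k)"

lemma ricci_evolution:
  assumes x: "x \<in> V"
  shows "has_mderiv (\<lambda>s. ricci_matrix (g s) x) t (ricci_dot x)"
proof -
  have dG: "has_mderiv (\<lambda>s. mderiv i (Gam (g s) j) x) t (mderiv i (C j) x)" for i j
    unfolding has_mderiv_def mderiv_nth
  proof (intro allI)
    fix a b
    have "((\<lambda>s. pderiv_coord i (\<lambda>y. (\<lambda>(t, x). Gam (g t) j x $ a $ b) (s, y)) x) has_real_derivative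
        pderiv_coord i (\<lambda>y. C j y $ a $ b) x) (at t)"
      by (rule time_pderiv_commute[OF smooth_Gam_strip open_T open_V t x, where f' = "\<lambda>s y. Gam_dot s j y $ a $ b"])
        (use has_mderivD[OF Gam_evolution] in auto)
    then show "((\<lambda>s. pderiv_coord i (\<lambda>y. Gam (g s) j y $ a $ b) x) has_real_derivative
        pderiv_coord i (\<lambda>y. C j y $ a $ b) x) (at t)" by simp
  qed
  have F: "has_mderiv (\<lambda>s. curv (g s) i j x) t (mderiv i (C j) x - mderiv j (C i) x
    + (C i x ** \<Gamma>\<Gamma> j x + \<Gamma>\<Gamma> i x ** C j x) - (C j x ** \<Gamma>\<Gamma> i x + \<Gamma>\<Gamma> j x ** C i x))" for i j
    unfolding curv_def by (intro has_mderiv_add has_mderiv_diff has_mderiv_mult dG Gam_evolution t x)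
  show ?thesis
    unfolding has_mderiv_def
  proof (intro allI)
    fix j k
    have "((\<lambda>s. \<Sum>i\<in>UNIV. curv (g s) i j x $ i $ k) has_real_derivative
      (\<Sum>i\<in>UNIV. (mderiv i (C j) x - mderiv j (C i) x
    + (C i x ** \<Gamma>\<Gamma> j x + \<Gamma>\<Gamma> i x ** C j x) - (C j x ** \<Gamma>\<Gamma> i x + \<Gamma>\<Gamma> j x ** C i x)) $ i $ k)) (at t)"
      by (intro DERIV_sum has_mderivD F)
    then show "((\<lambda>s. ricci_matrix (g s) x $ j $ k) has_real_derivative ricci_dot x $ j $ k) (at t)"
      by (simp add: ricci_matrix_nth ricci_dot_def)
  qed
qed

text \<open>The divergence of the vanishing vector field of \<open>Gam_dot_contract\<close>, written out with the derivative of
  the inverse metric.\<close>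

lemma contract_deriv_Gam_dot:
  assumes x: "x \<in> V"
  defines "X \<equiv> \<Sum>i\<in>UNIV. \<Sum>j\<in>UNIV. (C j x ** (\<Gamma>\<Gamma> i x ** HH x)) $ i $ j"
  shows "(\<Sum>i\<in>UNIV. \<Sum>j\<in>UNIV. \<Sum>k\<in>UNIV. HH x $ j $ k * mderiv i (C j) x $ i $ k) = 2 * X"
proof -
  note d = msmooth_mdiff[OF _ open_V x, THEN mdiffD]
  let ?B = "\<lambda>i. \<Gamma>\<Gamma> i x ** HH x"
  have dH: "pderiv_coord i (\<lambda>y. HH y $ j $ k) x = - ?B i $ j $ k - ?B i $ k $ j" for i j k
  proof -
    have "HH x ** transpose (\<Gamma>\<Gamma> i x) = transpose (?B i)"
      by (simp add: matrix_transpose_mul m.H_sym[OF x])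
    then have "mderiv i (\<lambda>y. HH y) x = - ?B i - transpose (?B i)"
      using m.inverse_compat[OF x, of i] by simp
    then show ?thesis by (simp add: mderiv_nth[symmetric] transpose_nth)
  qed
  have "0 = (\<Sum>i\<in>UNIV. pderiv_coord i (\<lambda>y. \<Sum>j\<in>UNIV. \<Sum>k\<in>UNIV. HH y $ j $ k * C j y $ i $ k) x)"
  proof (rule sym, intro sum.neutral ballI)
    fix i
    have "pderiv_coord i (\<lambda>y. \<Sum>j\<in>UNIV. \<Sum>k\<in>UNIV. HH y $ j $ k * C j y $ i $ k) x = pderiv_coord i (\<lambda>y. 0) x"
      by (rule pderiv_cong_open[OF open_V x]) (rule Gam_dot_contract)
    then show "pderiv_coord i (\<lambda>y. \<Sum>j\<in>UNIV. \<Sum>k\<in>UNIV. HH y $ j $ k * C j y $ i $ k) x = 0" by simp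
  qed
  also have "\<dots> = (\<Sum>i\<in>UNIV. \<Sum>j\<in>UNIV. \<Sum>k\<in>UNIV. HH x $ j $ k * mderiv i (C j) x $ i $ k
      + pderiv_coord i (\<lambda>y. HH y $ j $ k) x * C j x $ i $ k)"
    by (simp add: pderiv_sum pderiv_mult mderiv_nth d m.smooth_H msmooth_Gam_dot)
  also have "\<dots> = (\<Sum>i\<in>UNIV. \<Sum>j\<in>UNIV. \<Sum>k\<in>UNIV. HH x $ j $ k * mderiv i (C j) x $ i $ k)
      - (\<Sum>i\<in>UNIV. \<Sum>j\<in>UNIV. \<Sum>k\<in>UNIV. ?B i $ j $ k * C j x $ i $ k)
      - (\<Sum>i\<in>UNIV. \<Sum>j\<in>UNIV. \<Sum>k\<in>UNIV. ?B i $ k $ j * C j x $ i $ k)"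
    unfolding dH by (simp add: algebra_simps sum.distrib sum_subtractf sum_negf)
  also have "(\<Sum>i\<in>UNIV. \<Sum>j\<in>UNIV. \<Sum>k\<in>UNIV. ?B i $ k $ j * C j x $ i $ k) = X"
    unfolding X_def matrix_mult_nth[of "C _ x"] by (simp add: mult.commute)
  also have "(\<Sum>i\<in>UNIV. \<Sum>j\<in>UNIV. \<Sum>k\<in>UNIV. ?B i $ j $ k * C j x $ i $ k) =
      (\<Sum>i\<in>UNIV. \<Sum>j\<in>UNIV. \<Sum>k\<in>UNIV. ?B i $ j $ k * C k x $ i $ j)"
    using Gam_dot_sym[OF x] by simp
  also have "\<dots> = (\<Sum>i\<in>UNIV. \<Sum>j\<in>UNIV. \<Sum>k\<in>UNIV. ?B i $ k $ j * C j x $ i $ k)"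
    by (rule sum.cong[OF refl]) (rule sum.swap)
  also have "\<dots> = X"
    unfolding X_def matrix_mult_nth[of "C _ x"] by (simp add: mult.commute)
  finally show ?thesis by simp
qed

text \<open>The six terms of \<open>g\<^sup>j\<^sup>k \<partial>\<^sub>t R\<^sub>j\<^sub>k\<close>: the second and third form the Laplacian, because \<open>\<partial>\<^sub>t \<Gamma>\<^sup>i\<^sub>i\<^sub>k = - \<partial>\<^sub>k R\<close>;
  the fourth contains the vanishing vector field; the first equals \<open>2 X\<close> and cancels against the fifth
  and sixth, each of which is \<open>X\<close>.\<close>

lemma trace_ricci_dot:
  assumes x: "x \<in> V"
  shows "trace (HH x ** ricci_dot x) = laplacian (g t) R x"
proof -
  define X where "X = (\<Sum>i\<in>UNIV. \<Sum>j\<in>UNIV. (C j x ** (\<Gamma>\<Gamma> i x ** HH x)) $ i $ j)"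
  note Hs = m.H_sym_nth[OF x] and Cs = Gam_dot_sym[OF x] and Gs = m.Gam_sym[OF x]
  let ?s = "\<lambda>f. \<Sum>j\<in>UNIV. \<Sum>k\<in>UNIV. HH x $ j $ k * (f j k :: real)"
  have "trace (HH x ** ricci_dot x) = (\<Sum>k\<in>UNIV. \<Sum>j\<in>UNIV. HH x $ k $ j * ricci_dot x $ j $ k)"
    unfolding trace_def matrix_mult_nth ..
  also have "\<dots> = ?s (\<lambda>j k. ricci_dot x $ j $ k)"
    by (subst sum.swap) (simp add: Hs)
  also have "\<dots> = ?s (\<lambda>j k. \<Sum>i\<in>UNIV. mderiv i (C j) x $ i $ k) - ?s (\<lambda>j k. \<Sum>i\<in>UNIV. mderiv j (C i) x $ i $ k)
     + ?s (\<lambda>j k. \<Sum>i\<in>UNIV. (C i x ** \<Gamma>\<Gamma> j x) $ i $ k) + ?s (\<lambda>j k. \<Sum>i\<in>UNIV. (\<Gamma>\<Gamma> i x ** C j x) $ i $ k)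
     - ?s (\<lambda>j k. \<Sum>i\<in>UNIV. (C j x ** \<Gamma>\<Gamma> i x) $ i $ k) - ?s (\<lambda>j k. \<Sum>i\<in>UNIV. (\<Gamma>\<Gamma> j x ** C i x) $ i $ k)"
    unfolding ricci_dot_def by (simp add: algebra_simps sum.distrib sum_subtractf)
  also have "?s (\<lambda>j k. \<Sum>i\<in>UNIV. mderiv i (C j) x $ i $ k) = 2 * X"
    unfolding sum_pull_out3 X_def by (rule contract_deriv_Gam_dot[OF x])
  also have "?s (\<lambda>j k. \<Sum>i\<in>UNIV. mderiv j (C i) x $ i $ k) = - ?s (\<lambda>j k. pderiv_coord j (pderiv_coord k R) x)"
  proof -
    have "(\<Sum>i\<in>UNIV. mderiv j (C i) x $ i $ k) = - pderiv_coord j (pderiv_coord k R) x" for j k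
    proof -
      have "(\<Sum>i\<in>UNIV. mderiv j (C i) x $ i $ k) = pderiv_coord j (\<lambda>y. \<Sum>i\<in>UNIV. C i y $ i $ k) x"
        unfolding mderiv_nth
        by (rule pderiv_sum[symmetric]) (rule msmooth_mdiff[OF msmooth_Gam_dot open_V x, THEN mdiffD])
      also have "\<dots> = pderiv_coord j (\<lambda>y. - pderiv_coord k R y) x"
        by (rule pderiv_cong_open[OF open_V x]) (rule Gam_dot_trace)
      also have "\<dots> = - pderiv_coord j (pderiv_coord k R) x"
        by (rule pderiv_minus) (rule ck_differentiable[OF ck_pderiv[OF m.ck_scal open_V] open_V x])
      finally show ?thesis .
    qed
    then show ?thesis by (simp add: sum_negf)
  qed
  also have "?s (\<lambda>j k. \<Sum>i\<in>UNIV. (C i x ** \<Gamma>\<Gamma> j x) $ i $ k) =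
      - ?s (\<lambda>j k. \<Sum>m\<in>UNIV. \<Gamma>\<Gamma> j x $ m $ k * pderiv_coord m R x)"
  proof -
    have "(\<Sum>i\<in>UNIV. (C i x ** \<Gamma>\<Gamma> j x) $ i $ k) = - (\<Sum>m\<in>UNIV. \<Gamma>\<Gamma> j x $ m $ k * pderiv_coord m R x)" for j k
    proof -
      have "(\<Sum>i\<in>UNIV. (C i x ** \<Gamma>\<Gamma> j x) $ i $ k) = (\<Sum>m\<in>UNIV. (\<Sum>i\<in>UNIV. C i x $ i $ m) * \<Gamma>\<Gamma> j x $ m $ k)"
        unfolding matrix_mult_nth sum_distrib_right by (rule sum.swap)
      then show ?thesis unfolding Gam_dot_trace[OF x] by (simp add: sum_negf mult.commute)
    qed
    then show ?thesis by (simp add: sum_negf)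
  qed
  also have "?s (\<lambda>j k. \<Sum>i\<in>UNIV. (\<Gamma>\<Gamma> i x ** C j x) $ i $ k) = 0"
  proof -
    have "?s (\<lambda>j k. \<Sum>i\<in>UNIV. (\<Gamma>\<Gamma> i x ** C j x) $ i $ k) =
        (\<Sum>i\<in>UNIV. \<Sum>m\<in>UNIV. \<Sum>j\<in>UNIV. \<Sum>k\<in>UNIV. HH x $ j $ k * (\<Gamma>\<Gamma> i x $ i $ m * C j x $ m $ k))"
      unfolding sum_pull_out3 matrix_mult_nth ..
    also have "\<dots> = (\<Sum>i\<in>UNIV. \<Sum>m\<in>UNIV. \<Gamma>\<Gamma> i x $ i $ m * (\<Sum>j\<in>UNIV. \<Sum>k\<in>UNIV. HH x $ j $ k * C j x $ m $ k))"
      by (simp add: sum_distrib_left mult.left_commute)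
    finally show ?thesis unfolding Gam_dot_contract[OF x] by simp
  qed
  also have "?s (\<lambda>j k. \<Sum>i\<in>UNIV. (C j x ** \<Gamma>\<Gamma> i x) $ i $ k) = X"
  proof -
    have "?s (\<lambda>j k. \<Sum>i\<in>UNIV. (C j x ** \<Gamma>\<Gamma> i x) $ i $ k) =
        (\<Sum>i\<in>UNIV. \<Sum>j\<in>UNIV. \<Sum>k\<in>UNIV. (C j x ** \<Gamma>\<Gamma> i x) $ i $ k * HH x $ k $ j)"
      unfolding sum_pull_out3 using Hs by (simp add: mult.commute)
    also have "\<dots> = X"
      unfolding X_def matrix_mul_assoc matrix_mult_nth[of _ "HH x"] ..
    finally show ?thesis .
  qed
  also have "?s (\<lambda>j k. \<Sum>i\<in>UNIV. (\<Gamma>\<Gamma> j x ** C i x) $ i $ k) = X"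
  proof -
    have "?s (\<lambda>j k. \<Sum>i\<in>UNIV. (\<Gamma>\<Gamma> j x ** C i x) $ i $ k) =
        (\<Sum>i\<in>UNIV. \<Sum>j\<in>UNIV. \<Sum>k\<in>UNIV. (\<Gamma>\<Gamma> j x ** C i x) $ i $ k * HH x $ k $ j)"
      unfolding sum_pull_out3 using Hs by (simp add: mult.commute)
    also have "\<dots> = (\<Sum>i\<in>UNIV. \<Sum>j\<in>UNIV. (\<Gamma>\<Gamma> j x ** (C i x ** HH x)) $ i $ j)"
      unfolding matrix_mul_assoc matrix_mult_nth[of _ "HH x"] ..
    also have "\<dots> = (\<Sum>i\<in>UNIV. \<Sum>j\<in>UNIV. \<Sum>m\<in>UNIV. \<Gamma>\<Gamma> m x $ i $ j * (C i x ** HH x) $ m $ j)"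
      unfolding matrix_mult_nth[of "\<Gamma>\<Gamma> _ x"] using Gs by simp
    also have "\<dots> = (\<Sum>m\<in>UNIV. \<Sum>i\<in>UNIV. \<Sum>j\<in>UNIV. \<Gamma>\<Gamma> m x $ i $ j * (C i x ** HH x) $ m $ j)"
      by (rule sum_rotate3)
    also have "\<dots> = (\<Sum>m\<in>UNIV. \<Sum>i\<in>UNIV. \<Sum>j\<in>UNIV. \<Sum>k\<in>UNIV. C k x $ m $ i * (\<Gamma>\<Gamma> m x $ i $ j * HH x $ j $ k))"
      unfolding matrix_mult_nth[of "C _ x"] sum_distrib_left using Hs Cs by (simp add: algebra_simps)
    also have "\<dots> = (\<Sum>m\<in>UNIV. \<Sum>k\<in>UNIV. \<Sum>i\<in>UNIV. \<Sum>j\<in>UNIV. C k x $ m $ i * (\<Gamma>\<Gamma> m x $ i $ j * HH x $ j $ k))"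
      by (rule sum.cong[OF refl]) (rule sum_rotate3)
    also have "\<dots> = X"
      unfolding X_def matrix_mult_nth sum_distrib_left ..
    finally show ?thesis .
  qed
  finally show ?thesis
    unfolding laplacian_def by (simp add: right_diff_distrib sum_subtractf)
qed

lemma scal_evolution:
  assumes x: "x \<in> V"
  shows "((\<lambda>s. scal (g s) x) has_real_derivative
    laplacian (g t) R x + 2 * trace (HH x ** ricci_matrix (g t) x ** HH x ** ricci_matrix (g t) x)) (at t)"
  using has_mderiv_trace[OF has_mderiv_mult[OF inverse_evolution[OF t x] ricci_evolution[OF x]]]
  unfolding scal_def trace_add trace_ricci_dot[OF x]
  by (simp add: matrix_scaleR_left trace_def sum_distrib_left add.commute matrix_mul_assoc)

end

end

section \<open>Invariance of the scalar curvature under isometries\<close>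

lemma matrix_left_cancel:
  fixes M :: "real^'n^'n"
  assumes "det M \<noteq> 0" "M ** A = M ** B"
  shows "A = B"
proof -
  have "matrix_inv M ** (M ** A) = matrix_inv M ** (M ** B)" using assms(2) by simp
  then show ?thesis by (simp add: matrix_mul_assoc matrix_inv_inverse assms(1))
qed

lemma jacobian_nth:
  fixes \<phi> :: "real^'n \<Rightarrow> real^'n"
  assumes "\<phi> differentiable (at x)"
  shows "jacobian \<phi> (at x) $ a $ i = pderiv_coord i (\<lambda>y. \<phi> y $ a) x"
proof -
  have "((\<lambda>y. \<phi> y $ a) has_derivative (\<lambda>v. frechet_derivative \<phi> (at x) v $ a)) (at x)"
    by (rule bounded_linear.has_derivative[OF bounded_linear_vec_nth differentiable_frechet[OF assms]])
  from pderiv_eqI[OF this] show ?thesis by (simp add: jacobian_def matrix_def)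
qed

lemma pderiv_chain:
  fixes \<phi> :: "real^'n \<Rightarrow> real^'n"
  assumes "\<phi> differentiable (at x)" "f differentiable (at (\<phi> x))"
  shows "pderiv_coord i (\<lambda>y. f (\<phi> y)) x =
    (\<Sum>a\<in>UNIV. jacobian \<phi> (at x) $ a $ i * pderiv_coord a f (\<phi> x))"
proof -
  let ?f = "frechet_derivative f (at (\<phi> x))" and ?p = "frechet_derivative \<phi> (at x)"
  have l: "linear ?f" using differentiable_frechet[OF assms(2)] has_derivative_linear by blast
  have "((\<lambda>y. f (\<phi> y)) has_derivative (\<lambda>v. ?f (?p v))) (at x)"
    using diff_chain_at[OF differentiable_frechet[OF assms(1)] differentiable_frechet[OF assms(2)]]
    by (simp add: o_def)
  then have "pderiv_coord i (\<lambda>y. f (\<phi> y)) x = ?f (?p (axis i 1))"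
    by (rule pderiv_eqI)
  also have "?p (axis i 1) = (\<Sum>a\<in>UNIV. ?p (axis i 1) $ a *\<^sub>R axis a 1)"
    by (simp add: vec_eq_iff axis_def if_distrib cong: if_cong)
  also have "?f \<dots> = (\<Sum>a\<in>UNIV. ?p (axis i 1) $ a * ?f (axis a 1))"
    by (simp add: linear_sum[OF l] linear_scale[OF l])
  finally show ?thesis by (simp add: pderiv_coord_def jacobian_def matrix_def)
qed

lemma mderiv_chain:
  fixes \<phi> :: "real^'n \<Rightarrow> real^'n"
  assumes "\<phi> differentiable (at x)" "mdiff M (\<phi> x)"
  shows "mderiv i (\<lambda>y. M (\<phi> y)) x = (\<Sum>a\<in>UNIV. jacobian \<phi> (at x) $ a $ i *\<^sub>R mderiv a M (\<phi> x))"
  unfolding vec_eq_iff mderiv_nth sum_component vector_scaleR_component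
  using pderiv_chain[OF assms(1) mdiffD[OF assms(2)]] by (simp add: mderiv_nth)

lemma mdiff_compose:
  fixes \<phi> :: "real^'n \<Rightarrow> real^'n"
  assumes "\<phi> differentiable (at x)" "mdiff M (\<phi> x)"
  shows "mdiff (\<lambda>y. M (\<phi> y)) x"
proof (intro allI)
  fix a b
  show "(\<lambda>y. M (\<phi> y) $ a $ b) differentiable (at x)"
    using differentiable_chain_at[OF assms(1), of "\<lambda>z. M z $ a $ b"] assms(2) by (simp add: o_def)
qed

lemma mdiff_mult: "mdiff M x \<Longrightarrow> mdiff N x \<Longrightarrow> mdiff (\<lambda>y. M y ** N y) x"
  unfolding matrix_mult_nth
  by (intro allI differentiable_sum finite_class.finite_UNIV ballI differentiable_mult) auto

lemma mdiff_transpose: "mdiff M x \<Longrightarrow> mdiff (\<lambda>y. transpose (M y)) x"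
  by (simp add: transpose_nth)

context metric_chart
begin

text \<open>Uniqueness of the Levi-Civita connection: \<open>P i\<close> plays the role of \<open>G \<Gamma>\<^sub>i\<close>, and the two conditions are
  metric compatibility and vanishing torsion.\<close>

lemma koszul_unique:
  assumes x: "x \<in> V"
    and P: "\<And>i. mderiv i G x = P i + transpose (P i)" "\<And>i l j. P i $ l $ j = P j $ l $ i"
  shows "G x ** Gam G i x = P i"
proof -
  have d: "pderiv_coord i (\<lambda>y. G y $ a $ b) x = P i $ a $ b + P i $ b $ a" for i a b
    using P(1)[of i] by (simp add: mderiv_nth[symmetric] transpose_nth)
  have "(G x ** Gam G i x) $ l $ j = P i $ l $ j" for l j
    unfolding koszul[OF x] d using P(2)[of i j l] P(2)[of j i l] P(2)[of j l i] by simp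
  then show ?thesis by (simp add: vec_eq_iff)
qed

end

locale chart_isometry = src: metric_chart U G' + tgt: metric_chart V G
  for U :: "(real^'n) set" and G' and V :: "(real^'n::finite) set" and G +
  fixes \<phi> :: "real^'n \<Rightarrow> real^'n"
  assumes maps: "\<And>x. x \<in> U \<Longrightarrow> \<phi> x \<in> V"
    and smooth: "\<And>k. ck k U \<phi>"
    and isometry: "\<And>x. x \<in> U \<Longrightarrow> G' x = congr_transform (jacobian \<phi> (at x)) (G (\<phi> x))"
begin

abbreviation "J x \<equiv> jacobian \<phi> (at x)"
abbreviation "\<Gamma>' \<equiv> Gam G'"
abbreviation "\<Gamma> \<equiv> Gam G"

definition Gam_pull :: "'n \<Rightarrow> real^'n \<Rightarrow> real^'n^'n"
  where "Gam_pull i x = (\<Sum>a\<in>UNIV. J x $ a $ i *\<^sub>R \<Gamma> a (\<phi> x))"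

lemma phi_diff: "x \<in> U \<Longrightarrow> \<phi> differentiable (at x)"
  using ck_differentiable[OF smooth src.open_V] .

lemma phi_comp: "ck k U (\<lambda>x. \<phi> x $ a)"
  by (rule ck_bounded_linear[OF bounded_linear_vec_nth smooth])

lemma J_nth: "x \<in> U \<Longrightarrow> J x $ a $ i = pderiv_coord i (\<lambda>y. \<phi> y $ a) x"
  by (rule jacobian_nth[OF phi_diff])

lemma smooth_J: "msmooth U J"
proof (rule msmoothI)
  fix k a b
  have "ck k U (pderiv_coord b (\<lambda>y. \<phi> y $ a))"
    by (rule ck_pderiv[OF phi_comp src.open_V])
  then show "ck k U (\<lambda>x. J x $ a $ b)"
    by (rule ck_cong[rotated]) (simp add: J_nth)
qed

lemma dJ_sym:
  assumes x: "x \<in> U"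
  shows "mderiv i J x $ a $ j = mderiv j J x $ a $ i"
proof -
  have e: "mderiv i J x $ a $ j = pderiv_coord i (pderiv_coord j (\<lambda>y. \<phi> y $ a)) x" for i j
    unfolding mderiv_nth by (rule pderiv_cong_open[OF src.open_V x]) (rule J_nth)
  show ?thesis
    unfolding e by (rule pderiv_commute[OF phi_comp src.open_V x])
qed

lemma isometry': "x \<in> U \<Longrightarrow> G' x = transpose (J x) ** G (\<phi> x) ** J x"
  using isometry by (simp add: congr_transform_def)

lemma det_J: "x \<in> U \<Longrightarrow> det (J x) \<noteq> 0"
  using src.det_G[of x] by (auto simp: isometry' det_mul)

lemma dJ: "x \<in> U \<Longrightarrow> mdiff J x"
  by (rule msmooth_mdiff[OF smooth_J src.open_V])

lemma mdiff_comp_phi: "x \<in> U \<Longrightarrow> msmooth V M \<Longrightarrow> mdiff (\<lambda>y. M (\<phi> y)) x"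
  by (rule mdiff_compose[OF phi_diff msmooth_mdiff[OF _ tgt.open_V maps]])

lemma mdiff_Gam_pull: 
  assumes x: "x \<in> U" shows "mdiff (Gam_pull i) x"
  unfolding Gam_pull_def sum_component vector_scaleR_component real_scaleR_def
  using dJ[OF x] mdiff_comp_phi[OF x tgt.smooth_Gam]
  by (intro allI differentiable_sum finite_class.finite_UNIV ballI differentiable_mult) auto

text \<open>The gauge transformation law of the connection. The matrices \<open>J\<^sup>-\<^sup>1 (A\<^sub>i J + \<partial>\<^sub>i J)\<close>, where \<open>A\<^sub>i\<close> is the
  pulled back connection matrix, satisfy the two conditions that characterize the Levi-Civita
  connection of the pulled back metric. Multiplying by \<open>J\<close> keeps derivatives of \<open>J\<^sup>-\<^sup>1\<close> out of the
  computation.\<close>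

lemma connection_transform:
  assumes x: "x \<in> U"
  shows "J x ** \<Gamma>' i x = Gam_pull i x ** J x + mderiv i J x"
proof -
  let ?J = "J x" and ?G = "G (\<phi> x)"
  define P where "P i = transpose ?J ** ?G ** (Gam_pull i x ** ?J + mderiv i J x)" for i
  have Gsym: "transpose ?G = ?G" using tgt.G_sym[OF maps[OF x]] .
  have "G' x ** \<Gamma>' i x = P i"
  proof (rule src.koszul_unique[OF x])
    fix i
    have dG: "mderiv i (\<lambda>y. G (\<phi> y)) x = ?G ** Gam_pull i x + transpose (Gam_pull i x) ** ?G"
    proof -
      have "mderiv i (\<lambda>y. G (\<phi> y)) x = (\<Sum>a\<in>UNIV. ?J $ a $ i *\<^sub>R mderiv a G (\<phi> x))"
        by (rule mderiv_chain[OF phi_diff[OF x] msmooth_mdiff[OF tgt.smooth_G tgt.open_V maps[OF x]]])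
      then show ?thesis
        unfolding tgt.compat[OF maps[OF x]] Gam_pull_def
        by (simp add: matrix_sum_left matrix_sum_right matrix_scaleR_left matrix_scaleR_right
            transpose_sum transpose_scalar scaleR_add_right sum.distrib)
    qed
    have dJx: "mdiff J x" and dGx: "mdiff (\<lambda>y. G (\<phi> y)) x"
      using dJ[OF x] mdiff_comp_phi[OF x tgt.smooth_G] by blast+
    have "mderiv i G' x = mderiv i (\<lambda>y. transpose (J y) ** G (\<phi> y) ** J y) x"
      by (rule mderiv_cong_open[OF src.open_V x]) (rule isometry')
    also have "\<dots> = mderiv i (\<lambda>y. transpose (J y) ** G (\<phi> y)) x ** ?J
        + transpose ?J ** ?G ** mderiv i J x"
      by (rule mderiv_mult[OF mdiff_mult[OF mdiff_transpose[OF dJx] dGx] dJx])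
    also have "mderiv i (\<lambda>y. transpose (J y) ** G (\<phi> y)) x =
        transpose (mderiv i J x) ** ?G + transpose ?J ** mderiv i (\<lambda>y. G (\<phi> y)) x"
      unfolding mderiv_transpose[symmetric] by (rule mderiv_mult[OF mdiff_transpose[OF dJx] dGx])
    finally show "mderiv i G' x = P i + transpose (P i)"
      unfolding dG P_def by (simp add: matrix_ring Gsym)
  next
    fix i l j
    have "(Gam_pull i x ** ?J) $ k $ j = (Gam_pull j x ** ?J) $ k $ i" for k
    proof -
      have "(Gam_pull i x ** ?J) $ k $ j = (\<Sum>b\<in>UNIV. \<Sum>a\<in>UNIV. ?J $ a $ i * \<Gamma> a (\<phi> x) $ k $ b * ?J $ b $ j)" for i j
        unfolding matrix_mult_nth Gam_pull_def by (simp add: sum_distrib_right)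
      moreover have "(\<Sum>b\<in>UNIV. \<Sum>a\<in>UNIV. ?J $ a $ i * \<Gamma> a (\<phi> x) $ k $ b * ?J $ b $ j) =
          (\<Sum>a\<in>UNIV. \<Sum>b\<in>UNIV. ?J $ a $ i * \<Gamma> a (\<phi> x) $ k $ b * ?J $ b $ j)"
        by (rule sum.swap)
      moreover have "\<dots> = (\<Sum>a\<in>UNIV. \<Sum>b\<in>UNIV. ?J $ b $ j * \<Gamma> b (\<phi> x) $ k $ a * ?J $ a $ i)"
        using tgt.Gam_sym[OF maps[OF x]] by (intro sum.cong refl) simp
      ultimately show ?thesis by simp
    qed
    then have "(Gam_pull i x ** ?J + mderiv i J x) $ k $ j = (Gam_pull j x ** ?J + mderiv j J x) $ k $ i" for k
      using dJ_sym[OF x] by simp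
    then show "P i $ l $ j = P j $ l $ i"
      unfolding P_def matrix_mult_nth[of "transpose ?J ** ?G"] by simp
  qed
  then have "(transpose ?J ** ?G) ** (?J ** \<Gamma>' i x) = (transpose ?J ** ?G) ** (Gam_pull i x ** ?J + mderiv i J x)"
    by (simp add: P_def isometry'[OF x] matrix_mul_assoc)
  moreover have "det (transpose ?J ** ?G) \<noteq> 0"
    using det_J[OF x] tgt.det_G[OF maps[OF x]] by (simp add: det_mul)
  ultimately show ?thesis
    by (rule matrix_left_cancel[rotated])
qed

definition curv_pull :: "'n \<Rightarrow> 'n \<Rightarrow> real^'n \<Rightarrow> real^'n^'n"
  where "curv_pull l i x = (\<Sum>a\<in>UNIV. \<Sum>b\<in>UNIV. (J x $ b $ l * J x $ a $ i) *\<^sub>R curv G b a (\<phi> x))"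

text \<open>Pulling back a connection commutes with taking its curvature: the terms with second derivatives of
  \<open>\<phi>\<close> are symmetric in the two directions and cancel.\<close>

lemma curvature_form_transform:
  assumes x: "x \<in> U"
  shows "mderiv l (Gam_pull i) x - mderiv i (Gam_pull l) x + Gam_pull l x ** Gam_pull i x - Gam_pull i x ** Gam_pull l x = curv_pull l i x"
proof -
  let ?J = "J x" and ?y = "\<phi> x"
  have dA: "mderiv l (Gam_pull i) x = (\<Sum>a\<in>UNIV. mderiv l J x $ a $ i *\<^sub>R \<Gamma> a ?y)
      + (\<Sum>a\<in>UNIV. \<Sum>b\<in>UNIV. (?J $ b $ l * ?J $ a $ i) *\<^sub>R mderiv b (\<Gamma> a) ?y)" for l i
  proof -
    have "mderiv l (Gam_pull i) x $ p $ q = ((\<Sum>a\<in>UNIV. mderiv l J x $ a $ i *\<^sub>R \<Gamma> a ?y)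
      + (\<Sum>a\<in>UNIV. \<Sum>b\<in>UNIV. (?J $ b $ l * ?J $ a $ i) *\<^sub>R mderiv b (\<Gamma> a) ?y)) $ p $ q" for p q
    proof -
      have 1: "(\<lambda>y. J y $ a $ i) differentiable (at x)" for a
        using mdiffD[OF dJ[OF x]] .
      have 2: "(\<lambda>y. \<Gamma> a (\<phi> y) $ p $ q) differentiable (at x)" for a
        using mdiffD[OF mdiff_comp_phi[OF x tgt.smooth_Gam]] .
      have 3: "pderiv_coord l (\<lambda>y. \<Gamma> a (\<phi> y) $ p $ q) x = (\<Sum>b\<in>UNIV. ?J $ b $ l * mderiv b (\<Gamma> a) ?y $ p $ q)" for a
        unfolding mderiv_nth
        by (rule pderiv_chain[OF phi_diff[OF x], of "\<lambda>z. \<Gamma> a z $ p $ q"])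
          (rule mdiffD[OF msmooth_mdiff[OF tgt.smooth_Gam tgt.open_V maps[OF x]]])
      have "mderiv l (Gam_pull i) x $ p $ q = pderiv_coord l (\<lambda>y. \<Sum>a\<in>UNIV. J y $ a $ i * \<Gamma> a (\<phi> y) $ p $ q) x"
        unfolding mderiv_nth Gam_pull_def by simp
      also have "\<dots> = (\<Sum>a\<in>UNIV. ?J $ a $ i * pderiv_coord l (\<lambda>y. \<Gamma> a (\<phi> y) $ p $ q) x
          + pderiv_coord l (\<lambda>y. J y $ a $ i) x * \<Gamma> a ?y $ p $ q)"
        using 1 2 by (simp add: pderiv_sum pderiv_mult)
      finally show ?thesis
        unfolding 3 by (simp add: mderiv_nth sum.distrib sum_distrib_left mult_ac)
    qed
    then show ?thesis by (simp add: vec_eq_iff)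
  qed
  have AA: "Gam_pull l x ** Gam_pull i x = (\<Sum>a\<in>UNIV. \<Sum>b\<in>UNIV. (?J $ b $ l * ?J $ a $ i) *\<^sub>R (\<Gamma> b ?y ** \<Gamma> a ?y))" for l i
    unfolding Gam_pull_def
    by (simp add: matrix_sum_left matrix_sum_right matrix_scaleR_left matrix_scaleR_right scaleR_sum_right mult_ac)
  have AA': "Gam_pull i x ** Gam_pull l x = (\<Sum>a\<in>UNIV. \<Sum>b\<in>UNIV. (?J $ b $ l * ?J $ a $ i) *\<^sub>R (\<Gamma> a ?y ** \<Gamma> b ?y))"
    unfolding AA by (subst sum.swap) (simp add: mult.commute)
  have dA': "(\<Sum>a\<in>UNIV. \<Sum>b\<in>UNIV. (?J $ b $ i * ?J $ a $ l) *\<^sub>R mderiv b (\<Gamma> a) ?y) =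
      (\<Sum>a\<in>UNIV. \<Sum>b\<in>UNIV. (?J $ b $ l * ?J $ a $ i) *\<^sub>R mderiv a (\<Gamma> b) ?y)"
    by (subst sum.swap) (simp add: mult.commute)
  have "mderiv l (Gam_pull i) x - mderiv i (Gam_pull l) x =
      (\<Sum>a\<in>UNIV. \<Sum>b\<in>UNIV. (?J $ b $ l * ?J $ a $ i) *\<^sub>R mderiv b (\<Gamma> a) ?y)
      - (\<Sum>a\<in>UNIV. \<Sum>b\<in>UNIV. (?J $ b $ l * ?J $ a $ i) *\<^sub>R mderiv a (\<Gamma> b) ?y)"
    unfolding dA dA' using dJ_sym[OF x, of l _ i] by simp
  then show ?thesis
    unfolding AA[of l i] AA' curv_pull_def curv_def
    by (simp add: scaleR_add_right scaleR_diff_right sum.distrib sum_subtractf)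
qed

text \<open>Take the antisymmetrized derivative of the gauge transformation law and use that law again to
  eliminate the derivatives of \<open>J\<close>; the second derivatives of \<open>J\<close> cancel.\<close>

lemma curvature_transform:
  assumes x: "x \<in> U"
  shows "J x ** curv G' l i x = curv_pull l i x ** J x"
proof -
  let ?J = "J x"
  have D: "mderiv l J x ** \<Gamma>' i x + ?J ** mderiv l (\<Gamma>' i) x =
      mderiv l (Gam_pull i) x ** ?J + Gam_pull i x ** mderiv l J x + mderiv l (mderiv i J) x" for l i
  proof -
    have "mderiv l (\<lambda>y. J y ** \<Gamma>' i y) x = mderiv l (\<lambda>y. Gam_pull i y ** J y + mderiv i J y) x"
      by (rule mderiv_cong_open[OF src.open_V x]) (rule connection_transform)
    also have "\<dots> = mderiv l (\<lambda>y. Gam_pull i y ** J y) x + mderiv l (mderiv i J) x"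
      by (intro mderiv_add mdiff_mult mdiff_Gam_pull dJ x
          msmooth_mdiff[OF msmooth_deriv[OF smooth_J src.open_V] src.open_V x])
    also have "mderiv l (\<lambda>y. Gam_pull i y ** J y) x = mderiv l (Gam_pull i) x ** ?J + Gam_pull i x ** mderiv l J x"
      by (intro mderiv_mult mdiff_Gam_pull dJ x)
    also have "mderiv l (\<lambda>y. J y ** \<Gamma>' i y) x = mderiv l J x ** \<Gamma>' i x + ?J ** mderiv l (\<Gamma>' i) x"
      by (intro mderiv_mult dJ x msmooth_mdiff[OF src.smooth_Gam src.open_V x])
    finally show ?thesis .
  qed
  have dJ': "mderiv i J x = ?J ** \<Gamma>' i x - Gam_pull i x ** ?J" for i
    using connection_transform[OF x, of i] by simp
  have c: "mderiv l (mderiv i J) x = mderiv i (mderiv l J) x"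
    by (rule mderiv_commute[OF smooth_J src.open_V x])
  have D': "?J ** mderiv l (\<Gamma>' i) x = mderiv l (Gam_pull i) x ** ?J + Gam_pull i x ** (?J ** \<Gamma>' l x - Gam_pull l x ** ?J)
      + mderiv l (mderiv i J) x - (?J ** \<Gamma>' l x - Gam_pull l x ** ?J) ** \<Gamma>' i x" for l i
    using D[of l i] unfolding dJ'[of l] by (simp add: algebra_simps)
  have "?J ** curv G' l i x = ?J ** mderiv l (\<Gamma>' i) x - ?J ** mderiv i (\<Gamma>' l) x
      + ?J ** \<Gamma>' l x ** \<Gamma>' i x - ?J ** \<Gamma>' i x ** \<Gamma>' l x"
    unfolding curv_def by (simp add: matrix_ring)
  also have "\<dots> = (mderiv l (Gam_pull i) x - mderiv i (Gam_pull l) x + Gam_pull l x ** Gam_pull i x - Gam_pull i x ** Gam_pull l x) ** ?J"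
    unfolding D'[of l i] D'[of i l] c by (simp add: matrix_ring)
  finally show ?thesis unfolding curvature_form_transform[OF x] .
qed

lemma ricci_transform:
  assumes x: "x \<in> U"
  shows "ricci_matrix G' x = transpose (J x) ** ricci_matrix G (\<phi> x) ** J x"
proof -
  let ?J = "J x" and ?I = "matrix_inv (J x)" and ?y = "\<phi> x"
  have JI: "(\<Sum>l\<in>UNIV. ?J $ b $ l * ?I $ l $ m) = (if b = m then 1 else 0)" for b m
    unfolding matrix_mult_nth[symmetric] matrix_inv_inverse(1)[OF det_J[OF x]] by (simp add: mat_def)
  have F: "curv G' l i x = ?I ** (curv_pull l i x ** ?J)" for l i
    unfolding curvature_transform[OF x, symmetric]
    by (simp add: matrix_mul_assoc matrix_inv_inverse det_J x)
  have "ricci_matrix G' x $ i $ k = (transpose ?J ** ricci_matrix G ?y ** ?J) $ i $ k" for i k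
  proof -
    have KJ: "(curv_pull l i x ** ?J) $ m $ k = (\<Sum>a\<in>UNIV. \<Sum>b\<in>UNIV. ?J $ b $ l * ?J $ a $ i * (curv G b a ?y ** ?J) $ m $ k)" for l m
      unfolding curv_pull_def by (simp add: matrix_sum_left matrix_scaleR_left)
    have "ricci_matrix G' x $ i $ k = (\<Sum>l\<in>UNIV. \<Sum>m\<in>UNIV. \<Sum>a\<in>UNIV. \<Sum>b\<in>UNIV.
        ?I $ l $ m * (?J $ b $ l * ?J $ a $ i * (curv G b a ?y ** ?J) $ m $ k))"
      unfolding ricci_matrix_nth F matrix_mult_nth[of ?I] KJ sum_distrib_left ..
    also have "\<dots> = (\<Sum>m\<in>UNIV. \<Sum>l\<in>UNIV. \<Sum>a\<in>UNIV. \<Sum>b\<in>UNIV.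
        ?I $ l $ m * (?J $ b $ l * ?J $ a $ i * (curv G b a ?y ** ?J) $ m $ k))"
      by (rule sum.swap)
    also have "\<dots> = (\<Sum>m\<in>UNIV. \<Sum>a\<in>UNIV. \<Sum>b\<in>UNIV. \<Sum>l\<in>UNIV.
        ?I $ l $ m * (?J $ b $ l * ?J $ a $ i * (curv G b a ?y ** ?J) $ m $ k))"
      by (rule sum.cong[OF refl]) (rule sum_rotate3[symmetric])
    also have "\<dots> = (\<Sum>m\<in>UNIV. \<Sum>a\<in>UNIV. \<Sum>b\<in>UNIV. (\<Sum>l\<in>UNIV. ?J $ b $ l * ?I $ l $ m) *
        (?J $ a $ i * (curv G b a ?y ** ?J) $ m $ k))"
      unfolding sum_distrib_right by (intro sum.cong refl) (simp add: mult_ac)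
    also have "\<dots> = (\<Sum>m\<in>UNIV. \<Sum>a\<in>UNIV. ?J $ a $ i * (curv G m a ?y ** ?J) $ m $ k)"
      unfolding JI by (simp add: if_distrib if_distribR cong: if_cong)
    also have "\<dots> = (\<Sum>a\<in>UNIV. \<Sum>m\<in>UNIV. ?J $ a $ i * (curv G m a ?y ** ?J) $ m $ k)"
      by (rule sum.swap)
    also have "\<dots> = (\<Sum>a\<in>UNIV. ?J $ a $ i * (ricci_matrix G ?y ** ?J) $ a $ k)"
    proof (rule sum.cong[OF refl])
      fix a
      have "(\<Sum>m\<in>UNIV. (curv G m a ?y ** ?J) $ m $ k) = (ricci_matrix G ?y ** ?J) $ a $ k"
        unfolding matrix_mult_nth ricci_matrix_nth sum_distrib_right by (rule sum.swap)
      then show "(\<Sum>m\<in>UNIV. ?J $ a $ i * (curv G m a ?y ** ?J) $ m $ k) = ?J $ a $ i * (ricci_matrix G ?y ** ?J) $ a $ k"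
        by (simp add: sum_distrib_left[symmetric])
    qed
    also have "\<dots> = (transpose ?J ** (ricci_matrix G ?y ** ?J)) $ i $ k"
      unfolding matrix_mult_nth[of "transpose ?J"] by (simp add: transpose_nth)
    finally show ?thesis by (simp add: matrix_mul_assoc)
  qed
  then show ?thesis by (simp add: vec_eq_iff)
qed

lemma scal_transform:
  assumes x: "x \<in> U"
  shows "scal G' x = scal G (\<phi> x)"
proof -
  let ?J = "J x" and ?y = "\<phi> x" and ?H' = "matrix_inv (G' x)"
  have "?H' ** (transpose ?J ** G ?y ** ?J) = mat 1"
    using src.HG[OF x] isometry'[OF x] by simp
  then have "?J ** (?H' ** (transpose ?J ** G ?y ** ?J)) ** matrix_inv ?J = mat 1"
    by (simp add: matrix_inv_inverse det_J x)
  then have "?J ** ?H' ** transpose ?J ** G ?y ** (?J ** matrix_inv ?J) = mat 1"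
    by (simp add: matrix_mul_assoc)
  then have "?J ** ?H' ** transpose ?J ** G ?y = mat 1"
    by (simp add: matrix_inv_inverse det_J x)
  then have "?J ** ?H' ** transpose ?J ** (G ?y ** matrix_inv (G ?y)) = matrix_inv (G ?y)"
    by (simp add: matrix_mul_assoc)
  then have H: "?J ** ?H' ** transpose ?J = matrix_inv (G ?y)"
    by (simp add: tgt.GH maps x)
  have "scal G' x = trace (?H' ** transpose ?J ** ricci_matrix G ?y ** ?J)"
    unfolding scal_def ricci_transform[OF x] by (simp add: matrix_mul_assoc)
  also have "\<dots> = trace (?J ** (?H' ** transpose ?J ** ricci_matrix G ?y))"
    by (rule trace_mul_sym)
  also have "\<dots> = scal G ?y"
    unfolding scal_def H[symmetric] by (simp add: matrix_mul_assoc)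
  finally show ?thesis .
qed

end

section \<open>Maximum principles in a chart\<close>

lemma second_derivative_test:
  fixes h :: "real \<Rightarrow> real"
  assumes e: "e > 0" and h: "\<And>s. \<bar>s\<bar> < e \<Longrightarrow> (h has_real_derivative h' s) (at s)"
    and h': "(h' has_real_derivative D) (at 0)" and min: "\<And>s. \<bar>s\<bar> < e \<Longrightarrow> h 0 \<le> h s"
  shows "h' 0 = 0" "D \<ge> 0"
proof -
  show z: "h' 0 = 0"
    using DERIV_local_min[OF h[of 0] e] min e by simp
  show "D \<ge> 0"
  proof (rule ccontr)
    assume "\<not> D \<ge> 0"
    then have "D < 0" by simp
    from DERIV_neg_dec_right[OF h' this] obtain d where d: "d > 0"
      "\<And>s. s > 0 \<Longrightarrow> s < d \<Longrightarrow> h' s < 0" using z by auto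
    define s where "s = min d e / 2"
    have s: "s > 0" "s < d" "s < e" using d e by (auto simp: s_def)
    have "\<And>r. 0 \<le> r \<Longrightarrow> r \<le> s \<Longrightarrow> (h has_real_derivative h' r) (at r)"
      using h s by simp
    from MVT2[OF s(1) this] obtain r where r: "0 < r" "r < s" "h s - h 0 = (s - 0) * h' r"
      by blast
    have "s * h' r < 0" using d(2)[of r] r s by (simp add: mult_pos_neg)
    then show False using min[of s] r s by simp
  qed
qed

lemma derivative_nonpos_at_left_min:
  fixes w :: "real \<Rightarrow> real"
  assumes "(w has_real_derivative D) (at t)" "e > 0" "\<And>s. t - e < s \<Longrightarrow> s < t \<Longrightarrow> w t \<le> w s"
  shows "D \<le> 0"
proof (rule ccontr)
  assume "\<not> D \<le> 0"
  then have "D > 0" by simp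
  from DERIV_pos_inc_left[OF assms(1) this] obtain d where d: "d > 0"
    "\<And>h. h > 0 \<Longrightarrow> h < d \<Longrightarrow> w (t - h) < w t" by auto
  define h where "h = min d e / 2"
  have "h > 0" "h < d" "h < e" using d assms(2) by (auto simp: h_def)
  then show False using d(2)[of h] assms(3)[of "t - h"] by simp
qed

lemma derivative_along_line:
  fixes f :: "real^'n \<Rightarrow> real"
  assumes "f differentiable (at (x + s *\<^sub>R b))"
  shows "((\<lambda>s. f (x + s *\<^sub>R b)) has_real_derivative (\<Sum>k\<in>UNIV. b $ k * pderiv_coord k f (x + s *\<^sub>R b))) (at s)"
proof -
  let ?f = "frechet_derivative f (at (x + s *\<^sub>R b))"
  have d: "(f has_derivative ?f) (at (x + s *\<^sub>R b))" by (rule differentiable_frechet[OF assms])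
  have l: "linear ?f" using has_derivative_linear[OF d] .
  have "((\<lambda>s. x + s *\<^sub>R b) has_derivative (\<lambda>r. r *\<^sub>R b)) (at s)"
    by (auto intro!: derivative_eq_intros)
  from diff_chain_at[OF this d] have "((\<lambda>s. f (x + s *\<^sub>R b)) has_derivative (\<lambda>r. ?f (r *\<^sub>R b))) (at s)"
    by (simp add: o_def)
  moreover have "(\<lambda>r. ?f (r *\<^sub>R b)) = (*) (\<Sum>k\<in>UNIV. b $ k * pderiv_coord k f (x + s *\<^sub>R b))"
  proof
    fix r
    have "b = (\<Sum>k\<in>UNIV. b $ k *\<^sub>R axis k 1)"
      by (simp add: vec_eq_iff axis_def if_distrib cong: if_cong)
    then have "?f b = (\<Sum>k\<in>UNIV. b $ k * ?f (axis k 1))"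
      using linear_sum[OF l, of "\<lambda>k. b $ k *\<^sub>R axis k 1" UNIV] by (simp add: linear_scale[OF l])
    then show "?f (r *\<^sub>R b) = (\<Sum>k\<in>UNIV. b $ k * pderiv_coord k f (x + s *\<^sub>R b)) * r"
      by (simp add: linear_scale[OF l] pderiv_coord_def mult.commute)
  qed
  ultimately show ?thesis by (simp add: has_field_derivative_def)
qed

text \<open>The second derivative test on the line through \<open>x\<close> in direction \<open>b\<close>.\<close>

lemma directional_second_derivative_at_min:
  fixes f :: "real^'n \<Rightarrow> real"
  assumes f: "ck 2 W f" "open W" "x \<in> W" and min: "\<And>y. y \<in> W \<Longrightarrow> f x \<le> f y"
  shows "(\<Sum>k\<in>UNIV. b $ k * pderiv_coord k f x) = 0"
    "(\<Sum>j\<in>UNIV. \<Sum>k\<in>UNIV. b $ j * b $ k * pderiv_coord j (pderiv_coord k f) x) \<ge> 0"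
proof -
  have "((\<lambda>s. x + s *\<^sub>R b) \<longlongrightarrow> x + 0 *\<^sub>R b) (at 0)"
    by (intro tendsto_intros)
  then have "\<forall>\<^sub>F s in at 0. x + s *\<^sub>R b \<in> W"
    using topological_tendstoD[OF _ f(2)] f(3) by simp
  then obtain e where e: "e > 0" "\<And>s. \<bar>s\<bar> < e \<Longrightarrow> x + s *\<^sub>R b \<in> W"
    unfolding eventually_at using f(3) by (auto simp: dist_real_def) (metis add_0_right scaleR_zero_left abs_0)
  have c1: "ck (Suc 0) W (pderiv_coord k f)" for k
    using ck_pderiv[OF _ f(2), of "Suc 0" f k] f(1) by (simp only: numeral_2_eq_2)
  define h' where "h' s = (\<Sum>k\<in>UNIV. b $ k * pderiv_coord k f (x + s *\<^sub>R b))" for s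
  have h: "((\<lambda>s. f (x + s *\<^sub>R b)) has_real_derivative h' s) (at s)" if "\<bar>s\<bar> < e" for s
    unfolding h'_def
    by (rule derivative_along_line, rule ck_differentiable[OF f(1)[unfolded numeral_2_eq_2] f(2)]) (rule e(2)[OF that])
  have h': "(h' has_real_derivative (\<Sum>k\<in>UNIV. b $ k * (\<Sum>j\<in>UNIV. b $ j * pderiv_coord j (pderiv_coord k f) x))) (at 0)"
    unfolding h'_def
  proof (intro DERIV_sum DERIV_cmult)
    fix k
    show "((\<lambda>s. pderiv_coord k f (x + s *\<^sub>R b)) has_real_derivative
        (\<Sum>j\<in>UNIV. b $ j * pderiv_coord j (pderiv_coord k f) x)) (at 0)"
      using derivative_along_line[of "pderiv_coord k f" x 0 b] ck_differentiable[OF c1 f(2,3)] by simp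
  qed
  note t = second_derivative_test[OF e(1) h h']
  have m: "f (x + 0 *\<^sub>R b) \<le> f (x + s *\<^sub>R b)" if "\<bar>s\<bar> < e" for s
    using min[OF e(2)[OF that]] by simp
  show "(\<Sum>k\<in>UNIV. b $ k * pderiv_coord k f x) = 0"
    using t(1)[OF _ m] by (simp add: h'_def)
  have "(\<Sum>k\<in>UNIV. b $ k * (\<Sum>j\<in>UNIV. b $ j * pderiv_coord j (pderiv_coord k f) x)) =
      (\<Sum>j\<in>UNIV. \<Sum>k\<in>UNIV. b $ j * b $ k * pderiv_coord j (pderiv_coord k f) x)"
    unfolding sum_distrib_left by (subst sum.swap) (simp add: mult_ac)
  then show "(\<Sum>j\<in>UNIV. \<Sum>k\<in>UNIV. b $ j * b $ k * pderiv_coord j (pderiv_coord k f) x) \<ge> 0"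
    using t(2)[OF _ m] by simp
qed

text \<open>At a minimum the gradient vanishes, and writing the inverse metric as \<open>B B\<^sup>T\<close> makes the Laplacian the
  sum of the second derivatives in the directions of the columns of \<open>B\<close>.\<close>

lemma laplacian_nonneg_at_min:
  fixes f :: "real^'n \<Rightarrow> real"
  assumes f: "ck 2 W f" "open W" "x \<in> W" and min: "\<And>y. y \<in> W \<Longrightarrow> f x \<le> f y"
    and G: "posdef (G x)"
  shows "laplacian G f x \<ge> 0"
proof -
  obtain B :: "real^'n^'n" where B: "matrix_inv (G x) = B ** transpose B"
    using posdef_inv_factor G by blast
  have grad: "pderiv_coord m f x = 0" for m
    using directional_second_derivative_at_min(1)[OF f min, of "axis m 1"]
    by (simp add: axis_def if_distrib if_distribR cong: if_cong)
  have "laplacian G f x = (\<Sum>j\<in>UNIV. \<Sum>k\<in>UNIV. (\<Sum>l\<in>UNIV. B $ j $ l * B $ k $ l) * pderiv_coord j (pderiv_coord k f) x)"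
    unfolding laplacian_def grad B matrix_mult_nth by (simp add: transpose_nth)
  also have "\<dots> = (\<Sum>l\<in>UNIV. \<Sum>j\<in>UNIV. \<Sum>k\<in>UNIV. B $ j $ l * B $ k $ l * pderiv_coord j (pderiv_coord k f) x)"
    unfolding sum_distrib_right by (rule sum_rotate3)
  also have "\<dots> \<ge> 0"
  proof (rule sum_nonneg)
    fix l
    show "(\<Sum>j\<in>UNIV. \<Sum>k\<in>UNIV. B $ j $ l * B $ k $ l * pderiv_coord j (pderiv_coord k f) x) \<ge> 0"
      using directional_second_derivative_at_min(2)[OF f min, of "\<chi> j. B $ j $ l"] by simp
  qed
  finally show ?thesis .
qed

lemma laplacian_diff:
  assumes f: "ck 2 W f" and h: "ck 2 W h" and W: "open W" "x \<in> W"
  shows "laplacian G (\<lambda>y. f y - h y) x = laplacian G f x - laplacian G h x"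
proof -
  note c1 = ck_pderiv[OF _ W(1), of "Suc 0", folded numeral_2_eq_2]
  have d1: "pderiv_coord k (\<lambda>y. f y - h y) y = pderiv_coord k f y - pderiv_coord k h y" if "y \<in> W" for k y
    by (rule pderiv_diff; rule ck_differentiable[OF _ W(1) that, of 1])
      (use f h in \<open>simp_all only: numeral_2_eq_2 One_nat_def\<close>)
  have "pderiv_coord j (pderiv_coord k (\<lambda>y. f y - h y)) x = pderiv_coord j (\<lambda>y. pderiv_coord k f y - pderiv_coord k h y) x" for j k
    by (rule pderiv_cong_open[OF W]) (rule d1)
  also have "\<dots> j k = pderiv_coord j (pderiv_coord k f) x - pderiv_coord j (pderiv_coord k h) x" for j k
    by (rule pderiv_diff; rule ck_differentiable[OF c1 W]) (rule f h)+
  finally show ?thesis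
    unfolding laplacian_def d1[OF W(2)]
    by (simp add: sum_subtractf right_diff_distrib)
qed

lemma ck_ident: "ck k S (\<lambda>x. x)"
  by (cases k) (auto intro!: exI[of _ "\<lambda>x v. v"] ck_const)

lemma ck_component: "ck k S (\<lambda>x. x $ i)"
  by (rule ck_bounded_linear[OF bounded_linear_vec_nth ck_ident])

text \<open>For \<open>r > 0\<close> this is positive exactly inside the ball of radius \<open>r\<close> about \<open>c\<close>. Its square is the profile of the barrier in
  the strong maximum principle: at the boundary of the ball the square vanishes to second order, where
  its Laplacian is positive.\<close>

definition bump :: "real \<Rightarrow> real^'n \<Rightarrow> real^'n \<Rightarrow> real"
  where "bump r c x = r\<^sup>2 - (x - c) \<bullet> (x - c)"

lemma ck_bump: "ck k S (bump r c)"
  unfolding bump_def[abs_def] inner_vec_def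
  by (simp, intro ck_diff ck_sum ck_mult ck_const ck_component)

lemma pderiv_bump: "pderiv_coord j (bump r c) x = - 2 * (x - c) $ j"
proof -
  have "(bump r c has_derivative (\<lambda>v. - 2 * ((x - c) \<bullet> v))) (at x)"
    unfolding bump_def[abs_def]
    by (auto intro!: derivative_eq_intros simp: inner_commute)
  from pderiv_eqI[OF this] show ?thesis by (simp add: inner_axis)
qed

lemma pderiv_component: "pderiv_coord j (\<lambda>x. x $ k) x = (if j = k then 1 else 0)"
proof -
  have "((\<lambda>x. x $ k) has_derivative (\<lambda>v. v $ k)) (at x)"
    by (rule bounded_linear_imp_has_derivative[OF bounded_linear_vec_nth])
  from pderiv_eqI[OF this] show ?thesis by (simp add: axis_def)
qed

lemma differentiable_ck: "ck (Suc 0) UNIV f \<Longrightarrow> f differentiable (at x)"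
  using ck_differentiable[of 0 UNIV f x] by simp

lemma laplacian_barrier:
  "laplacian G (\<lambda>x. a * (bump r c x)\<^sup>2) x = a * (\<Sum>j\<in>UNIV. \<Sum>k\<in>UNIV. matrix_inv (G x) $ j $ k *
    (8 * (x - c) $ j * (x - c) $ k - 4 * bump r c x * ((if j = k then 1 else 0)
      - (\<Sum>m\<in>UNIV. Gam G j x $ m $ k * (x - c) $ m))))"
proof -
  have db: "bump r c differentiable (at x)" for x
    by (rule differentiable_ck[OF ck_bump])
  have p1: "pderiv_coord k (\<lambda>x. a * (bump r c x)\<^sup>2) x = - (4 * a) * (bump r c x * (x - c) $ k)" for k x
  proof -
    have "pderiv_coord k (\<lambda>x. a * (bump r c x * bump r c x)) x = a * pderiv_coord k (\<lambda>x. bump r c x * bump r c x) x"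
      by (rule pderiv_cmult) (intro differentiable_mult db)
    also have "pderiv_coord k (\<lambda>x. bump r c x * bump r c x) x = - 4 * (bump r c x * (x - c) $ k)"
      by (simp add: pderiv_mult[OF db db] pderiv_bump algebra_simps)
    finally show ?thesis by (simp add: power2_eq_square)
  qed
  have dk: "(\<lambda>x. (x - c) $ k) differentiable (at x)" for k x
    by (rule differentiable_ck) (unfold vector_minus_component, intro ck_diff ck_component ck_const)
  have pk: "pderiv_coord j (\<lambda>x. (x - c) $ k) x = (if j = k then 1 else 0)" for j k
    using pderiv_diff[OF differentiable_ck[OF ck_component], of "\<lambda>_. c $ k" x j k] by (simp add: pderiv_component)
  have p2: "pderiv_coord j (pderiv_coord k (\<lambda>x. a * (bump r c x)\<^sup>2)) x =
      - (4 * a) * (bump r c x * (if j = k then 1 else 0) - 2 * (x - c) $ j * (x - c) $ k)" for j k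
  proof -
    have "pderiv_coord k (\<lambda>x. a * (bump r c x)\<^sup>2) = (\<lambda>x. - (4 * a) * (bump r c x * (x - c) $ k))"
      using p1 by blast
    then have "pderiv_coord j (pderiv_coord k (\<lambda>x. a * (bump r c x)\<^sup>2)) x =
        - (4 * a) * pderiv_coord j (\<lambda>x. bump r c x * (x - c) $ k) x"
      by (simp only: pderiv_cmult[OF differentiable_mult[OF db dk]])
    then show ?thesis
      unfolding pderiv_mult[OF db dk] pk pderiv_bump by (simp add: algebra_simps)
  qed
  have s: "(\<Sum>m\<in>UNIV. Gam G j x $ m $ k * (- (4 * a) * (bump r c x * (x - c) $ m))) =
      - (4 * a) * bump r c x * (\<Sum>m\<in>UNIV. Gam G j x $ m $ k * (x - c) $ m)" for j k
    by (simp add: sum_distrib_left sum_negf mult_ac del: vector_minus_component)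
  have alg: "h * (- (4 * a) * (b * i - 2 * dj * dk) - - (4 * a) * b * s) =
      a * (h * (8 * dj * dk - 4 * b * (i - s)))" for h b i dj dk s :: real
    by (simp add: algebra_simps)
  show ?thesis
    unfolding laplacian_def p1 p2 s alg sum_distrib_left[symmetric] ..
qed

text \<open>Where \<open>e \<ge> 0\<close>, the function \<open>q\<close> is bounded below by a positive constant by compactness.\<close>

lemma compact_dominate:
  fixes e q :: "'a::topological_space \<Rightarrow> real"
  assumes K: "compact K" and e: "continuous_on K e" and q: "continuous_on K q"
    and q0: "\<And>z. z \<in> K \<Longrightarrow> q z \<ge> 0" and neg: "\<And>z. z \<in> K \<Longrightarrow> q z = 0 \<Longrightarrow> e z < 0"
  shows "\<exists>\<kappa>. \<forall>z\<in>K. e z < \<kappa> * q z"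
proof -
  define L where "L = K \<inter> e -` {0..}"
  have L: "compact L"
  proof -
    have "closedin (top_of_set K) L"
      unfolding L_def by (rule continuous_closedin_preimage[OF e closed_atLeast])
    then show ?thesis using closedin_compact K by blast
  qed
  show ?thesis
  proof (cases "L = {}")
    case True
    then have "e z < 0 * q z" if "z \<in> K" for z using that by (auto simp: L_def not_le)
    then show ?thesis by blast
  next
    case False
    have sub: "L \<subseteq> K" by (auto simp: L_def)
    obtain z1 where z1: "z1 \<in> L" "\<And>z. z \<in> L \<Longrightarrow> q z1 \<le> q z"
      using continuous_attains_inf[OF L False continuous_on_subset[OF q sub]] by blast
    obtain z2 where z2: "z2 \<in> L" "\<And>z. z \<in> L \<Longrightarrow> e z \<le> e z2"
      using continuous_attains_sup[OF L False continuous_on_subset[OF e sub]] by blast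
    have pos: "q z1 > 0" using z1(1) q0 neg unfolding L_def by force
    have e2: "e z2 \<ge> 0" using z2 by (auto simp: L_def)
    let ?k = "(e z2 + 1) / q z1"
    have "e z < ?k * q z" if z: "z \<in> K" for z
    proof (cases "z \<in> L")
      case True
      have "e z < ?k * q z1" using z2(2)[OF True] pos by simp
      also have "\<dots> \<le> ?k * q z" using z1(2)[OF True] e2 pos by (intro mult_left_mono) auto
      finally show ?thesis .
    next
      case False
      then have "e z < 0" using z by (auto simp: L_def)
      moreover have "0 \<le> ?k * q z" using e2 pos q0[OF z] by simp
      ultimately show ?thesis by linarith
    qed
    then show ?thesis by blast
  qed
qed

context flow_chart
begin

abbreviation "ricci_sq t x \<equiv> trace (matrix_inv (g t x) ** ricci_matrix (g t) x ** matrix_inv (g t x) ** ricci_matrix (g t) x)"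

lemma scal_square_le: "t \<in> T \<Longrightarrow> x \<in> V \<Longrightarrow> (scal (g t) x)\<^sup>2 \<le> CARD('n) * ricci_sq t x"
  unfolding scal_def by (rule trace_square_le[OF posdef_g ricci_sym])

lemma ricci_sq_nonneg: 
  assumes "t \<in> T" "x \<in> V" shows "ricci_sq t x \<ge> 0"
proof -
  have "0 \<le> (scal (g t) x)\<^sup>2" by simp
  also have "\<dots> \<le> CARD('n) * ricci_sq t x" by (rule scal_square_le[OF assms])
  finally show ?thesis by (simp add: zero_le_mult_iff)
qed

lemma ck_scal_time: "t \<in> T \<Longrightarrow> ck k V (scal (g t))"
  using metric_chart.ck_scal[OF at_time] .

text \<open>The strong maximum principle. A barrier of height \<open>a(t) (\<eta>\<^sup>2 - |x - c(t)|\<^sup>2)\<^sup>2\<close>, supported in a small ball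
  whose centre \<open>c(t)\<close> moves from \<open>y\<close> to \<open>z\<close>, starts below \<open>R\<close>. If its amplitude decays fast enough, it is
  a strict subsolution of the heat equation: near the boundary of the ball the positive gradient term
  in its Laplacian wins, and elsewhere the decay does. Hence it stays below \<open>R\<close> and forces \<open>R > 0\<close> at \<open>z\<close>.\<close>

lemma positivity_spreads:
  assumes t: "{t0..t3} \<subseteq> T" "t0 < t3" and B: "ball x0 \<rho> \<subseteq> V"
    and nn: "\<And>t x. t \<in> {t0..t3} \<Longrightarrow> x \<in> ball x0 \<rho> \<Longrightarrow> scal (g t) x \<ge> 0"
    and y: "y \<in> ball x0 \<rho>" "scal (g t0) y > 0" and z: "z \<in> ball x0 \<rho>"
  shows "scal (g t3) z > 0"
proof -
  let ?u = "\<lambda>t x. scal (g t) x"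
  have t0T: "t0 \<in> T" using t by auto
  define \<delta> where "\<delta> = ?u t0 y / 2"
  have \<delta>: "\<delta> > 0" using y by (simp add: \<delta>_def)
  have "isCont (?u t0) y"
    using ck_continuous_on[OF ck_scal_time[OF t0T]] y B open_V continuous_on_eq_continuous_at by blast
  then obtain \<eta>1 where \<eta>1: "\<eta>1 > 0" "\<And>x. dist x y < \<eta>1 \<Longrightarrow> dist (?u t0 x) (?u t0 y) < \<delta>"
    unfolding continuous_at_eps_delta using \<delta> by blast
  define \<eta> where "\<eta> = min (\<eta>1 / 2) (min (\<rho> - dist x0 y) (\<rho> - dist x0 z) / 2)"
  have \<eta>: "\<eta> > 0" "\<eta> < \<eta>1" "\<eta> + dist x0 y < \<rho>" "\<eta> + dist x0 z < \<rho>"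
    using \<eta>1 y z by (auto simp: \<eta>_def min_def field_simps)
  have start: "?u t0 x > \<delta>" if "dist x y \<le> \<eta>" for x
  proof -
    have "\<bar>?u t0 x - ?u t0 y\<bar> < \<delta>"
      using \<eta>1(2)[of x] that \<eta>(2) unfolding dist_real_def by linarith
    then show ?thesis unfolding \<delta>_def by linarith
  qed
  define \<theta> where "\<theta> t = (t - t0) / (t3 - t0)" for t
  define c where "c t = y + \<theta> t *\<^sub>R (z - y)" for t
  define c' where "c' = (1 / (t3 - t0)) *\<^sub>R (z - y)"
  have c0: "c t0 = y" and c3: "c t3 = z" using t(2) by (auto simp: c_def \<theta>_def)
  have inB: "x \<in> ball x0 \<rho>" if "t \<in> {t0..t3}" "dist x (c t) \<le> \<eta>" for t x
  proof -
    have \<theta>: "0 \<le> \<theta> t" "\<theta> t \<le> 1" using that(1) t(2) by (auto simp: \<theta>_def)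
    have "c t = (1 - \<theta> t) *\<^sub>R y + \<theta> t *\<^sub>R z" by (simp add: c_def algebra_simps)
    moreover have "(1 - \<theta> t) *\<^sub>R y + \<theta> t *\<^sub>R z \<in> ball x0 (\<rho> - \<eta>)"
      using convexD[OF convex_ball[of x0 "\<rho> - \<eta>"], of y z "1 - \<theta> t" "\<theta> t"] \<theta> \<eta>(3,4) by simp
    ultimately have "dist x0 (c t) < \<rho> - \<eta>" by simp
    then show ?thesis using that(2) dist_triangle[of x0 x "c t"] by (simp add: dist_commute)
  qed
  define K where "K = (\<lambda>(t, \<xi>). (t, c t + \<xi>)) ` ({t0..t3} \<times> cball (0 :: real^'n) \<eta>)"
  have c_cont: "continuous_on S c" for S
    unfolding c_def[abs_def] \<theta>_def using t(2) by (intro continuous_intros) auto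
  have cK: "compact K"
    unfolding K_def
  proof (rule compact_continuous_image)
    show "continuous_on ({t0..t3} \<times> cball (0 :: real^'n) \<eta>) (\<lambda>(t, \<xi>). (t, c t + \<xi>))"
      unfolding case_prod_beta' by (intro continuous_intros continuous_on_compose2[OF c_cont[of UNIV]]) auto
    show "compact ({t0..t3} \<times> cball (0 :: real^'n) \<eta>)"
      by (intro compact_Times compact_Icc compact_cball)
  qed
  have K: "(t, x) \<in> K \<longleftrightarrow> t \<in> {t0..t3} \<and> dist x (c t) \<le> \<eta>" for t x
  proof
    assume "t \<in> {t0..t3} \<and> dist x (c t) \<le> \<eta>"
    then have "(t, x - c t) \<in> {t0..t3} \<times> cball (0 :: real^'n) \<eta>"
      by (simp add: dist_norm norm_minus_commute)
    then show "(t, x) \<in> K" unfolding K_def by (force intro: image_eqI[of _ _ "(t, x - c t)"])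
  qed (auto simp: K_def dist_norm norm_minus_commute)
  have KTV: "K \<subseteq> T \<times> V" using K inB B t(1) by fastforce
  define q where "q t x = bump \<eta> (c t) x" for t x
  have q_nn: "q t x \<ge> 0" if "(t, x) \<in> K" for t x
    using that power_mono[of "norm (x - c t)" \<eta> 2] by (simp add: K q_def bump_def dist_norm power2_norm_eq_inner)
  have q_le: "q t x \<le> \<eta>\<^sup>2" for t x
    by (simp add: q_def bump_def)
  \<comment> \<open>\<open>a e\<close> is the time derivative of the barrier for frozen \<open>a\<close>, minus its Laplacian; the decay of
    the amplitude \<open>a\<close> contributes \<open>- \<kappa> a q\<^sup>2\<close>.\<close>
  define e where "e t x = 4 * q t x * ((x - c t) \<bullet> c')
    - (\<Sum>j\<in>UNIV. \<Sum>k\<in>UNIV. matrix_inv (g t x) $ j $ k *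
    (8 * (x - c t) $ j * (x - c t) $ k - 4 * q t x * ((if j = k then 1 else 0)
      - (\<Sum>m\<in>UNIV. Gam (g t) j x $ m $ k * (x - c t) $ m))))" for t x
  have qc: "continuous_on K (\<lambda>(t, x). q t x)"
    unfolding q_def bump_def case_prod_beta'
    by (intro continuous_intros continuous_on_compose2[OF c_cont[of UNIV]]) auto
  have ec: "continuous_on K (\<lambda>(t, x). e t x)"
  proof -
    have 1: "continuous_on K (\<lambda>z. matrix_inv (g (fst z) (snd z)) $ j $ k)" for j k
      using continuous_on_subset[OF ck_continuous_on[OF smooth_inv_strip[of 0 j k]] KTV] by (simp add: case_prod_beta')
    have 2: "continuous_on K (\<lambda>z. Gam (g (fst z)) j (snd z) $ m $ k)" for j m k
      using continuous_on_subset[OF ck_continuous_on[OF smooth_Gam_strip[of 0 j m k]] KTV] by (simp add: case_prod_beta')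
    have 3: "continuous_on K (\<lambda>z. q (fst z) (snd z))" using qc by (simp add: case_prod_beta')
    have 4: "continuous_on K (\<lambda>z. (snd z - c (fst z)) $ k)" for k
      by (intro continuous_intros continuous_on_compose2[OF c_cont[of UNIV]]) auto
    have 5: "continuous_on K (\<lambda>z. (snd z - c (fst z)) \<bullet> c')"
      by (intro continuous_intros continuous_on_compose2[OF c_cont[of UNIV]]) auto
    show ?thesis
      unfolding e_def case_prod_beta'
      by (intro continuous_on_diff continuous_on_sum continuous_on_mult continuous_on_const 1 2 3 4 5)
  qed
  \<comment> \<open>The rate of decay: on the boundary of the ball, where \<open>q = 0\<close>, only the negative gradient
    term of \<open>e\<close> is left.\<close>
  have "\<exists>\<kappa>. \<forall>p\<in>K. (\<lambda>(t, x). e t x) p < \<kappa> * (\<lambda>(t, x). (q t x)\<^sup>2) p"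
  proof (rule compact_dominate[OF cK ec])
    show "continuous_on K (\<lambda>(t, x). (q t x)\<^sup>2)"
      using qc unfolding case_prod_beta' by (intro continuous_intros)
    fix p assume p: "p \<in> K"
    show "(\<lambda>(t, x). (q t x)\<^sup>2) p \<ge> 0" by (simp add: case_prod_beta')
    assume q0: "(\<lambda>(t, x). (q t x)\<^sup>2) p = 0"
    obtain t x where tx: "p = (t, x)" by fastforce
    have "q t x = 0" using q0 tx by simp
    then have nz: "x - c t \<noteq> 0" using \<eta>(1) by (auto simp: q_def bump_def)
    have "e t x = - 8 * (\<Sum>j\<in>UNIV. \<Sum>k\<in>UNIV. matrix_inv (g t x) $ j $ k * ((x - c t) $ j * (x - c t) $ k))"
      unfolding e_def \<open>q t x = 0\<close>
      by (simp add: sum_distrib_left mult_ac sum_negf del: vector_minus_component)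
    also have "(\<Sum>j\<in>UNIV. \<Sum>k\<in>UNIV. matrix_inv (g t x) $ j $ k * ((x - c t) $ j * (x - c t) $ k)) =
        (x - c t) \<bullet> (matrix_inv (g t x) *v (x - c t))"
      by (simp add: inner_vec_def matrix_vector_mult_def sum_distrib_left mult_ac)
    finally have "e t x = - 8 * ((x - c t) \<bullet> (matrix_inv (g t x) *v (x - c t)))" .
    moreover have "posdef (matrix_inv (g t x))"
      using posdef_matrix_inv posdef_g KTV p tx by blast
    ultimately have "e t x < 0" using nz by (simp add: posdef_def)
    then show "(\<lambda>(t, x). e t x) p < 0" using tx by simp
  qed
  then obtain \<kappa> where \<kappa>: "\<And>t x. (t, x) \<in> K \<Longrightarrow> e t x < \<kappa> * (q t x)\<^sup>2" by force
  \<comment> \<open>Initially the barrier is at most \<open>D (\<eta>\<^sup>2)\<^sup>2 = \<delta>\<close>.\<close>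
  define D where "D = \<delta> / \<eta>^4"
  define a where "a t = D * exp (- \<kappa> * (t - t0))" for t
  have a: "a t > 0" for t using \<delta> \<eta> by (simp add: a_def D_def)
  define v where "v t x = a t * (q t x)\<^sup>2" for t x
  define w where "w t x = ?u t x - v t x" for t x
  have "K \<noteq> {}" using K[of t3 z] c3 \<eta>(1) t(2) by auto
  moreover have "continuous_on K (\<lambda>(t, x). w t x)"
  proof -
    have "continuous_on K (\<lambda>(t, x). ?u t x)"
      using continuous_on_subset[OF ck_continuous_on[OF ck_scal_strip[of 0]] KTV] .
    then show ?thesis using qc
      unfolding w_def v_def a_def case_prod_beta' by (intro continuous_intros)
  qed
  ultimately obtain p where p: "p \<in> K" "\<forall>p'\<in>K. (\<lambda>(t, x). w t x) p \<le> (\<lambda>(t, x). w t x) p'"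
    using continuous_attains_inf[OF cK] by blast
  obtain ts xs where ps: "p = (ts, xs)" by fastforce
  have sK: "(ts, xs) \<in> K" and min: "\<And>t x. (t, x) \<in> K \<Longrightarrow> w ts xs \<le> w t x"
    using p ps by auto
  have sT: "ts \<in> T" and sV: "xs \<in> V" and s03: "ts \<in> {t0..t3}" using KTV sK K by auto
  have "w ts xs \<ge> 0"
  proof (rule ccontr)
    assume "\<not> w ts xs \<ge> 0"
    then have lt: "?u ts xs < v ts xs" by (simp add: w_def)
    moreover have "?u ts xs \<ge> 0" using nn[OF s03] inB[OF s03] sK K by blast
    ultimately have "v ts xs > 0" by linarith
    then have "q ts xs \<noteq> 0" by (auto simp: v_def)
    then have qpos: "q ts xs > 0" using q_nn[OF sK] by linarith
    then have "(norm (xs - c ts))\<^sup>2 < \<eta>\<^sup>2" by (simp add: q_def bump_def power2_norm_eq_inner)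
    then have near: "dist xs (c ts) < \<eta>"
      using \<eta>(1) power_less_imp_less_base[of "norm (xs - c ts)" 2 \<eta>] by (simp add: dist_norm)
    have late: "ts > t0"
    proof (rule ccontr)
      assume "\<not> ts > t0"
      then have ts: "ts = t0" using s03 by simp
      have "v t0 xs \<le> \<delta> / \<eta>^4 * (\<eta>\<^sup>2)\<^sup>2"
      proof -
        have "(q t0 xs)\<^sup>2 \<le> (\<eta>\<^sup>2)\<^sup>2" using power_mono[OF q_le q_nn] sK ts by blast
        moreover have "v t0 xs = \<delta> / \<eta>^4 * (q t0 xs)\<^sup>2" by (simp add: v_def a_def D_def)
        ultimately show ?thesis using \<delta> \<eta>(1) by (simp only:) (intro mult_left_mono, auto)
      qed
      also have "\<dots> = \<delta>" using \<eta> by (simp flip: power_mult)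
      also have "\<dots> < ?u t0 xs" using start[of xs] sK K ts c0 by auto
      finally show False using lt ts by simp
    qed
    have u_t: "((\<lambda>s. ?u s xs) has_real_derivative laplacian (g ts) (?u ts) xs + 2 * ricci_sq ts xs) (at ts)"
      by (rule scal_evolution[OF sT sV])
    have v_t: "((\<lambda>s. v s xs) has_real_derivative a ts * (- \<kappa> * (q ts xs)\<^sup>2 + 4 * q ts xs * ((xs - c ts) \<bullet> c'))) (at ts)"
    proof -
      have "(c has_vector_derivative c') (at ts)"
        unfolding c_def[abs_def] \<theta>_def c'_def
        using t(2) by (auto intro!: derivative_eq_intros simp: divide_simps)
      then have "((\<lambda>s. xs - c s) has_vector_derivative - c') (at ts)"
        by (auto intro!: derivative_eq_intros)
      then have "((\<lambda>s. (xs - c s) \<bullet> (xs - c s)) has_vector_derivative (xs - c ts) \<bullet> (- c') + (- c') \<bullet> (xs - c ts)) (at ts)"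
        by (rule bounded_bilinear.has_vector_derivative[OF bounded_bilinear_inner, of "\<lambda>s. xs - c s" _ _ _ "\<lambda>s. xs - c s"]) fact
      then have q_t: "((\<lambda>s. q s xs) has_real_derivative 2 * ((xs - c ts) \<bullet> c')) (at ts)"
        unfolding q_def bump_def has_real_derivative_iff_has_vector_derivative
        by (auto intro!: derivative_eq_intros simp: inner_commute)
      have a_t: "(a has_real_derivative - \<kappa> * a ts) (at ts)"
        unfolding a_def[abs_def] by (auto intro!: derivative_eq_intros)
      show ?thesis
        unfolding v_def using a_t q_t
        by (auto intro!: derivative_eq_intros simp: algebra_simps power2_eq_square)
    qed
    \<comment> \<open>At a negative minimum of \<open>R - v\<close> the barrier is positive, so the point lies in the open ball
      and the derivative tests apply.\<close>
    have "laplacian (g ts) (\<lambda>x. ?u ts x - v ts x) xs \<ge> 0"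
    proof (rule laplacian_nonneg_at_min)
      show "open (ball (c ts) \<eta> \<inter> V)" using open_V by auto
      show "xs \<in> ball (c ts) \<eta> \<inter> V" using near sV by (simp add: dist_commute)
      show "ck 2 (ball (c ts) \<eta> \<inter> V) (\<lambda>x. ?u ts x - v ts x)"
        unfolding v_def q_def power2_eq_square
        by (intro ck_diff ck_mult ck_const ck_bump ck_subset[OF ck_scal_time[OF sT]]) auto
      show "?u ts xs - v ts xs \<le> ?u ts x - v ts x" if "x \<in> ball (c ts) \<eta> \<inter> V" for x
        using min[of ts x] that K s03 by (simp add: w_def dist_commute)
      show "posdef (g ts xs)" by (rule posdef_g[OF sT sV])
    qed
    also have "laplacian (g ts) (\<lambda>x. ?u ts x - v ts x) xs =
        laplacian (g ts) (?u ts) xs - laplacian (g ts) (v ts) xs"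
      by (rule laplacian_diff[OF ck_scal_time[OF sT] _ open_V sV])
        (unfold v_def q_def power2_eq_square, intro ck_mult ck_const ck_bump)
    finally have lap: "laplacian (g ts) (v ts) xs \<le> laplacian (g ts) (?u ts) xs" by simp
    have lapv: "laplacian (g ts) (v ts) xs = a ts * (4 * q ts xs * ((xs - c ts) \<bullet> c') - e ts xs)"
      unfolding v_def[abs_def] q_def laplacian_barrier by (simp add: e_def q_def)
    have "((\<lambda>s. w s xs) has_real_derivative laplacian (g ts) (?u ts) xs + 2 * ricci_sq ts xs
        - a ts * (- \<kappa> * (q ts xs)\<^sup>2 + 4 * q ts xs * ((xs - c ts) \<bullet> c'))) (at ts)"
      unfolding w_def by (rule DERIV_diff[OF u_t v_t])
    moreover have "\<exists>d>0. \<forall>s. ts - d < s \<longrightarrow> s < ts \<longrightarrow> (s, xs) \<in> K"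
    proof -
      have "isCont (\<lambda>s. dist xs (c s)) ts"
        using c_cont[of UNIV] by (intro continuous_intros) (simp add: continuous_on_eq_continuous_at)
      then have "\<forall>\<^sub>F s in at ts. dist xs (c s) < \<eta>"
        using near by (simp add: isCont_def order_tendstoD(2))
      then obtain d where d: "d > 0" "\<And>s. s \<noteq> ts \<Longrightarrow> dist s ts < d \<Longrightarrow> dist xs (c s) < \<eta>"
        unfolding eventually_at by auto
      have "(s, xs) \<in> K" if "ts - min d (ts - t0) < s" "s < ts" for s
      proof -
        have "ts - s < d" "t0 < s" using that by linarith+
        then show ?thesis using that d(2)[of s] s03 by (auto simp: K dist_real_def)
      qed
      then show ?thesis using d(1) late by (intro exI[of _ "min d (ts - t0)"]) auto
    qed
    ultimately have "laplacian (g ts) (?u ts) xs + 2 * ricci_sq ts xs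
        - a ts * (- \<kappa> * (q ts xs)\<^sup>2 + 4 * q ts xs * ((xs - c ts) \<bullet> c')) \<le> 0"
      using derivative_nonpos_at_left_min[of "\<lambda>s. w s xs" _ ts] min by metis
    then have "a ts * (4 * q ts xs * ((xs - c ts) \<bullet> c') - e ts xs) \<le> a ts * (- \<kappa> * (q ts xs)\<^sup>2 + 4 * q ts xs * ((xs - c ts) \<bullet> c'))"
      using lap lapv ricci_sq_nonneg[OF sT sV] by linarith
    then have "4 * q ts xs * ((xs - c ts) \<bullet> c') - e ts xs \<le> - \<kappa> * (q ts xs)\<^sup>2 + 4 * q ts xs * ((xs - c ts) \<bullet> c')"
      using a[of ts] by (simp only: mult_le_cancel_left_pos)
    then show False using \<kappa>[OF sK] by simp
  qed
  moreover have "(t3, z) \<in> K" using K c3 \<eta>(1) t(2) by simp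
  ultimately have "?u t3 z \<ge> v t3 z" using min[of t3 z] by (simp add: w_def)
  moreover have "v t3 z > 0"
    using a[of t3] \<eta>(1) by (simp add: v_def q_def bump_def c3)
  ultimately show ?thesis by linarith
qed

end

section \<open>Ricci flow on a closed manifold\<close>

lemma msmooth_subset: "msmooth S F \<Longrightarrow> U \<subseteq> S \<Longrightarrow> msmooth U F"
  unfolding msmooth_def using ck_subset by blast

text \<open>The chain rule for Jacobians, for a function that is a composition only near \<open>x\<close>, as happens for
  composed coordinate maps.\<close>

lemma jacobian_compose:
  fixes \<phi> :: "real^'n \<Rightarrow> real^'n" and \<psi> :: "real^'n \<Rightarrow> real^'n"
  assumes \<phi>: "\<phi> differentiable (at x)" and \<psi>: "\<psi> differentiable (at (\<phi> x))"
    and W: "open W" "x \<in> W" "\<And>y. y \<in> W \<Longrightarrow> \<xi> y = \<psi> (\<phi> y)"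
  shows "jacobian \<xi> (at x) = jacobian \<psi> (at (\<phi> x)) ** jacobian \<phi> (at x)"
proof -
  let ?p = "frechet_derivative \<phi> (at x)" and ?q = "frechet_derivative \<psi> (at (\<phi> x))"
  have d: "((\<psi> \<circ> \<phi>) has_derivative ?q \<circ> ?p) (at x)"
    by (rule diff_chain_at[OF differentiable_frechet[OF \<phi>] differentiable_frechet[OF \<psi>]])
  have "(\<xi> has_derivative ?q \<circ> ?p) (at x)"
    by (rule has_derivative_transform_within_open[OF d W(1,2)]) (simp add: W(3))
  then have "frechet_derivative \<xi> (at x) = ?q \<circ> ?p"
    by (rule frechet_derivative_at[symmetric])
  moreover have "linear ?p" "linear ?q"
    using has_derivative_linear differentiable_frechet \<phi> \<psi> by blast+
  ultimately show ?thesis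
    by (simp add: jacobian_def matrix_compose)
qed

lemma congr_transform_compose: "congr_transform P (congr_transform Q h) = congr_transform (Q ** P) h"
  by (simp add: congr_transform_def matrix_transpose_mul matrix_mul_assoc)

locale closed_flow =
  fixes X :: "'a topology" and A :: "('a, 'n::finite) chart set"
    and g :: "real \<Rightarrow> ('a, 'n) tensor2" and t1 t2 :: real
  assumes manifold: "closed_connected_manifold X A" and t12: "t1 < t2"
    and flow: "ricci_flow A t1 t2 g"
begin

abbreviation "M \<equiv> topspace X"

lemma atlas: "smooth_atlas X A" and compact_M: "compact_space X" and connected_M: "connected_space X"
  using manifold by (auto simp: closed_connected_manifold_def smooth_manifold_def)

lemma chart: "c \<in> A \<Longrightarrow> is_chart X c"
  using atlas by (simp add: smooth_atlas_def)

lemma covered: "p \<in> M \<Longrightarrow> \<exists>c\<in>A. p \<in> dom_of c"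
  using atlas by (auto simp: smooth_atlas_def)

definition img :: "('a, 'n) chart \<Rightarrow> (real^'n) set"
  where "img c = coord c ` dom_of c"

lemma open_img: "c \<in> A \<Longrightarrow> open (img c)"
  using chart by (simp add: is_chart_def img_def)

lemma open_dom: "c \<in> A \<Longrightarrow> openin X (dom_of c)"
  using chart by (simp add: is_chart_def)

lemma dom_sub: "c \<in> A \<Longrightarrow> dom_of c \<subseteq> M"
  using open_dom openin_subset by blast

lemma homeo: "c \<in> A \<Longrightarrow> homeomorphic_map (subtopology X (dom_of c)) (top_of_set (img c)) (coord c)"
  using chart by (simp add: is_chart_def img_def)

lemma top_dom: "c \<in> A \<Longrightarrow> topspace (subtopology X (dom_of c)) = dom_of c"
  using dom_sub by (simp add: Int_absorb1)

lemma inj_coord: "c \<in> A \<Longrightarrow> inj_on (coord c) (dom_of c)"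
  using homeomorphic_imp_injective_map[OF homeo] top_dom by simp

lemma param_coord: "c \<in> A \<Longrightarrow> p \<in> dom_of c \<Longrightarrow> param c (coord c p) = p"
  using inj_coord inv_into_f_f by metis

lemma coord_param: "x \<in> img c \<Longrightarrow> coord c (param c x) = x"
  by (simp add: img_def f_inv_into_f)

lemma param_dom: "x \<in> img c \<Longrightarrow> param c x \<in> dom_of c"
  by (simp add: img_def inv_into_into)

lemma coord_img: "p \<in> dom_of c \<Longrightarrow> coord c p \<in> img c"
  by (simp add: img_def)

lemma open_coord_image:
  assumes c: "c \<in> A" and U: "openin X U" "U \<subseteq> dom_of c"
  shows "open (coord c ` U)"
proof -
  have "openin (subtopology X (dom_of c)) U"
    using U by (simp add: openin_open_subtopology open_dom c)
  then have "openin (top_of_set (img c)) (coord c ` U)"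
    using homeomorphic_map_openness[OF homeo[OF c]] U(2) top_dom[OF c] by blast
  then show ?thesis using open_img[OF c] openin_open_eq by blast
qed

lemma open_param_image:
  assumes c: "c \<in> A" and W: "open W" "W \<subseteq> img c"
  shows "openin X (param c ` W)"
proof -
  have sub: "param c ` W \<subseteq> dom_of c" using W(2) param_dom by blast
  have "coord c ` param c ` W = (\<lambda>x. x) ` W"
    unfolding image_image using coord_param W(2) by (intro image_cong) auto
  then have "coord c ` param c ` W = W" by simp
  then have "openin (top_of_set (img c)) (coord c ` param c ` W)"
    using W open_img[OF c] by (simp add: openin_open_eq)
  then have "openin (subtopology X (dom_of c)) (param c ` W)"
    using homeomorphic_map_openness[OF homeo[OF c]] sub top_dom[OF c] by blast
  then show ?thesis using open_dom[OF c] openin_open_subtopology by blast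
qed

lemma chart_ball:
  assumes p: "p \<in> M"
  obtains c \<rho> where "c \<in> A" "p \<in> dom_of c" "\<rho> > 0" "cball (coord c p) \<rho> \<subseteq> img c"
    "openin X (param c ` ball (coord c p) \<rho>)" "p \<in> param c ` ball (coord c p) \<rho>"
proof -
  obtain c where c: "c \<in> A" "p \<in> dom_of c" using covered[OF p] by blast
  obtain \<rho> where \<rho>: "\<rho> > 0" "cball (coord c p) \<rho> \<subseteq> img c"
    using open_contains_cball open_img[OF c(1)] coord_img[OF c(2)] by blast
  have "openin X (param c ` ball (coord c p) \<rho>)"
    using open_param_image[OF c(1) open_ball] \<rho>(2) ball_subset_cball by (metis subset_trans)
  moreover have "p \<in> param c ` ball (coord c p) \<rho>"
    using param_coord[OF c] \<rho>(1) by (metis centre_in_ball image_eqI)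
  ultimately show thesis using that c \<rho> by blast
qed

definition metric_in :: "('a, 'n) chart \<Rightarrow> real \<Rightarrow> real^'n \<Rightarrow> real^'n^'n"
  where "metric_in c t x = g t c (param c x)"

lemma metric: "t \<in> {t1..t2} \<Longrightarrow> riemannian_metric A (g t)"
  using flow by (simp add: ricci_flow_def)

lemma metric_transform:
  assumes "t \<in> {t1..t2}" "c \<in> A" "d \<in> A" "p \<in> dom_of c" "p \<in> dom_of d"
  shows "g t c p = congr_transform (jacobian (coord d \<circ> param c) (at (coord c p))) (g t d p)"
  using metric[OF assms(1)] assms(2-) unfolding riemannian_metric_def tensor_field_def by blast

lemma ricci_metric_in: "ricci (g t) c p = ricci_matrix (metric_in c t) (coord c p)"
  by (simp add: ricci_def metric_in_def[abs_def] o_def)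

lemma bounded_linear_entry: "bounded_linear (\<lambda>M :: real^'n^'n. M $ a $ b)"
  using bounded_linear_compose[OF bounded_linear_vec_nth bounded_linear_vec_nth] .

lemma strip: 
  assumes c: "c \<in> A" shows "metric_strip {t1..t2} (img c) (metric_in c)"
proof
  show "open (img c)" by (rule open_img[OF c])
  show "msmooth ({t1..t2} \<times> img c) (\<lambda>(t, x). metric_in c t x)"
  proof (rule msmoothI)
    fix k a b
    have "smooth_on ({t1..t2} \<times> img c) (\<lambda>(t, x). metric_in c t x)"
      using flow c by (simp add: ricci_flow_def img_def metric_in_def)
    from ck_bounded_linear[OF bounded_linear_entry ck_if_smooth_on[OF this]]
    show "ck k ({t1..t2} \<times> img c) (\<lambda>x. (case x of (t, x) \<Rightarrow> metric_in c t x) $ a $ b)" .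
  qed
  fix t x assume "t \<in> {t1..t2}" "x \<in> img c"
  then show "posdef (metric_in c t x)"
    using metric[of t] c param_dom[of x c] by (auto simp: riemannian_metric_def posdef_def metric_in_def)
qed

lemma flow_chart: 
  assumes c: "c \<in> A" shows "flow_chart {t1<..<t2} (img c) (metric_in c)"
proof -
  interpret s: metric_strip "{t1..t2}" "img c" "metric_in c" by (rule strip[OF c])
  show ?thesis
  proof
    show "open (img c)" by (rule open_img[OF c])
    show "msmooth ({t1<..<t2} \<times> img c) (\<lambda>(t, x). metric_in c t x)"
      by (rule msmooth_subset[OF s.smooth_g]) auto
    show "open {t1<..<t2}" by simp
    fix t x assume t: "t \<in> {t1<..<t2}" and x: "x \<in> img c"
    show "posdef (metric_in c t x)" using s.posdef_g t x by simp
    have p: "param c x \<in> dom_of c" by (rule param_dom[OF x])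
    have "((\<lambda>s. g s c (param c x)) has_vector_derivative (-2) *\<^sub>R ricci (g t) c (param c x)) (at t within {t1..t2})"
      using flow c p t by (simp add: ricci_flow_def)
    moreover have "at t within {t1..t2} = at t"
      using t by (intro at_within_interior) simp
    ultimately have d: "((\<lambda>s. metric_in c s x) has_vector_derivative (-2) *\<^sub>R ricci_matrix (metric_in c t) x) (at t)"
      by (simp add: metric_in_def[of c _ x] ricci_metric_in coord_param[OF x])
    show "has_mderiv (\<lambda>s. metric_in c s x) t ((-2) *\<^sub>R ricci_matrix (metric_in c t) x)"
      unfolding has_mderiv_def has_real_derivative_iff_has_vector_derivative
      using bounded_linear.has_vector_derivative[OF bounded_linear_entry d] by blast
  qed
qed

lemma open_overlap:
  assumes "continuous_map X X \<Phi>" and c: "c \<in> A" and "d \<in> A"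
  shows "open (coord c ` {q \<in> dom_of c. \<Phi> q \<in> dom_of d})"
proof (rule open_coord_image[OF c])
  have "openin X (dom_of c \<inter> {q \<in> M. \<Phi> q \<in> dom_of d})"
    using openin_continuous_map_preimage[OF assms(1) open_dom[OF assms(3)]] open_dom[OF c] by blast
  moreover have "dom_of c \<inter> {q \<in> M. \<Phi> q \<in> dom_of d} = {q \<in> dom_of c. \<Phi> q \<in> dom_of d}"
    using dom_sub[OF c] by auto
  ultimately show "openin X {q \<in> dom_of c. \<Phi> q \<in> dom_of d}" by simp
qed auto

text \<open>Applied with the identity map this makes the scalar curvature independent of the chart, and applied
  with the diffeomorphism of a breather it compares the two end times.\<close>

lemma scal_under_isometry:
  assumes \<Phi>: "smooth_map X A \<Phi>" and c: "c \<in> A" and d: "d \<in> A"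
    and p: "p \<in> dom_of c" "\<Phi> p \<in> dom_of d" and st: "s \<in> {t1..t2}" "t \<in> {t1..t2}"
    and iso: "\<And>q. q \<in> dom_of c \<Longrightarrow> \<Phi> q \<in> dom_of d \<Longrightarrow>
      g s c q = congr_transform (jacobian (coord d \<circ> \<Phi> \<circ> param c) (at (coord c q))) (g t d (\<Phi> q))"
  shows "scal (metric_in c s) (coord c p) = scal (metric_in d t) (coord d (\<Phi> p))"
proof -
  define D where "D = {q \<in> dom_of c. \<Phi> q \<in> dom_of d}"
  define U where "U = coord c ` D"
  define \<phi> where "\<phi> = coord d \<circ> \<Phi> \<circ> param c"
  have oU: "open U"
    using \<Phi> unfolding U_def D_def smooth_map_def by (intro open_overlap c d) blast
  have UV: "U \<subseteq> img c" by (auto simp: U_def D_def img_def)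
  interpret mc: metric_chart "img c" "metric_in c s" by (rule metric_strip.at_time[OF strip[OF c] st(1)])
  interpret md: metric_chart "img d" "metric_in d t" by (rule metric_strip.at_time[OF strip[OF d] st(2)])
  have pre: "param c x \<in> D" "coord c (param c x) = x" if "x \<in> U" for x
    using that param_coord[OF c] by (auto simp: U_def D_def)
  interpret chart_isometry U "metric_in c s" "img d" "metric_in d t" \<phi>
  proof
    show "open U" by (rule oU)
    show "msmooth U (metric_in c s)" by (rule msmooth_subset[OF mc.smooth_G UV])
    show "posdef (metric_in c s x)" if "x \<in> U" for x using mc.posdef_G UV that by blast
    show "\<phi> x \<in> img d" if "x \<in> U" for x
      using pre[OF that] by (simp add: \<phi>_def img_def D_def)
    have "smooth_on U \<phi>" using \<Phi> c d by (simp add: smooth_map_def U_def D_def \<phi>_def)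
    then show "ck k U \<phi>" for k by (rule ck_if_smooth_on)
    show "metric_in c s x = congr_transform (jacobian \<phi> (at x)) (metric_in d t (\<phi> x))" if "x \<in> U" for x
      using iso[of "param c x"] pre[OF that] param_coord[OF d]
      by (simp add: D_def metric_in_def \<phi>_def)
  qed
  have "coord c p \<in> U" using p by (auto simp: U_def D_def)
  from scal_transform[OF this] show ?thesis
    by (simp add: \<phi>_def param_coord[OF c p(1)])
qed

lemma smooth_map_id: "smooth_map X A (\<lambda>p. p)"
proof -
  have "{p \<in> dom_of c. p \<in> dom_of d} = dom_of c \<inter> dom_of d" for c d :: "('a, 'n) chart" by auto
  then show ?thesis
    using atlas by (simp add: smooth_map_def smooth_atlas_def continuous_map_id[unfolded id_def] o_def)
qed

lemma scal_chart_indep: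
  assumes "c \<in> A" "d \<in> A" "p \<in> dom_of c" "p \<in> dom_of d" "t \<in> {t1..t2}"
  shows "scal (metric_in c t) (coord c p) = scal (metric_in d t) (coord d p)"
proof (rule scal_under_isometry[OF smooth_map_id, of c d p t t])
  fix q assume "q \<in> dom_of c" "q \<in> dom_of d"
  moreover have "coord d \<circ> (\<lambda>p. p) \<circ> param c = coord d \<circ> param c" by (simp add: o_def)
  ultimately show "g t c q = congr_transform (jacobian (coord d \<circ> (\<lambda>p. p) \<circ> param c) (at (coord c q))) (g t d q)"
    using metric_transform[OF assms(5,1,2)] by metis
qed (use assms in auto)

text \<open>The scalar curvature as a function on the manifold; the choice of the chart is immaterial by
  \<open>scal_chart_indep\<close>.\<close>

definition scalar :: "real \<Rightarrow> 'a \<Rightarrow> real"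
  where "scalar t p = (let c = (SOME c. c \<in> A \<and> p \<in> dom_of c) in scal (metric_in c t) (coord c p))"

lemma scalar_chart:
  assumes "c \<in> A" "p \<in> dom_of c" "t \<in> {t1..t2}"
  shows "scalar t p = scal (metric_in c t) (coord c p)"
proof -
  have "(SOME c. c \<in> A \<and> p \<in> dom_of c) \<in> A \<and> p \<in> dom_of (SOME c. c \<in> A \<and> p \<in> dom_of c)"
    using assms by (intro someI[where P = "\<lambda>c. c \<in> A \<and> p \<in> dom_of c"]) auto
  then show ?thesis
    unfolding scalar_def Let_def using scal_chart_indep assms by blast
qed

lemma scalar_param:
  assumes "c \<in> A" "x \<in> img c" "t \<in> {t1..t2}"
  shows "scalar t (param c x) = scal (metric_in c t) x"
  using scalar_chart[OF assms(1) param_dom[OF assms(2)] assms(3)] coord_param[OF assms(2)] by simp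

lemma scalar_continuous_time:
  assumes p: "p \<in> M" shows "continuous_on {t1..t2} (\<lambda>t. scalar t p)"
proof -
  obtain c where c: "c \<in> A" "p \<in> dom_of c" using covered[OF p] by blast
  have "continuous_on ({t1..t2} \<times> img c) (\<lambda>(t, x). scal (metric_in c t) x)"
    using ck_continuous_on[OF metric_strip.ck_scal_strip[OF strip[OF c(1)]]] .
  then have "continuous_on {t1..t2} (\<lambda>t. (\<lambda>(t, x). scal (metric_in c t) x) (t, coord c p))"
    by (rule continuous_on_compose2) (auto intro!: continuous_intros coord_img c)
  then show ?thesis
    by (rule continuous_on_eq) (simp add: scalar_chart[OF c])
qed

text \<open>On each coordinate ball the minimum is attained over the compact set of times and points of the
  closed ball; finitely many balls cover the manifold.\<close>

lemma scalar_attains_min: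
  assumes ab: "a \<le> b" "{a..b} \<subseteq> {t1..t2}" and \<psi>: "continuous_on {a..b} \<psi>" and ne: "M \<noteq> {}"
  shows "\<exists>t\<in>{a..b}. \<exists>p\<in>M. \<forall>t'\<in>{a..b}. \<forall>p'\<in>M. scalar t p - \<psi> t \<le> scalar t' p' - \<psi> t'"
proof -
  define w where "w z = scalar (fst z) (snd z) - \<psi> (fst z)" for z
  have "\<exists>O' z. openin X O' \<and> p \<in> O' \<and> z \<in> {a..b} \<times> M \<and> (\<forall>z'\<in>{a..b} \<times> O'. w z \<le> w z')" if p: "p \<in> M" for p
  proof -
    obtain c \<rho> where c: "c \<in> A" "p \<in> dom_of c" "\<rho> > 0" "cball (coord c p) \<rho> \<subseteq> img c"
      "openin X (param c ` ball (coord c p) \<rho>)" "p \<in> param c ` ball (coord c p) \<rho>"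
      using chart_ball[OF p] by blast
    let ?K = "{a..b} \<times> cball (coord c p) \<rho>"
    have "continuous_on ?K (\<lambda>(t, x). scal (metric_in c t) x)"
      by (rule continuous_on_subset[OF ck_continuous_on[OF metric_strip.ck_scal_strip[OF strip[OF c(1)]]]])
        (use ab c(4) in auto)
    moreover have "continuous_on ?K (\<lambda>z. \<psi> (fst z))"
      by (rule continuous_on_compose2[OF \<psi>]) (auto intro: continuous_intros)
    ultimately have "continuous_on ?K (\<lambda>z. scal (metric_in c (fst z)) (snd z) - \<psi> (fst z))"
      by (auto simp: case_prod_beta' intro: continuous_on_diff)
    moreover have "compact ?K" "?K \<noteq> {}"
      using ab c(3) by (auto intro: compact_Times)
    ultimately obtain z where z: "z \<in> ?K"
      "\<forall>z'\<in>?K. scal (metric_in c (fst z)) (snd z) - \<psi> (fst z) \<le> scal (metric_in c (fst z')) (snd z') - \<psi> (fst z')"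
      using continuous_attains_inf by blast
    have w: "w (t, param c x) = scal (metric_in c t) x - \<psi> t" if "(t, x) \<in> ?K" for t x
      using that scalar_param[OF c(1), of x t] ab(2) c(4) by (auto simp: w_def)
    show ?thesis
    proof (intro exI conjI ballI)
      show "openin X (param c ` ball (coord c p) \<rho>)" "p \<in> param c ` ball (coord c p) \<rho>" by fact+
      show "(fst z, param c (snd z)) \<in> {a..b} \<times> M"
        using z(1) c(4) param_dom[of "snd z" c] dom_sub[OF c(1)] unfolding mem_Times_iff fst_conv snd_conv by blast
      fix z' assume "z' \<in> {a..b} \<times> param c ` ball (coord c p) \<rho>"
      then obtain t x where z': "z' = (t, param c x)" "(t, x) \<in> ?K" by auto
      show "w (fst z, param c (snd z)) \<le> w z'"
        using z(2)[rule_format, OF z'(2)] w[OF z'(2)] w[of "fst z" "snd z"] z(1) z'(1) by simp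
    qed
  qed
  then obtain N m where Nm: "\<And>p. p \<in> M \<Longrightarrow> openin X (N p)" "\<And>p. p \<in> M \<Longrightarrow> p \<in> N p"
    "\<And>p. p \<in> M \<Longrightarrow> m p \<in> {a..b} \<times> M" "\<And>p z'. p \<in> M \<Longrightarrow> z' \<in> {a..b} \<times> N p \<Longrightarrow> w (m p) \<le> w z'"
    by metis
  have "compactin X M" using compact_M by (simp add: compact_space_def)
  moreover have "\<And>U. U \<in> N ` M \<Longrightarrow> openin X U" "M \<subseteq> \<Union> (N ` M)" using Nm(1,2) by auto
  ultimately obtain \<F> where F: "finite \<F>" "\<F> \<subseteq> N ` M" "M \<subseteq> \<Union> \<F>"
    unfolding compactin_def by (metis (no_types, lifting))
  obtain F' where F': "F' \<subseteq> M" "finite F'" "\<F> = N ` F'"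
    using finite_subset_image[OF F(1,2)] by blast
  have "F' \<noteq> {}" using F(3) F'(3) ne by auto
  define p where "p = arg_min_on (\<lambda>p. w (m p)) F'"
  have p: "p \<in> F'" unfolding p_def by (rule arg_min_if_finite(1)[OF F'(2) \<open>F' \<noteq> {}\<close>])
  have least: "w (m p) \<le> w (m q)" if "q \<in> F'" for q
    unfolding p_def using arg_min_least[OF F'(2) \<open>F' \<noteq> {}\<close> that] .
  have "w (m p) \<le> w (t', p')" if "t' \<in> {a..b}" "p' \<in> M" for t' p'
  proof -
    obtain q where q: "q \<in> F'" "p' \<in> N q" using F(3) F'(3) \<open>p' \<in> M\<close> by auto
    then have "w (m q) \<le> w (t', p')" using Nm(4)[of q "(t', p')"] F'(1) \<open>t' \<in> {a..b}\<close> by auto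
    then show ?thesis using least[OF q(1)] by linarith
  qed
  moreover have "m p \<in> {a..b} \<times> M" using Nm(3) F'(1) p by blast
  ultimately show ?thesis unfolding w_def by (metis SigmaE fst_conv snd_conv)
qed

section \<open>Maximum principles on the manifold\<close>

text \<open>Comparison of \<open>R\<close> with a function of time alone. At a negative minimum of \<open>R - \<psi>\<close> over a time interval
  starting at \<open>a\<close>, which cannot be at the time \<open>a\<close>, the Laplacian of \<open>R\<close> is nonnegative and the
  time derivative of \<open>R\<close> at most \<open>\<psi>'\<close>, so that the reaction term \<open>2 |Ric|\<^sup>2\<close> cannot exceed \<open>\<psi>'\<close>. The evolution equation holds at interior times, and the
  final time follows by continuity.\<close>

lemma weak_max_principle:
  assumes a: "t1 \<le> a" and start: "\<And>p. p \<in> M \<Longrightarrow> \<psi> a \<le> scalar a p"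
    and \<psi>: "\<And>t. (\<psi> has_real_derivative \<psi>') (at t)"
    and reaction: "\<And>t c x. t \<in> {a<..<t2} \<Longrightarrow> c \<in> A \<Longrightarrow> x \<in> img c \<Longrightarrow> scal (metric_in c t) x < \<psi> t \<Longrightarrow>
      \<psi>' < 2 * trace (matrix_inv (metric_in c t x) ** ricci_matrix (metric_in c t) x ** matrix_inv (metric_in c t x) ** ricci_matrix (metric_in c t) x)"
    and t: "t \<in> {a..t2}" and p: "p \<in> M"
  shows "\<psi> t \<le> scalar t p"
proof -
  have inner: "\<psi> b \<le> scalar b p" if b: "a \<le> b" "b < t2" for b
  proof -
    have c\<psi>: "continuous_on {a..b} \<psi>"
      using \<psi> by (meson DERIV_isCont continuous_at_imp_continuous_on)
    obtain ts ps where m: "ts \<in> {a..b}" "ps \<in> M"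
      "\<And>t' p'. t' \<in> {a..b} \<Longrightarrow> p' \<in> M \<Longrightarrow> scalar ts ps - \<psi> ts \<le> scalar t' p' - \<psi> t'"
      using scalar_attains_min[OF b(1) _ c\<psi>] a b p by force
    have "scalar ts ps - \<psi> ts \<ge> 0"
    proof (rule ccontr)
      assume neg: "\<not> scalar ts ps - \<psi> ts \<ge> 0"
      have late: "a < ts"
      proof (rule ccontr)
        assume "\<not> a < ts"
        then have "ts = a" using m(1) by simp
        then show False using start[OF m(2)] neg by simp
      qed
      have ts: "ts \<in> {t1<..<t2}" "ts \<in> {a<..<t2}" "ts \<in> {t1..t2}" using late m(1) a b by auto
      obtain c where c: "c \<in> A" "ps \<in> dom_of c" using covered[OF m(2)] by blast
      interpret f: flow_chart "{t1<..<t2}" "img c" "metric_in c" by (rule flow_chart[OF c(1)])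
      define x where "x = coord c ps"
      have x: "x \<in> img c" by (simp add: x_def coord_img c)
      have ux: "scal (metric_in c ts) x = scalar ts ps" using scalar_chart[OF c ts(3)] by (simp add: x_def)
      have "laplacian (metric_in c ts) (scal (metric_in c ts)) x \<ge> 0"
      proof (rule laplacian_nonneg_at_min[OF f.ck_scal_time[OF ts(1)] open_img[OF c(1)] x])
        show "posdef (metric_in c ts x)" by (rule f.posdef_g[OF ts(1) x])
        fix y assume y: "y \<in> img c"
        then have "param c y \<in> M" using param_dom dom_sub[OF c(1)] by blast
        from m(3)[OF m(1) this] show "scal (metric_in c ts) x \<le> scal (metric_in c ts) y"
          using scalar_param[OF c(1) y ts(3)] ux by simp
      qed
      moreover have "laplacian (metric_in c ts) (scal (metric_in c ts)) x + 2 * f.ricci_sq ts x - \<psi>' \<le> 0"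
      proof (rule derivative_nonpos_at_left_min)
        show "((\<lambda>s. scal (metric_in c s) x - \<psi> s) has_real_derivative
            laplacian (metric_in c ts) (scal (metric_in c ts)) x + 2 * f.ricci_sq ts x - \<psi>') (at ts)"
          by (intro DERIV_diff f.scal_evolution ts(1) x \<psi>)
        show "ts - a > 0" using late by simp
        fix s assume s: "ts - (ts - a) < s" "s < ts"
        then have s': "s \<in> {a..b}" "s \<in> {t1..t2}" using m(1) a b by auto
        show "scal (metric_in c ts) x - \<psi> ts \<le> scal (metric_in c s) x - \<psi> s"
          using m(3)[OF s'(1) m(2)] scalar_chart[OF c s'(2)] ux by (simp add: x_def)
      qed
      moreover have "\<psi>' < 2 * f.ricci_sq ts x"
        using reaction[OF ts(2) c(1) x] ux neg by simp
      ultimately show False by linarith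
    qed
    moreover have "b \<in> {a..b}" using b by simp
    ultimately show ?thesis using m(3)[of b p] p by fastforce
  qed
  show ?thesis
  proof (cases "t < t2")
    case True
    then show ?thesis using inner[of t] t by simp
  next
    case False
    then have t: "t = t2" using t by simp
    show ?thesis
    proof (cases "a = t2")
      case True
      then show ?thesis using start[OF p] t by simp
    next
      case False
      then have at: "a < t2" using t \<open>t \<in> {a..t2}\<close> by simp
      have c: "continuous_on {a..t2} (\<lambda>t. scalar t p - \<psi> t)"
      proof (intro continuous_on_diff)
        show "continuous_on {a..t2} (\<lambda>t. scalar t p)"
          by (rule continuous_on_subset[OF scalar_continuous_time[OF p]]) (use a in auto)
        show "continuous_on {a..t2} \<psi>"
          using \<psi> by (meson DERIV_isCont continuous_at_imp_continuous_on)
      qed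
      have "((\<lambda>t. scalar t p - \<psi> t) \<longlongrightarrow> scalar t2 p - \<psi> t2) (at t2 within {a..t2})"
        using c at by (simp add: continuous_on_def)
      then have "((\<lambda>t. scalar t p - \<psi> t) \<longlongrightarrow> scalar t2 p - \<psi> t2) (at_left t2)"
        using at by (simp add: at_within_Icc_at_left)
      moreover have "\<forall>\<^sub>F t in at_left t2. 0 \<le> scalar t p - \<psi> t"
        using at inner by (auto simp: eventually_at_left intro!: exI[of _ a])
      ultimately have "0 \<le> scalar t2 p - \<psi> t2"
        by (rule tendsto_lowerbound) simp
      then show ?thesis using t by simp
    qed
  qed
qed

text \<open>Compare with the slowly decreasing barrier \<open>r - \<epsilon> (t - a)\<close>, whose slope lies strictly below the
  nonnegative reaction term.\<close>

lemma lower_bound_preserved: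
  assumes a: "t1 \<le> a" and start: "\<And>p. p \<in> M \<Longrightarrow> r \<le> scalar a p"
    and t: "t \<in> {a..t2}" and p: "p \<in> M"
  shows "r \<le> scalar t p"
proof (rule field_le_epsilon)
  fix e :: real assume e: "e > 0"
  define \<epsilon> where "\<epsilon> = e / (t - a + 1)"
  have \<epsilon>: "\<epsilon> > 0" "\<epsilon> * (t - a) \<le> e" using e t by (auto simp: \<epsilon>_def field_simps)
  have "r - \<epsilon> * (t - a) \<le> scalar t p"
  proof (rule weak_max_principle[OF a _ _ _ t p, of "\<lambda>t. r - \<epsilon> * (t - a)" "- \<epsilon>"])
    show "((\<lambda>t. r - \<epsilon> * (t - a)) has_real_derivative - \<epsilon>) (at t)" for t
      by (auto intro!: derivative_eq_intros)
    fix t c x assume tcx: "t \<in> {a<..<t2}" "c \<in> A" "x \<in> img c"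
    interpret f: flow_chart "{t1<..<t2}" "img c" "metric_in c" by (rule flow_chart[OF tcx(2)])
    show "- \<epsilon> < 2 * f.ricci_sq t x"
      using f.ricci_sq_nonneg[of t x] tcx a \<epsilon> by simp
  qed (use start in simp)
  then show "r \<le> scalar t p + e" using \<epsilon> by linarith
qed

text \<open>As long as \<open>R\<close> is below the barrier \<open>r + \<epsilon> (t - t1)\<close>, it lies between \<open>r\<close> and \<open>r + |r| / 2\<close>, so
  \<open>|R| \<ge> |r| / 2\<close> whatever the sign of \<open>r\<close>, and the reaction term \<open>2 |Ric|\<^sup>2 \<ge> 2 R\<^sup>2 / n\<close> exceeds the slope
  \<open>\<epsilon>\<close>. The two bounds in the definition of \<open>\<epsilon>\<close> express just this.\<close>

lemma nonzero_min_increases: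
  assumes start: "\<And>p. p \<in> M \<Longrightarrow> r \<le> scalar t1 p" and r: "r \<noteq> 0"
  shows "\<exists>r' > r. \<forall>p\<in>M. r' \<le> scalar t2 p"
proof -
  define \<epsilon> where "\<epsilon> = min (\<bar>r\<bar> / (2 * (t2 - t1))) (r\<^sup>2 / (4 * CARD('n)))"
  have \<epsilon>: "\<epsilon> > 0" using r t12 by (simp add: \<epsilon>_def)
  have \<epsilon>1: "\<epsilon> * (t2 - t1) \<le> \<bar>r\<bar> / 2"
  proof -
    have "\<epsilon> * (t2 - t1) \<le> \<bar>r\<bar> / (2 * (t2 - t1)) * (t2 - t1)"
      using t12 by (intro mult_right_mono) (auto simp: \<epsilon>_def)
    also have "\<bar>r\<bar> / (2 * (t2 - t1)) * (t2 - t1) = \<bar>r\<bar> / 2"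
      using t12 by (simp add: field_simps)
    finally show ?thesis .
  qed
  have \<epsilon>2: "CARD('n) * \<epsilon> \<le> r\<^sup>2 / 4"
  proof -
    have "CARD('n) * \<epsilon> \<le> CARD('n) * (r\<^sup>2 / (4 * CARD('n)))"
      by (intro mult_left_mono) (auto simp: \<epsilon>_def)
    then show ?thesis by simp
  qed
  have "r + \<epsilon> * (t2 - t1) \<le> scalar t2 p" if p: "p \<in> M" for p
  proof (rule weak_max_principle[OF order_refl _ _ _ _ p, of "\<lambda>t. r + \<epsilon> * (t - t1)" \<epsilon>])
    show "((\<lambda>t. r + \<epsilon> * (t - t1)) has_real_derivative \<epsilon>) (at t)" for t
      by (auto intro!: derivative_eq_intros)
    show "t2 \<in> {t1..t2}" using t12 by simp
    fix t c x assume tcx: "t \<in> {t1<..<t2}" "c \<in> A" "x \<in> img c"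
      and lt: "scal (metric_in c t) x < r + \<epsilon> * (t - t1)"
    interpret f: flow_chart "{t1<..<t2}" "img c" "metric_in c" by (rule flow_chart[OF tcx(2)])
    have "param c x \<in> M" using param_dom[OF tcx(3)] dom_sub[OF tcx(2)] by blast
    then have ge: "r \<le> scal (metric_in c t) x"
      using lower_bound_preserved[OF order_refl start, of t "param c x"] scalar_param[OF tcx(2,3), of t] tcx(1) by simp
    have "\<epsilon> * (t - t1) \<le> \<epsilon> * (t2 - t1)" using \<epsilon> tcx(1) by (intro mult_left_mono) auto
    then have "scal (metric_in c t) x < r + \<bar>r\<bar> / 2" using lt \<epsilon>1 by linarith
    then have "\<bar>r\<bar> / 2 \<le> \<bar>scal (metric_in c t) x\<bar>" using ge by linarith
    then have "(\<bar>r\<bar> / 2)\<^sup>2 \<le> (scal (metric_in c t) x)\<^sup>2"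
      using power_mono[of "\<bar>r\<bar> / 2" "\<bar>scal (metric_in c t) x\<bar>" 2] by simp
    then have "r\<^sup>2 / 4 \<le> CARD('n) * f.ricci_sq t x"
      using f.scal_square_le[OF tcx(1,3)] by (simp add: power_divide)
    then have "CARD('n) * \<epsilon> \<le> CARD('n) * f.ricci_sq t x" using \<epsilon>2 by linarith
    then have "\<epsilon> \<le> f.ricci_sq t x" by simp
    then show "\<epsilon> < 2 * f.ricci_sq t x" using \<epsilon> by simp
  qed (use start in simp)
  moreover have "r < r + \<epsilon> * (t2 - t1)" using \<epsilon> t12 by simp
  ultimately show ?thesis by blast
qed

text \<open>By \<open>positivity_spreads\<close> every point has a neighbourhood, the same for all times, in which positivity at
  one point and time implies positivity at all points and later times. So the set \<open>W\<close> of points where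
  \<open>R\<close> is positive after \<open>t0\<close> is open and closed.\<close>

lemma strong_max_principle:
  assumes nn: "\<And>t p. t \<in> {t1..t2} \<Longrightarrow> p \<in> M \<Longrightarrow> 0 \<le> scalar t p"
    and t0: "t0 \<in> {t1<..<t2}" and p0: "p0 \<in> M" "scalar t0 p0 > 0"
    and t: "t \<in> {t0<..<t2}" and p: "p \<in> M"
  shows "scalar t p > 0"
proof -
  define W where "W = {p \<in> M. \<forall>t\<in>{t0<..<t2}. scalar t p > 0}"
  have spread: "\<exists>N. openin X N \<and> p \<in> N \<and> (\<forall>s t q q'. t1 < s \<longrightarrow> s < t \<longrightarrow> t < t2 \<longrightarrow> q \<in> N \<longrightarrow> q' \<in> N
      \<longrightarrow> scalar s q > 0 \<longrightarrow> scalar t q' > 0)" if p: "p \<in> M" for p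
  proof -
    obtain c \<rho> where c: "c \<in> A" "p \<in> dom_of c" "\<rho> > 0" "cball (coord c p) \<rho> \<subseteq> img c"
      "openin X (param c ` ball (coord c p) \<rho>)" "p \<in> param c ` ball (coord c p) \<rho>"
      using chart_ball[OF p] by blast
    interpret f: flow_chart "{t1<..<t2}" "img c" "metric_in c" by (rule flow_chart[OF c(1)])
    have bi: "ball (coord c p) \<rho> \<subseteq> img c" using c(4) ball_subset_cball by blast
    have "scalar t q' > 0" if st: "t1 < s" "s < t" "t < t2" and q: "q \<in> param c ` ball (coord c p) \<rho>"
      "q' \<in> param c ` ball (coord c p) \<rho>" and pos: "scalar s q > 0" for s t q q'
    proof -
      obtain y z where y: "y \<in> ball (coord c p) \<rho>" "q = param c y" and z: "z \<in> ball (coord c p) \<rho>" "q' = param c z"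
        using q by auto
      have sub: "{s..t} \<subseteq> {t1<..<t2}" using st by auto
      have "scal (metric_in c t) z > 0"
      proof (rule f.positivity_spreads[OF sub st(2) bi _ y(1) _ z(1)])
        show "0 < scal (metric_in c s) y" using pos scalar_param[OF c(1), of y s] y bi st by auto
        fix r x assume "r \<in> {s..t}" "x \<in> ball (coord c p) \<rho>"
        then have "x \<in> img c" "r \<in> {t1..t2}" using bi st by auto
        then show "0 \<le> scal (metric_in c r) x"
          using nn[of r "param c x"] scalar_param[OF c(1), of x r] param_dom dom_sub[OF c(1)] by fastforce
      qed
      then show ?thesis using scalar_param[OF c(1), of z t] z bi st by auto
    qed
    then show ?thesis using c(5,6) by blast
  qed
  \<comment> \<open>Membership in \<open>W\<close> says nothing about the time \<open>t0\<close> itself, so positivity is spread from the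
    intermediate time \<open>(t0 + t) / 2\<close>.\<close>
  have half: "(t0 + t) / 2 \<in> {t0<..<t2} \<and> t1 < (t0 + t) / 2 \<and> (t0 + t) / 2 < t \<and> t < t2" if "t \<in> {t0<..<t2}" for t
    using that t0 by auto
  have step: "q' \<in> W" if N: "openin X N" "q \<in> N" "q \<in> W" "q' \<in> N"
    "\<forall>s t q q'. t1 < s \<longrightarrow> s < t \<longrightarrow> t < t2 \<longrightarrow> q \<in> N \<longrightarrow> q' \<in> N \<longrightarrow> scalar s q > 0 \<longrightarrow> scalar t q' > 0" for N q q'
  proof -
    have "q' \<in> M" using N(1,4) openin_subset by blast
    moreover have "scalar t q' > 0" if "t \<in> {t0<..<t2}" for t
      using half[OF that] N(2-5) unfolding W_def by blast
    ultimately show ?thesis by (simp add: W_def)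
  qed
  have "openin X W"
  proof (subst openin_subopen, intro ballI)
    fix q assume q: "q \<in> W"
    then have "q \<in> M" by (simp add: W_def)
    from spread[OF this] step q show "\<exists>T. openin X T \<and> q \<in> T \<and> T \<subseteq> W" by (metis subsetI)
  qed
  moreover have "openin X (M - W)"
  proof (subst openin_subopen, intro ballI)
    fix q assume q: "q \<in> M - W"
    then obtain N where N: "openin X N" "q \<in> N"
      "\<forall>s t q q'. t1 < s \<longrightarrow> s < t \<longrightarrow> t < t2 \<longrightarrow> q \<in> N \<longrightarrow> q' \<in> N \<longrightarrow> scalar s q > 0 \<longrightarrow> scalar t q' > 0"
      using spread[of q] by blast
    have "N \<subseteq> M - W"
    proof
      fix q' assume q': "q' \<in> N"
      then have "q' \<in> M" using N(1) openin_subset by blast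
      moreover have "q' \<notin> W" using step[OF N(1) q' _ N(2) N(3)] q by blast
      ultimately show "q' \<in> M - W" by simp
    qed
    then show "\<exists>T. openin X T \<and> q \<in> T \<and> T \<subseteq> M - W" using N by blast
  qed
  moreover have "p0 \<in> W"
  proof -
    obtain N where "openin X N" "p0 \<in> N"
      "\<forall>s t q q'. t1 < s \<longrightarrow> s < t \<longrightarrow> t < t2 \<longrightarrow> q \<in> N \<longrightarrow> q' \<in> N \<longrightarrow> scalar s q > 0 \<longrightarrow> scalar t q' > 0"
      using spread[OF p0(1)] by blast
    then show ?thesis using p0 t0 by (auto simp: W_def)
  qed
  moreover have "W \<subseteq> M" by (auto simp: W_def)
  ultimately have "W = M"
    using connected_M unfolding connected_space_clopen_in closedin_def by blast
  then have "p \<in> W" using p by simp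
  then show ?thesis using t by (simp add: W_def)
qed

lemma ricci_flat_if_scal_zero:
  assumes zero: "\<And>t p. t \<in> {t1<..<t2} \<Longrightarrow> p \<in> M \<Longrightarrow> scalar t p = 0" and t: "t \<in> {t1..t2}"
  shows "ricci_flat A (g t)"
  unfolding ricci_flat_def
proof (intro ballI)
  fix c p assume c: "c \<in> A" and p: "p \<in> dom_of c"
  interpret f: flow_chart "{t1<..<t2}" "img c" "metric_in c" by (rule flow_chart[OF c])
  let ?x = "coord c p"
  have x: "?x \<in> img c" by (rule coord_img[OF p])
  have z: "scal (metric_in c s) y = 0" if "s \<in> {t1<..<t2}" "y \<in> img c" for s y
    using zero[OF that(1), of "param c y"] scalar_param[OF c that(2), of s] that param_dom[OF that(2)] dom_sub[OF c] by auto
  have inner: "ricci_matrix (metric_in c s) ?x = 0" if s: "s \<in> {t1<..<t2}" for s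
  proof -
    have p1: "pderiv_coord k (scal (metric_in c s)) y = 0" if "y \<in> img c" for k y
      using pderiv_cong_open[OF open_img[OF c] that, of "scal (metric_in c s)" "\<lambda>_. 0" k] z[OF s] by simp
    have p2: "pderiv_coord j (pderiv_coord k (scal (metric_in c s))) ?x = 0" for j k
      using pderiv_cong_open[OF open_img[OF c] x, of "pderiv_coord k (scal (metric_in c s))" "\<lambda>_. 0" j] p1 by simp
    have "laplacian (metric_in c s) (scal (metric_in c s)) ?x = 0"
      unfolding laplacian_def p1[OF x] p2 by simp
    then have "((\<lambda>s. scal (metric_in c s) ?x) has_real_derivative 2 * f.ricci_sq s ?x) (at s)"
      using f.scal_evolution[OF s x] by simp
    moreover have "((\<lambda>s. scal (metric_in c s) ?x) has_real_derivative 0) (at s)"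
      by (rule has_field_derivative_transform_within_open[of "\<lambda>_. 0" 0 s "{t1<..<t2}"])
        (use s z x in auto)
    ultimately have "2 * f.ricci_sq s ?x = 0" by (rule DERIV_unique)
    then show ?thesis
      using norm_zero_imp_zero[OF f.posdef_g[OF s x] f.ricci_sym[OF s x]] by simp
  qed
  have "ricci_matrix (metric_in c t) ?x $ a $ b = 0" for a b
  proof -
    have "continuous_on ({t1..t2} \<times> img c) (\<lambda>(t, x). ricci_matrix (metric_in c t) x $ a $ b)"
      using ck_continuous_on[OF metric_strip.smooth_ricci_strip[OF strip[OF c]]] .
    then have "continuous_on {t1..t2} (\<lambda>t. (\<lambda>(t, x). ricci_matrix (metric_in c t) x $ a $ b) (t, ?x))"
      by (rule continuous_on_compose2) (auto intro!: continuous_intros x)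
    then have "continuous_on (closure {t1<..<t2}) (\<lambda>t. ricci_matrix (metric_in c t) ?x $ a $ b)"
      using t12 by simp
    then show ?thesis
      by (rule continuous_constant_on_closure) (use inner t t12 in auto)
  qed
  then show "ricci (g t) c p = 0" by (simp add: ricci_metric_in vec_eq_iff)
qed

text \<open>\<^const>\<open>pullback\<close> picks a chart around the image of every point separately, while the comparison in
  coordinates requires one target chart near the point. The transformation law of \<open>g t1\<close> and the chain
  rule connect the two.\<close>

lemma scal_invariant_breather:
  assumes \<Phi>: "smooth_map X A \<Phi>" and p: "p \<in> M"
    and iso: "\<And>c p. c \<in> A \<Longrightarrow> p \<in> dom_of c \<Longrightarrow> g t2 c p = pullback A \<Phi> (g t1) c p"
  shows "scalar t2 p = scalar t1 (\<Phi> p)"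
proof -
  have cont: "continuous_map X X \<Phi>" using \<Phi> by (simp add: smooth_map_def)
  have \<Phi>M: "\<Phi> q \<in> M" if "q \<in> M" for q
    using that cont by (auto simp: continuous_map_def)
  obtain c where c: "c \<in> A" "p \<in> dom_of c" using covered[OF p] by blast
  obtain d where d: "d \<in> A" "\<Phi> p \<in> dom_of d" using covered[OF \<Phi>M[OF p]] by blast
  have "scal (metric_in c t2) (coord c p) = scal (metric_in d t1) (coord d (\<Phi> p))"
  proof (rule scal_under_isometry[OF \<Phi> c(1) d(1) c(2) d(2)])
    fix q assume q: "q \<in> dom_of c" "\<Phi> q \<in> dom_of d"
    define e where "e = (SOME d. d \<in> A \<and> \<Phi> q \<in> dom_of d)"
    have "e \<in> A \<and> \<Phi> q \<in> dom_of e"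
      unfolding e_def by (rule someI[of _ d]) (use d q in auto)
    then have e: "e \<in> A" "\<Phi> q \<in> dom_of e" by auto
    let ?x = "coord c q"
    let ?\<phi> = "coord e \<circ> \<Phi> \<circ> param c" and ?\<psi> = "coord d \<circ> param e" and ?\<xi> = "coord d \<circ> \<Phi> \<circ> param c"
    have pq: "param c ?x = q" "param e (coord e (\<Phi> q)) = \<Phi> q"
      using param_coord c e q by auto
    define D :: "('a, 'n) chart \<Rightarrow> 'a set" where "D f = {q \<in> dom_of c. \<Phi> q \<in> dom_of f}" for f
    have oD: "open (coord c ` D f)" if "f \<in> A" for f
      unfolding D_def by (rule open_overlap[OF cont c(1) that])
    have d1: "?\<phi> differentiable (at ?x)"
    proof (rule ck_differentiable[OF ck_if_smooth_on oD[OF e(1)]])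
      show "smooth_on (coord c ` D e) ?\<phi>"
        using \<Phi> c e by (simp add: smooth_map_def D_def)
      show "?x \<in> coord c ` D e" using q e by (auto simp: D_def)
    qed
    have d2: "?\<psi> differentiable (at (?\<phi> ?x))"
    proof (rule ck_differentiable[OF ck_if_smooth_on])
      show "smooth_on (coord e ` (dom_of e \<inter> dom_of d)) ?\<psi>"
        using atlas e d by (simp add: smooth_atlas_def)
      show "open (coord e ` (dom_of e \<inter> dom_of d))"
        by (intro open_coord_image[OF e(1)] openin_Int open_dom e(1) d(1)) auto
      show "?\<phi> ?x \<in> coord e ` (dom_of e \<inter> dom_of d)"
        using q e pq by auto
    qed
    have "jacobian ?\<xi> (at ?x) = jacobian ?\<psi> (at (?\<phi> ?x)) ** jacobian ?\<phi> (at ?x)"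
    proof (rule jacobian_compose[OF d1 d2 oD[OF e(1)]])
      show "?x \<in> coord c ` D e" using q e by (auto simp: D_def)
      fix y assume "y \<in> coord c ` D e"
      then show "?\<xi> y = ?\<psi> (?\<phi> y)"
        using param_coord[OF c(1)] param_coord[OF e(1)] by (auto simp: D_def)
    qed
    moreover have "g t1 e (\<Phi> q) = congr_transform (jacobian ?\<psi> (at (coord e (\<Phi> q)))) (g t1 d (\<Phi> q))"
      by (rule metric_transform) (use t12 e d q in auto)
    moreover have "g t2 c q = congr_transform (jacobian ?\<phi> (at ?x)) (g t1 e (\<Phi> q))"
      using iso[OF c(1) q(1)] by (simp add: pullback_def e_def Let_def)
    ultimately show "g t2 c q = congr_transform (jacobian ?\<xi> (at ?x)) (g t1 d (\<Phi> q))"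
      by (simp add: congr_transform_compose pq)
  qed (use t12 in auto)
  then show ?thesis
    using scalar_chart[OF c, of t2] scalar_chart[OF d, of t1] t12 by simp
qed

end

section \<open>Steady breathers\<close>

theorem corollary5p5:
  fixes X :: "'a topology"
    and A :: "('a, 'n::finite) chart set"
    and g :: "real \<Rightarrow> ('a, 'n) tensor2"
    and t1 t2 :: real
  assumes "closed_connected_manifold X A"
    and "steady_breather X A t1 t2 g"
  shows "\<forall>t\<in>{t1..t2}. ricci_flat A (g t)"
proof -
  obtain \<Phi> where t12: "t1 < t2" and flow: "ricci_flow A t1 t2 g" and \<Phi>: "diffeomorphism X A \<Phi>"
    and iso: "\<And>c p. c \<in> A \<Longrightarrow> p \<in> dom_of c \<Longrightarrow> g t2 c p = pullback A \<Phi> (g t1) c p"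
    using assms(2) by (auto simp: steady_breather_def ricci_breather_def)
  interpret closed_flow X A g t1 t2
    by unfold_locales (fact assms(1) t12 flow)+
  obtain \<Psi> where \<Psi>: "smooth_map X A \<Psi>" "\<And>p. p \<in> M \<Longrightarrow> \<Phi> (\<Psi> p) = p" and s\<Phi>: "smooth_map X A \<Phi>"
    using \<Phi> by (auto simp: diffeomorphism_def)
  have \<Psi>M: "\<Psi> p \<in> M" if "p \<in> M" for p
    using that \<Psi>(1) by (auto simp: smooth_map_def continuous_map_def)
  have \<Phi>M: "\<Phi> p \<in> M" if "p \<in> M" for p
    using that s\<Phi> by (auto simp: smooth_map_def continuous_map_def)
  show ?thesis
  proof (cases "M = {}")
    case True
    then have "dom_of c = {}" if "c \<in> A" for c using dom_sub[OF that] by simp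
    then show ?thesis by (auto simp: ricci_flat_def)
  next
    case False
    have "\<exists>p\<in>M. \<forall>p'\<in>M. scalar t1 p \<le> scalar t1 p'"
      using scalar_attains_min[of t1 t1 "\<lambda>_. 0"] t12 False by simp
    then obtain p1 where p1: "p1 \<in> M" "\<And>p. p \<in> M \<Longrightarrow> scalar t1 p1 \<le> scalar t1 p" by blast
    define r where "r = scalar t1 p1"
    have start: "r \<le> scalar t1 p" if "p \<in> M" for p using p1(2)[OF that] by (simp add: r_def)
    have q: "\<Psi> p1 \<in> M" "scalar t2 (\<Psi> p1) = r"
      using scal_invariant_breather[OF s\<Phi> \<Psi>M[OF p1(1)] iso] \<Psi>M p1(1) \<Psi>(2) by (auto simp: r_def)
    have "r = 0"
      using nonzero_min_increases[OF start] q by fastforce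
    then have nn: "0 \<le> scalar t p" if "t \<in> {t1..t2}" "p \<in> M" for t p
      using lower_bound_preserved[OF order_refl start that] by simp
    have zero: "scalar t0 p0 = 0" if t0: "t0 \<in> {t1<..<t2}" and p0: "p0 \<in> M" for t0 p0
    proof (rule ccontr)
      assume "scalar t0 p0 \<noteq> 0"
      then have pos: "scalar t0 p0 > 0" using nn[of t0 p0] t0 p0 by fastforce
      define s where "s = (t0 + t2) / 2"
      have s: "s \<in> {t0<..<t2}" "t1 \<le> s" "s \<le> t2" using t0 by (auto simp: s_def)
      have "\<exists>p\<in>M. \<forall>p'\<in>M. scalar s p \<le> scalar s p'"
        using scalar_attains_min[of s s "\<lambda>_. 0"] s False by simp
      then obtain p2 where p2: "p2 \<in> M" "\<And>p. p \<in> M \<Longrightarrow> scalar s p2 \<le> scalar s p" by blast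
      have "scalar s p2 > 0" by (rule strong_max_principle[OF nn t0 p0 pos s(1) p2(1)])
      moreover have "scalar s p2 \<le> scalar t2 (\<Psi> p1)"
        by (rule lower_bound_preserved[OF s(2) p2(2)]) (use s q in auto)
      ultimately show False using q(2) \<open>r = 0\<close> by simp
    qed
    show ?thesis using ricci_flat_if_scal_zero[OF zero] by blast
  qed
qed

end
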